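(* Let $\mathcal X$ and $\mathcal Y$ be categories. Then $(\overline\Gamma:\overline{\mathsf{Herd}}(\mathcal X,\mathcal Y)\to\mathsf{PreTor}(\mathcal X,\mathcal Y),\ \overline\Upsilon:\mathsf{PreTor}(\mathcal X,\mathcal Y)\to\overline{\mathsf{Herd}}(\mathcal X,\mathcal Y))$ is an adjoint pair and $\overline\Gamma$ is a full and faithful functor. Furthermore, $(\overline\Gamma,\overline\Upsilon)$ is a pair of inverse equivalences between the categories of pre-torsors and balanced herd functors if and only if, for all pre-torsors $(\mathcal Z,(L_A,R_A),(L_B,R_B),\tau)\in\mathsf{PreTor}(\mathcal X,\mathcal Y)$, $(R_A,R_B)$ is a moritable pair. In particular, if $(\Gamma,\Upsilon)$ is a pair of inverse equivalences, then so is $(\overline\Gamma,\overline\Upsilon)$.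
   Context: Composition of functors is juxtaposition; identities are denoted by the object/functor itself; juxtaposition of natural transformations such as $\phi^3\phi^4\phi^3$ is the Godement product. In an adjoint pair the left adjoint is listed first. Bialgebra functors. For monads $\mathbf A=(A,\mathsf m^A,\mathsf u^A)$ on $\mathcal X$ and $\mathbf B=(B,\mathsf m^B,\mathsf u^B)$ on $\mathcal Y$, an $\mathbf A$-$\mathbf B$ bialgebra functor $\mathbf T=(T,\lambda,\rho)$ is a functor $T:\mathcal Y\to\mathcal X$ with natural transformations $\lambda:AT\to T$, $\rho:TB\to T$ such that $\rho\circ T\mathsf m^B=\rho\circ\rho B$, $\rho\circ T\mathsf u^B=T$, $\lambda\circ\mathsf m^AT=\lambda\circ A\lambda$, $\lambda\circ\mathsf u^AT=T$, $\rho\circ\lambda B=\lambda\circ A\rho$. Category $\mathsf{Mor}(\mathcal X,\mathcal Y)$ of Morita contexts. Objects $\mathbb T=(\mathbf A,\mathbf B,\mathbf T,\widehat{\mathbf T},\mathrm{ev},\widehat{\mathrm{ev}})$: monads $\mathbf A$ on $\mathcal X$, $\mathbf B$ on $\mathcal Y$, an $\mathbf A$-$\mathbf B$ bialgebra functor $\mathbf T=(T,\lambda,\rho)$, a $\mathbf B$-$\mathbf A$ bialgebra functor $\widehat{\mathbf T}=(\widehat T:\mathcal X\to\mathcal Y,\hat\lambda:B\widehat T\to\widehat T,\hat\rho:\widehat TA\to\widehat T)$, natural transformations $\mathrm{ev}:T\widehat T\to A$, $\widehat{\mathrm{ev}}:\widehat TT\to B$ with $\mathrm{ev}\circ\lambda\widehat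 T=\mathsf m^A\circ A\,\mathrm{ev}$, $\mathrm{ev}\circ T\hat\rho=\mathsf m^A\circ\mathrm{ev}A$, $\widehat{\mathrm{ev}}\circ\hat\lambda T=\mathsf m^B\circ B\,\widehat{\mathrm{ev}}$, $\widehat{\mathrm{ev}}\circ\widehat T\rho=\mathsf m^B\circ\widehat{\mathrm{ev}}B$, $\rho\circ T\widehat{\mathrm{ev}}=\lambda\circ\mathrm{ev}T$, $\hat\lambda\circ\widehat{\mathrm{ev}}\widehat T=\hat\rho\circ\widehat T\mathrm{ev}$, $\widehat{\mathrm{ev}}\circ\widehat T\lambda=\widehat{\mathrm{ev}}\circ\hat\rho T$, $\mathrm{ev}\circ\rho\widehat T=\mathrm{ev}\circ T\hat\lambda$. Morphisms $\mathbb T\to\mathbb T'$: quadruples $(\phi^1,\phi^2,\phi^3,\phi^4)$ with $\phi^1:\mathbf A\to\mathbf A'$, $\phi^2:\mathbf B\to\mathbf B'$ monad morphisms, natural transformations $\phi^3:T\to T'$, $\phi^4:\widehat T\to\widehat T'$ with $\phi^3\circ\rho=\rho'\circ T'\phi^2\circ\phi^3B$, $\phi^3\circ\lambda=\lambda'\circ\phi^1T'\circ A\phi^3$, $\phi^4\circ\hat\rho=\hat\rho'\circ\widehat T'\phi^1\circ\phi^4A$, $\phi^4\circ\hat\lambda=\hat\lambda'\circ\phi^2\widehat T'\circ B\phi^4$, $\phi^1\circ\mathrm{ev}=\mathrm{ev}'\circ\phi^3\phi^4$, $\phi^2\circ\widehat{\mathrm{ev}}=\widehat{\mathrm{ev}}'\circ\phi^4\phi^3$.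 Category $\mathsf{Adj}(\mathcal X,\mathcal Y)$ of double adjunctions. Objects $\mathfrak Z=(\mathcal Z,(L_A,R_A),(L_B,R_B))$: a category $\mathcal Z$ with adjunctions $(L_A:\mathcal X\to\mathcal Z,R_A:\mathcal Z\to\mathcal X)$, $(L_B:\mathcal Y\to\mathcal Z,R_B:\mathcal Z\to\mathcal Y)$, units $\eta^A,\eta^B$, counits $\varepsilon^A,\varepsilon^B$. A morphism $\mathfrak Z\to\mathfrak Z'$ is a functor $F:\mathcal Z'\to\mathcal Z$ with $R_AF=R'_A$, $R_BF=R'_B$; put $a=(\varepsilon^AFL'_A)\circ(L_A\eta'^A):L_A\to FL'_A$, $b=(\varepsilon^BFL'_B)\circ(L_B\eta'^B):L_B\to FL'_B$. Functor $\Upsilon:\mathsf{Adj}(\mathcal X,\mathcal Y)\to\mathsf{Mor}(\mathcal X,\mathcal Y)$: $\Upsilon(\mathfrak Z)$ has monads $(R_AL_A,R_A\varepsilon^AL_A,\eta^A)$, $(R_BL_B,R_B\varepsilon^BL_B,\eta^B)$, bialgebra functors $(R_AL_B,R_A\varepsilon^AL_B,R_A\varepsilon^BL_B)$, $(R_BL_A,R_B\varepsilon^BL_A,R_B\varepsilon^AL_A)$ and $\mathrm{ev}=R_A\varepsilon^BL_A$, $\widehat{\mathrm{ev}}=R_B\varepsilon^AL_B$; $\Upsilon(F)=(R_Aa,R_Bb,R_Ab,R_Ba)$. Eilenberg-Moore category $(\mathcal X,\mathcal Y)^{\mathbb T}$: objects $((X,\rho^X),(Y,\rho^Y),v,w)$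 with $(X,\rho^X)$ an $\mathbf A$-algebra, $(Y,\rho^Y)$ a $\mathbf B$-algebra, $v:TY\to X$, $w:\widehat TX\to Y$ with $v\circ\lambda Y=\rho^X\circ Av$, $w\circ\hat\lambda X=\rho^Y\circ Bw$, $v\circ Tw=\rho^X\circ\mathrm{ev}X$, $w\circ\widehat Tv=\rho^Y\circ\widehat{\mathrm{ev}}Y$, $w\circ\widehat T\rho^X=w\circ\hat\rho X$, $v\circ T\rho^Y=v\circ\rho Y$; morphisms are pairs $(f,g)$ of algebra morphisms with $g\circ w=w'\circ\widehat Tf$, $f\circ v=v'\circ Tg$. Functor $\Gamma:\mathsf{Mor}(\mathcal X,\mathcal Y)\to\mathsf{Adj}(\mathcal X,\mathcal Y)$: $\Gamma(\mathbb T)=((\mathcal X,\mathcal Y)^{\mathbb T},(G_A,U_A),(G_B,U_B))$ with $U_A,U_B$ forgetful to $X$, resp. $Y$, $G_AX=((AX,\mathsf m^AX),(\widehat TX,\hat\lambda X),\mathrm{ev}X,\hat\rho X)$, $G_BY=((TY,\lambda Y),(BY,\mathsf m^BY),\rho Y,\widehat{\mathrm{ev}}Y)$, $G_Af=(Af,\widehat Tf)$, $G_Bg=(Tg,Bg)$, units $\mathsf u^A,\mathsf u^B$, counits $(\rho^X,w)$ and $(v,\rho^Y)$; $\Gamma(\phi)$ is the functor $(\mathcal X,\mathcal Y)^{\mathbb T'}\to(\mathcal X,\mathcal Y)^{\mathbb T}$, $((X,\rho^X),(Y,\rho^Y),v,w)\mapsto((X,\rho^X\circ\phi^1X),(Y,\rho^Y\circ\phi^2Y),v\circ\phi^3Y,w\circ\phi^4X)$,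 identity on morphisms. Moritability. For a double adjunction $\mathfrak Z$ with $\mathbb T=\Upsilon(\mathfrak Z)$, $(R_A,R_B)$ is moritable if the comparison functor $K:\mathcal Z\to(\mathcal X,\mathcal Y)^{\mathbb T}$, $KZ=((R_AZ,R_A\varepsilon^AZ),(R_BZ,R_B\varepsilon^BZ),R_A\varepsilon^BZ,R_B\varepsilon^AZ)$, $Kf=(R_Af,R_Bf)$, is an equivalence of categories. Balanced herds. $\overline{\mathsf{Herd}}(\mathcal X,\mathcal Y)$ has as objects Morita contexts $\mathbb T$ together with a natural transformation (shepherd) $\gamma:T\to T\widehat TT$ such that $T\widehat{\mathrm{ev}}\circ\gamma=T\mathsf u^B$, $\mathrm{ev}T\circ\gamma=\mathsf u^AT$, $T\widehat T\gamma\circ\gamma=\gamma\widehat TT\circ\gamma$. Morphisms are morphisms of Morita contexts with $\phi^3\phi^4\phi^3\circ\gamma=\gamma'\circ\phi^3$. Pre-torsors. $\mathsf{PreTor}(\mathcal X,\mathcal Y)$ has as objects double adjunctions $\mathfrak Z$ together with a natural transformation $\tau:R_AL_B\to R_AL_BR_BL_AR_AL_B$ such that $R_AL_BR_B\varepsilon^AL_B\circ\tau=R_AL_B\eta^B$, $R_A\varepsilon^BL_AR_AL_B\circ\tau=\eta^AR_AL_B$, $R_AL_BR_BL_A\tau\circ\tau=\tau R_BL_AR_AL_B\circ\tau$. Morphisms are morphisms $F$ in $\mathsf{Adj}(\mathcal X,\mathcal Y)$ with $(R_Ab\,R_Ba\,R_Ab)\circ\tau=\tau'\circ R_Ab$.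 The functors $\overline\Upsilon$, $\overline\Gamma$ are $(\mathfrak Z,\tau)\mapsto(\Upsilon\mathfrak Z,\tau)$ and $(\mathbb T,\gamma)\mapsto(\Gamma\mathbb T,\gamma)$ (note $T=U_AG_B$, $\widehat T=U_BG_A$), acting on morphisms as $\Upsilon$ and $\Gamma$. *)

theory Defs
  imports Main "HOL-Library.FuncSet"
begin

section \<open>Categories, functors and natural transformations\<close>

text \<open>
  All structure maps take the value \<^const>\<open>undefined\<close> outside their domains.  With this
  convention, equality in HOL of categories, functors and natural transformations is equality of
  the mathematical objects, so that strict equations between functors can be written with \<open>=\<close>,
  and functor composition is strictly associative and unital.
\<close>

record ('o, 'a) cat =
  Obj :: "'o set"
  Arr :: "'a set"
  Dom :: "'a \<Rightarrow> 'o"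
  Cod :: "'a \<Rightarrow> 'o"
  Ide :: "'o \<Rightarrow> 'a"
  Comp :: "'a \<Rightarrow> 'a \<Rightarrow> 'a"

notation Comp ("_ \<cdot>\<index> _" [66, 65] 65)

definition Hom :: "('o, 'a) cat \<Rightarrow> 'o \<Rightarrow> 'o \<Rightarrow> 'a set" where
  "Hom C x y = {f \<in> Arr C. Dom C f = x \<and> Cod C f = y}"

definition category :: "('o, 'a) cat \<Rightarrow> bool" where
  "category C \<longleftrightarrow>
     (\<forall>f \<in> Arr C. Dom C f \<in> Obj C \<and> Cod C f \<in> Obj C) \<and>
     (\<forall>x \<in> Obj C. Ide C x \<in> Hom C x x) \<and>
     (\<forall>x y z f g. f \<in> Hom C x y \<longrightarrow> g \<in> Hom C y z \<longrightarrow> g \<cdot>\<^bsub>C\<^esub> f \<in> Hom C x z) \<and>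
     (\<forall>x y f. f \<in> Hom C x y \<longrightarrow> f \<cdot>\<^bsub>C\<^esub> Ide C x = f \<and> Ide C y \<cdot>\<^bsub>C\<^esub> f = f) \<and>
     (\<forall>x y z w f g h. f \<in> Hom C x y \<longrightarrow> g \<in> Hom C y z \<longrightarrow> h \<in> Hom C z w \<longrightarrow>
        h \<cdot>\<^bsub>C\<^esub> (g \<cdot>\<^bsub>C\<^esub> f) = (h \<cdot>\<^bsub>C\<^esub> g) \<cdot>\<^bsub>C\<^esub> f) \<and>
     Dom C \<in> extensional (Arr C) \<and> Cod C \<in> extensional (Arr C) \<and> Ide C \<in> extensional (Obj C) \<and>
     (\<forall>g f. \<not> (f \<in> Arr C \<and> g \<in> Arr C \<and> Dom C g = Cod C f) \<longrightarrow> g \<cdot>\<^bsub>C\<^esub> f = undefined)"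

definition mk_cat ::
  "'o set \<Rightarrow> 'a set \<Rightarrow> ('a \<Rightarrow> 'o) \<Rightarrow> ('a \<Rightarrow> 'o) \<Rightarrow> ('o \<Rightarrow> 'a) \<Rightarrow> ('a \<Rightarrow> 'a \<Rightarrow> 'a) \<Rightarrow> ('o, 'a) cat" where
  "mk_cat Ob Ar d c i m =
     \<lparr>Obj = Ob, Arr = Ar, Dom = restrict d Ar, Cod = restrict c Ar, Ide = restrict i Ob,
      Comp = (\<lambda>g f. if f \<in> Ar \<and> g \<in> Ar \<and> d g = c f then m g f else undefined)\<rparr>"

text \<open>
  The category with given objects, hom-sets, identities and composition; an arrow is a triple of
  its domain, the underlying morphism and its codomain.
\<close>

definition hom_cat ::
  "'o set \<Rightarrow> ('o \<Rightarrow> 'o \<Rightarrow> 'm set) \<Rightarrow> ('o \<Rightarrow> 'm) \<Rightarrow> ('m \<Rightarrow> 'm \<Rightarrow> 'm) \<Rightarrow> ('o, 'o \<times> 'm \<times> 'o) cat" where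
  "hom_cat Ob H i m =
     mk_cat Ob {(a, f, b). a \<in> Ob \<and> b \<in> Ob \<and> f \<in> H a b}
       (\<lambda>(a, f, b). a) (\<lambda>(a, f, b). b) (\<lambda>a. (a, i a, a))
       (\<lambda>(b', g, c) (a, f, b). (a, m g f, c))"

record ('o, 'a, 'p, 'b) func =
  Src :: "('o, 'a) cat"
  Tgt :: "('p, 'b) cat"
  Fo :: "'o \<Rightarrow> 'p"
  Fa :: "'a \<Rightarrow> 'b"

definition is_functor ::
  "('o, 'a, 'p, 'b) func \<Rightarrow> ('o, 'a) cat \<Rightarrow> ('p, 'b) cat \<Rightarrow> bool" where
  "is_functor F C D \<longleftrightarrow>
     category C \<and> category D \<and> Src F = C \<and> Tgt F = D \<and>
     Fo F \<in> extensional (Obj C) \<and> Fa F \<in> extensional (Arr C) \<and>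
     (\<forall>x \<in> Obj C. Fo F x \<in> Obj D) \<and>
     (\<forall>x y f. f \<in> Hom C x y \<longrightarrow> Fa F f \<in> Hom D (Fo F x) (Fo F y)) \<and>
     (\<forall>x \<in> Obj C. Fa F (Ide C x) = Ide D (Fo F x)) \<and>
     (\<forall>x y z f g. f \<in> Hom C x y \<longrightarrow> g \<in> Hom C y z \<longrightarrow>
        Fa F (g \<cdot>\<^bsub>C\<^esub> f) = Fa F g \<cdot>\<^bsub>D\<^esub> Fa F f)"

definition mk_func ::
  "('o, 'a) cat \<Rightarrow> ('p, 'b) cat \<Rightarrow> ('o \<Rightarrow> 'p) \<Rightarrow> ('a \<Rightarrow> 'b) \<Rightarrow> ('o, 'a, 'p, 'b) func" where
  "mk_func C D fo fa = \<lparr>Src = C, Tgt = D, Fo = restrict fo (Obj C), Fa = restrict fa (Arr C)\<rparr>"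

definition idf :: "('o, 'a) cat \<Rightarrow> ('o, 'a, 'o, 'a) func" where
  "idf C = mk_func C C (\<lambda>x. x) (\<lambda>f. f)"

definition fcomp ::
  "('p, 'b, 'q, 'c) func \<Rightarrow> ('o, 'a, 'p, 'b) func \<Rightarrow> ('o, 'a, 'q, 'c) func" (infixr "\<odot>" 80) where
  "G \<odot> F = mk_func (Src F) (Tgt G) (\<lambda>x. Fo G (Fo F x)) (\<lambda>f. Fa G (Fa F f))"

record ('o, 'a, 'p, 'b) ntrans =
  NSrc :: "('o, 'a, 'p, 'b) func"
  NTgt :: "('o, 'a, 'p, 'b) func"
  At :: "'o \<Rightarrow> 'b"

definition is_nt ::
  "('o, 'a, 'p, 'b) ntrans \<Rightarrow> ('o, 'a, 'p, 'b) func \<Rightarrow> ('o, 'a, 'p, 'b) func \<Rightarrow> bool" where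
  "is_nt \<alpha> F G \<longleftrightarrow>
     is_functor F (Src F) (Tgt F) \<and> is_functor G (Src F) (Tgt F) \<and> NSrc \<alpha> = F \<and> NTgt \<alpha> = G \<and>
     At \<alpha> \<in> extensional (Obj (Src F)) \<and>
     (\<forall>x \<in> Obj (Src F). At \<alpha> x \<in> Hom (Tgt F) (Fo F x) (Fo G x)) \<and>
     (\<forall>x y f. f \<in> Hom (Src F) x y \<longrightarrow>
        At \<alpha> y \<cdot>\<^bsub>Tgt F\<^esub> Fa F f = Fa G f \<cdot>\<^bsub>Tgt F\<^esub> At \<alpha> x)"

definition mk_nt ::
  "('o, 'a, 'p, 'b) func \<Rightarrow> ('o, 'a, 'p, 'b) func \<Rightarrow> ('o \<Rightarrow> 'b) \<Rightarrow> ('o, 'a, 'p, 'b) ntrans" where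
  "mk_nt F G c = \<lparr>NSrc = F, NTgt = G, At = restrict c (Obj (Src F))\<rparr>"

definition idn :: "('o, 'a, 'p, 'b) func \<Rightarrow> ('o, 'a, 'p, 'b) ntrans" where
  "idn F = mk_nt F F (\<lambda>x. Ide (Tgt F) (Fo F x))"

definition vcomp ::
  "('o, 'a, 'p, 'b) ntrans \<Rightarrow> ('o, 'a, 'p, 'b) ntrans \<Rightarrow> ('o, 'a, 'p, 'b) ntrans" (infixr "\<bullet>" 55) where
  "\<beta> \<bullet> \<alpha> = mk_nt (NSrc \<alpha>) (NTgt \<beta>) (\<lambda>x. At \<beta> x \<cdot>\<^bsub>Tgt (NSrc \<alpha>)\<^esub> At \<alpha> x)"

text \<open>The juxtapositions \<open>F\<alpha>\<close> and \<open>\<alpha>F\<close> of a functor and a natural transformation.\<close>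

definition whisker_left ::
  "('p, 'b, 'q, 'c) func \<Rightarrow> ('o, 'a, 'p, 'b) ntrans \<Rightarrow> ('o, 'a, 'q, 'c) ntrans" (infixr "\<rhd>" 70) where
  "F \<rhd> \<alpha> = mk_nt (F \<odot> NSrc \<alpha>) (F \<odot> NTgt \<alpha>) (\<lambda>x. Fa F (At \<alpha> x))"

definition whisker_right ::
  "('p, 'b, 'q, 'c) ntrans \<Rightarrow> ('o, 'a, 'p, 'b) func \<Rightarrow> ('o, 'a, 'q, 'c) ntrans" (infixl "\<lhd>" 75) where
  "\<alpha> \<lhd> F = mk_nt (NSrc \<alpha> \<odot> F) (NTgt \<alpha> \<odot> F) (\<lambda>x. At \<alpha> (Fo F x))"

definition godement ::
  "('p, 'b, 'q, 'c) ntrans \<Rightarrow> ('o, 'a, 'p, 'b) ntrans \<Rightarrow> ('o, 'a, 'q, 'c) ntrans" (infixr "\<star>" 60) where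
  "\<alpha> \<star> \<beta> = (\<alpha> \<lhd> NTgt \<beta>) \<bullet> (NSrc \<alpha> \<rhd> \<beta>)"

definition is_adjunction ::
  "('o, 'a) cat \<Rightarrow> ('p, 'b) cat \<Rightarrow> ('o, 'a, 'p, 'b) func \<Rightarrow> ('p, 'b, 'o, 'a) func \<Rightarrow>
   ('o, 'a, 'o, 'a) ntrans \<Rightarrow> ('p, 'b, 'p, 'b) ntrans \<Rightarrow> bool" where
  "is_adjunction C D L R \<eta> \<epsilon> \<longleftrightarrow>
     is_functor L C D \<and> is_functor R D C \<and>
     is_nt \<eta> (idf C) (R \<odot> L) \<and> is_nt \<epsilon> (L \<odot> R) (idf D) \<and>
     (\<epsilon> \<lhd> L) \<bullet> (L \<rhd> \<eta>) = idn L \<and> (R \<rhd> \<epsilon>) \<bullet> (\<eta> \<lhd> R) = idn R"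

definition adjoint_pair :: "('o, 'a, 'p, 'b) func \<Rightarrow> ('p, 'b, 'o, 'a) func \<Rightarrow> bool" where
  "adjoint_pair L R \<longleftrightarrow> (\<exists>\<eta> \<epsilon>. is_adjunction (Src L) (Tgt L) L R \<eta> \<epsilon>)"

definition full :: "('o, 'a, 'p, 'b) func \<Rightarrow> bool" where
  "full F \<longleftrightarrow>
     (\<forall>x \<in> Obj (Src F). \<forall>y \<in> Obj (Src F). \<forall>g \<in> Hom (Tgt F) (Fo F x) (Fo F y).
        \<exists>f \<in> Hom (Src F) x y. Fa F f = g)"

definition faithful :: "('o, 'a, 'p, 'b) func \<Rightarrow> bool" where
  "faithful F \<longleftrightarrow>
     (\<forall>x \<in> Obj (Src F). \<forall>y \<in> Obj (Src F). inj_on (Fa F) (Hom (Src F) x y))"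

definition naturally_isomorphic ::
  "('o, 'a, 'p, 'b) func \<Rightarrow> ('o, 'a, 'p, 'b) func \<Rightarrow> bool" where
  "naturally_isomorphic F G \<longleftrightarrow>
     (\<exists>\<alpha> \<beta>. is_nt \<alpha> F G \<and> is_nt \<beta> G F \<and> \<beta> \<bullet> \<alpha> = idn F \<and> \<alpha> \<bullet> \<beta> = idn G)"

definition inverse_equivalences :: "('o, 'a, 'p, 'b) func \<Rightarrow> ('p, 'b, 'o, 'a) func \<Rightarrow> bool" where
  "inverse_equivalences F G \<longleftrightarrow>
     is_functor F (Src F) (Tgt F) \<and> is_functor G (Tgt F) (Src F) \<and>
     naturally_isomorphic (G \<odot> F) (idf (Src F)) \<and> naturally_isomorphic (F \<odot> G) (idf (Tgt F))"

definition is_equivalence :: "('o, 'a, 'p, 'b) func \<Rightarrow> bool" where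
  "is_equivalence F \<longleftrightarrow> (\<exists>G. inverse_equivalences F G)"


section \<open>Monads and bialgebra functors\<close>

definition is_monad ::
  "('o, 'a) cat \<Rightarrow> ('o, 'a, 'o, 'a) func \<Rightarrow> ('o, 'a, 'o, 'a) ntrans \<Rightarrow> ('o, 'a, 'o, 'a) ntrans \<Rightarrow> bool" where
  "is_monad C A m u \<longleftrightarrow>
     is_functor A C C \<and> is_nt m (A \<odot> A) A \<and> is_nt u (idf C) A \<and>
     m \<bullet> (m \<lhd> A) = m \<bullet> (A \<rhd> m) \<and> m \<bullet> (u \<lhd> A) = idn A \<and> m \<bullet> (A \<rhd> u) = idn A"

definition is_monad_mor ::
  "('o, 'a, 'o, 'a) func \<Rightarrow> ('o, 'a, 'o, 'a) ntrans \<Rightarrow> ('o, 'a, 'o, 'a) ntrans \<Rightarrow>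
   ('o, 'a, 'o, 'a) func \<Rightarrow> ('o, 'a, 'o, 'a) ntrans \<Rightarrow> ('o, 'a, 'o, 'a) ntrans \<Rightarrow>
   ('o, 'a, 'o, 'a) ntrans \<Rightarrow> bool" where
  "is_monad_mor A m u A' m' u' \<phi> \<longleftrightarrow>
     is_nt \<phi> A A' \<and> \<phi> \<bullet> m = m' \<bullet> (\<phi> \<star> \<phi>) \<and> \<phi> \<bullet> u = u'"

text \<open>Here \<open>(A, mA, uA)\<close> is a monad on \<open>X\<close>, \<open>(B, mB, uB)\<close> is one on \<open>Y\<close>, and \<open>T\<close> goes from \<open>Y\<close> to \<open>X\<close>.\<close>

definition is_bialgebra_functor ::
  "('xo, 'xa) cat \<Rightarrow> ('yo, 'ya) cat \<Rightarrow>
   ('xo, 'xa, 'xo, 'xa) func \<Rightarrow> ('xo, 'xa, 'xo, 'xa) ntrans \<Rightarrow> ('xo, 'xa, 'xo, 'xa) ntrans \<Rightarrow>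
   ('yo, 'ya, 'yo, 'ya) func \<Rightarrow> ('yo, 'ya, 'yo, 'ya) ntrans \<Rightarrow> ('yo, 'ya, 'yo, 'ya) ntrans \<Rightarrow>
   ('yo, 'ya, 'xo, 'xa) func \<Rightarrow> ('yo, 'ya, 'xo, 'xa) ntrans \<Rightarrow> ('yo, 'ya, 'xo, 'xa) ntrans \<Rightarrow> bool" where
  "is_bialgebra_functor X Y A mA uA B mB uB T l r \<longleftrightarrow>
     is_functor T Y X \<and> is_nt l (A \<odot> T) T \<and> is_nt r (T \<odot> B) T \<and>
     r \<bullet> (T \<rhd> mB) = r \<bullet> (r \<lhd> B) \<and> r \<bullet> (T \<rhd> uB) = idn T \<and>
     l \<bullet> (mA \<lhd> T) = l \<bullet> (A \<rhd> l) \<and> l \<bullet> (uA \<lhd> T) = idn T \<and>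
     r \<bullet> (l \<lhd> B) = l \<bullet> (A \<rhd> r)"


section \<open>Morita contexts\<close>

text \<open>
  The monads are \<open>(FA, mA, uA)\<close> on \<open>X\<close> and \<open>(FB, mB, uB)\<close> on \<open>Y\<close>; the bialgebra functors are
  \<open>(FT, lT, rT)\<close> from \<open>Y\<close> to \<open>X\<close> and, for the second one (written with a hat on paper),
  \<open>(FH, lH, rH)\<close> from \<open>X\<close> to \<open>Y\<close>.
\<close>

record ('xo, 'xa, 'yo, 'ya) morita =
  FA :: "('xo, 'xa, 'xo, 'xa) func"
  mA :: "('xo, 'xa, 'xo, 'xa) ntrans"
  uA :: "('xo, 'xa, 'xo, 'xa) ntrans"
  FB :: "('yo, 'ya, 'yo, 'ya) func"
  mB :: "('yo, 'ya, 'yo, 'ya) ntrans"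
  uB :: "('yo, 'ya, 'yo, 'ya) ntrans"
  FT :: "('yo, 'ya, 'xo, 'xa) func"
  lT :: "('yo, 'ya, 'xo, 'xa) ntrans"
  rT :: "('yo, 'ya, 'xo, 'xa) ntrans"
  FH :: "('xo, 'xa, 'yo, 'ya) func"
  lH :: "('xo, 'xa, 'yo, 'ya) ntrans"
  rH :: "('xo, 'xa, 'yo, 'ya) ntrans"
  ev :: "('xo, 'xa, 'xo, 'xa) ntrans"
  evh :: "('yo, 'ya, 'yo, 'ya) ntrans"

definition is_morita ::
  "('xo, 'xa) cat \<Rightarrow> ('yo, 'ya) cat \<Rightarrow> ('xo, 'xa, 'yo, 'ya) morita \<Rightarrow> bool" where
  "is_morita X Y M \<longleftrightarrow>
     is_monad X (FA M) (mA M) (uA M) \<and> is_monad Y (FB M) (mB M) (uB M) \<and>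
     is_bialgebra_functor X Y (FA M) (mA M) (uA M) (FB M) (mB M) (uB M) (FT M) (lT M) (rT M) \<and>
     is_bialgebra_functor Y X (FB M) (mB M) (uB M) (FA M) (mA M) (uA M) (FH M) (lH M) (rH M) \<and>
     is_nt (ev M) (FT M \<odot> FH M) (FA M) \<and> is_nt (evh M) (FH M \<odot> FT M) (FB M) \<and>
     ev M \<bullet> (lT M \<lhd> FH M) = mA M \<bullet> (FA M \<rhd> ev M) \<and>
     ev M \<bullet> (FT M \<rhd> rH M) = mA M \<bullet> (ev M \<lhd> FA M) \<and>
     evh M \<bullet> (lH M \<lhd> FT M) = mB M \<bullet> (FB M \<rhd> evh M) \<and>
     evh M \<bullet> (FH M \<rhd> rT M) = mB M \<bullet> (evh M \<lhd> FB M) \<and>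
     rT M \<bullet> (FT M \<rhd> evh M) = lT M \<bullet> (ev M \<lhd> FT M) \<and>
     lH M \<bullet> (evh M \<lhd> FH M) = rH M \<bullet> (FH M \<rhd> ev M) \<and>
     evh M \<bullet> (FH M \<rhd> lT M) = evh M \<bullet> (rH M \<lhd> FT M) \<and>
     ev M \<bullet> (rT M \<lhd> FH M) = ev M \<bullet> (FT M \<rhd> lH M)"

record ('xo, 'xa, 'yo, 'ya) morita_mor =
  ph1 :: "('xo, 'xa, 'xo, 'xa) ntrans"
  ph2 :: "('yo, 'ya, 'yo, 'ya) ntrans"
  ph3 :: "('yo, 'ya, 'xo, 'xa) ntrans"
  ph4 :: "('xo, 'xa, 'yo, 'ya) ntrans"

definition is_morita_mor ::
  "('xo, 'xa, 'yo, 'ya) morita \<Rightarrow> ('xo, 'xa, 'yo, 'ya) morita \<Rightarrow> ('xo, 'xa, 'yo, 'ya) morita_mor \<Rightarrow> bool" where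
  "is_morita_mor M M' \<phi> \<longleftrightarrow>
     is_monad_mor (FA M) (mA M) (uA M) (FA M') (mA M') (uA M') (ph1 \<phi>) \<and>
     is_monad_mor (FB M) (mB M) (uB M) (FB M') (mB M') (uB M') (ph2 \<phi>) \<and>
     is_nt (ph3 \<phi>) (FT M) (FT M') \<and> is_nt (ph4 \<phi>) (FH M) (FH M') \<and>
     ph3 \<phi> \<bullet> rT M = rT M' \<bullet> (FT M' \<rhd> ph2 \<phi>) \<bullet> (ph3 \<phi> \<lhd> FB M) \<and>
     ph3 \<phi> \<bullet> lT M = lT M' \<bullet> (ph1 \<phi> \<lhd> FT M') \<bullet> (FA M \<rhd> ph3 \<phi>) \<and>
     ph4 \<phi> \<bullet> rH M = rH M' \<bullet> (FH M' \<rhd> ph1 \<phi>) \<bullet> (ph4 \<phi> \<lhd> FA M) \<and>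
     ph4 \<phi> \<bullet> lH M = lH M' \<bullet> (ph2 \<phi> \<lhd> FH M') \<bullet> (FB M \<rhd> ph4 \<phi>) \<and>
     ph1 \<phi> \<bullet> ev M = ev M' \<bullet> (ph3 \<phi> \<star> ph4 \<phi>) \<and>
     ph2 \<phi> \<bullet> evh M = evh M' \<bullet> (ph4 \<phi> \<star> ph3 \<phi>)"

definition morita_id :: "('xo, 'xa, 'yo, 'ya) morita \<Rightarrow> ('xo, 'xa, 'yo, 'ya) morita_mor" where
  "morita_id M = \<lparr>ph1 = idn (FA M), ph2 = idn (FB M), ph3 = idn (FT M), ph4 = idn (FH M)\<rparr>"

definition morita_comp ::
  "('xo, 'xa, 'yo, 'ya) morita_mor \<Rightarrow> ('xo, 'xa, 'yo, 'ya) morita_mor \<Rightarrow> ('xo, 'xa, 'yo, 'ya) morita_mor" where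
  "morita_comp \<psi> \<phi> =
     \<lparr>ph1 = ph1 \<psi> \<bullet> ph1 \<phi>, ph2 = ph2 \<psi> \<bullet> ph2 \<phi>, ph3 = ph3 \<psi> \<bullet> ph3 \<phi>, ph4 = ph4 \<psi> \<bullet> ph4 \<phi>\<rparr>"

type_synonym ('xo, 'xa, 'yo, 'ya) morita_arr =
  "('xo, 'xa, 'yo, 'ya) morita \<times> ('xo, 'xa, 'yo, 'ya) morita_mor \<times> ('xo, 'xa, 'yo, 'ya) morita"

definition Mor ::
  "('xo, 'xa) cat \<Rightarrow> ('yo, 'ya) cat \<Rightarrow>
   (('xo, 'xa, 'yo, 'ya) morita, ('xo, 'xa, 'yo, 'ya) morita_arr) cat" where
  "Mor X Y =
     hom_cat {M. is_morita X Y M} (\<lambda>M M'. {\<phi>. is_morita_mor M M' \<phi>}) morita_id morita_comp"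


section \<open>Double adjunctions\<close>

record ('xo, 'xa, 'yo, 'ya, 'zo, 'za) dadj =
  ZC :: "('zo, 'za) cat"
  LA :: "('xo, 'xa, 'zo, 'za) func"
  RA :: "('zo, 'za, 'xo, 'xa) func"
  etaA :: "('xo, 'xa, 'xo, 'xa) ntrans"
  epsA :: "('zo, 'za, 'zo, 'za) ntrans"
  LB :: "('yo, 'ya, 'zo, 'za) func"
  RB :: "('zo, 'za, 'yo, 'ya) func"
  etaB :: "('yo, 'ya, 'yo, 'ya) ntrans"
  epsB :: "('zo, 'za, 'zo, 'za) ntrans"

definition is_dadj ::
  "('xo, 'xa) cat \<Rightarrow> ('yo, 'ya) cat \<Rightarrow> ('xo, 'xa, 'yo, 'ya, 'zo, 'za) dadj \<Rightarrow> bool" where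
  "is_dadj X Y D \<longleftrightarrow>
     is_adjunction X (ZC D) (LA D) (RA D) (etaA D) (epsA D) \<and>
     is_adjunction Y (ZC D) (LB D) (RB D) (etaB D) (epsB D)"

text \<open>Contravariance: a morphism from \<open>D\<close> to \<open>D'\<close> is a functor from \<open>ZC D'\<close> to \<open>ZC D\<close>.\<close>

definition is_dadj_mor ::
  "('xo, 'xa, 'yo, 'ya, 'zo, 'za) dadj \<Rightarrow> ('xo, 'xa, 'yo, 'ya, 'zo, 'za) dadj \<Rightarrow>
   ('zo, 'za, 'zo, 'za) func \<Rightarrow> bool" where
  "is_dadj_mor D D' F \<longleftrightarrow>
     is_functor F (ZC D') (ZC D) \<and> RA D \<odot> F = RA D' \<and> RB D \<odot> F = RB D'"

type_synonym ('xo, 'xa, 'yo, 'ya, 'zo, 'za) dadj_arr =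
  "('xo, 'xa, 'yo, 'ya, 'zo, 'za) dadj \<times> ('zo, 'za, 'zo, 'za) func \<times>
   ('xo, 'xa, 'yo, 'ya, 'zo, 'za) dadj"

definition Adj ::
  "('xo, 'xa) cat \<Rightarrow> ('yo, 'ya) cat \<Rightarrow>
   (('xo, 'xa, 'yo, 'ya, 'zo, 'za) dadj, ('xo, 'xa, 'yo, 'ya, 'zo, 'za) dadj_arr) cat" where
  "Adj X Y =
     hom_cat {D. is_dadj X Y D} (\<lambda>D D'. {F. is_dadj_mor D D' F}) (\<lambda>D. idf (ZC D))
       (\<lambda>G F. F \<odot> G)"

text \<open>The natural transformations \<open>a\<close> and \<open>b\<close> of a morphism \<open>F\<close> from \<open>D\<close> to \<open>D'\<close>.\<close>

definition mate_a ::
  "('xo, 'xa, 'yo, 'ya, 'zo, 'za) dadj \<Rightarrow> ('zo, 'za, 'zo, 'za) func \<Rightarrow>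
   ('xo, 'xa, 'yo, 'ya, 'zo, 'za) dadj \<Rightarrow> ('xo, 'xa, 'zo, 'za) ntrans" where
  "mate_a D F D' = (epsA D \<lhd> (F \<odot> LA D')) \<bullet> (LA D \<rhd> etaA D')"

definition mate_b ::
  "('xo, 'xa, 'yo, 'ya, 'zo, 'za) dadj \<Rightarrow> ('zo, 'za, 'zo, 'za) func \<Rightarrow>
   ('xo, 'xa, 'yo, 'ya, 'zo, 'za) dadj \<Rightarrow> ('yo, 'ya, 'zo, 'za) ntrans" where
  "mate_b D F D' = (epsB D \<lhd> (F \<odot> LB D')) \<bullet> (LB D \<rhd> etaB D')"


section \<open>The functor from double adjunctions to Morita contexts\<close>

definition Ups_obj ::
  "('xo, 'xa, 'yo, 'ya, 'zo, 'za) dadj \<Rightarrow> ('xo, 'xa, 'yo, 'ya) morita" where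
  "Ups_obj D =
     \<lparr>FA = RA D \<odot> LA D, mA = RA D \<rhd> epsA D \<lhd> LA D, uA = etaA D,
      FB = RB D \<odot> LB D, mB = RB D \<rhd> epsB D \<lhd> LB D, uB = etaB D,
      FT = RA D \<odot> LB D, lT = RA D \<rhd> epsA D \<lhd> LB D, rT = RA D \<rhd> epsB D \<lhd> LB D,
      FH = RB D \<odot> LA D, lH = RB D \<rhd> epsB D \<lhd> LA D, rH = RB D \<rhd> epsA D \<lhd> LA D,
      ev = RA D \<rhd> epsB D \<lhd> LA D, evh = RB D \<rhd> epsA D \<lhd> LB D\<rparr>"

definition Ups_mor ::
  "('xo, 'xa, 'yo, 'ya, 'zo, 'za) dadj \<Rightarrow> ('zo, 'za, 'zo, 'za) func \<Rightarrow>
   ('xo, 'xa, 'yo, 'ya, 'zo, 'za) dadj \<Rightarrow> ('xo, 'xa, 'yo, 'ya) morita_mor" where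
  "Ups_mor D F D' =
     \<lparr>ph1 = RA D \<rhd> mate_a D F D', ph2 = RB D \<rhd> mate_b D F D',
      ph3 = RA D \<rhd> mate_b D F D', ph4 = RB D \<rhd> mate_a D F D'\<rparr>"

definition Ups ::
  "('xo, 'xa) cat \<Rightarrow> ('yo, 'ya) cat \<Rightarrow>
   (('xo, 'xa, 'yo, 'ya, 'zo, 'za) dadj, ('xo, 'xa, 'yo, 'ya, 'zo, 'za) dadj_arr,
    ('xo, 'xa, 'yo, 'ya) morita, ('xo, 'xa, 'yo, 'ya) morita_arr) func" where
  "Ups X Y =
     mk_func (Adj X Y) (Mor X Y) Ups_obj
       (\<lambda>(D, F, D'). (Ups_obj D, Ups_mor D F D', Ups_obj D'))"


section \<open>The Eilenberg-Moore category of a Morita context\<close>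

definition is_algebra ::
  "('o, 'a, 'o, 'a) func \<Rightarrow> ('o, 'a, 'o, 'a) ntrans \<Rightarrow> ('o, 'a, 'o, 'a) ntrans \<Rightarrow> 'o \<Rightarrow> 'a \<Rightarrow> bool" where
  "is_algebra A m u x r \<longleftrightarrow>
     x \<in> Obj (Src A) \<and> r \<in> Hom (Src A) (Fo A x) x \<and>
     r \<cdot>\<^bsub>Src A\<^esub> At m x = r \<cdot>\<^bsub>Src A\<^esub> Fa A r \<and> r \<cdot>\<^bsub>Src A\<^esub> At u x = Ide (Src A) x"

definition is_algebra_mor ::
  "('o, 'a, 'o, 'a) func \<Rightarrow> 'o \<Rightarrow> 'a \<Rightarrow> 'o \<Rightarrow> 'a \<Rightarrow> 'a \<Rightarrow> bool" where
  "is_algebra_mor A x r x' r' f \<longleftrightarrow>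
     f \<in> Hom (Src A) x x' \<and> f \<cdot>\<^bsub>Src A\<^esub> r = r' \<cdot>\<^bsub>Src A\<^esub> Fa A f"

type_synonym ('xo, 'xa, 'yo, 'ya) emobj = "('xo \<times> 'xa) \<times> ('yo \<times> 'ya) \<times> 'xa \<times> 'ya"

type_synonym ('xo, 'xa, 'yo, 'ya) emarr =
  "('xo, 'xa, 'yo, 'ya) emobj \<times> ('xa \<times> 'ya) \<times> ('xo, 'xa, 'yo, 'ya) emobj"

definition is_emobj ::
  "('xo, 'xa, 'yo, 'ya) morita \<Rightarrow> ('xo, 'xa, 'yo, 'ya) emobj \<Rightarrow> bool" where
  "is_emobj M = (\<lambda>((x, r), (y, s), v, w).
     let X = Src (FA M); Y = Src (FB M) in
     is_algebra (FA M) (mA M) (uA M) x r \<and> is_algebra (FB M) (mB M) (uB M) y s \<and>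
     v \<in> Hom X (Fo (FT M) y) x \<and> w \<in> Hom Y (Fo (FH M) x) y \<and>
     v \<cdot>\<^bsub>X\<^esub> At (lT M) y = r \<cdot>\<^bsub>X\<^esub> Fa (FA M) v \<and>
     w \<cdot>\<^bsub>Y\<^esub> At (lH M) x = s \<cdot>\<^bsub>Y\<^esub> Fa (FB M) w \<and>
     v \<cdot>\<^bsub>X\<^esub> Fa (FT M) w = r \<cdot>\<^bsub>X\<^esub> At (ev M) x \<and>
     w \<cdot>\<^bsub>Y\<^esub> Fa (FH M) v = s \<cdot>\<^bsub>Y\<^esub> At (evh M) y \<and>
     w \<cdot>\<^bsub>Y\<^esub> Fa (FH M) r = w \<cdot>\<^bsub>Y\<^esub> At (rH M) x \<and>
     v \<cdot>\<^bsub>X\<^esub> Fa (FT M) s = v \<cdot>\<^bsub>X\<^esub> At (rT M) y)"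

definition is_emmor ::
  "('xo, 'xa, 'yo, 'ya) morita \<Rightarrow> ('xo, 'xa, 'yo, 'ya) emobj \<Rightarrow> ('xo, 'xa, 'yo, 'ya) emobj \<Rightarrow>
   'xa \<times> 'ya \<Rightarrow> bool" where
  "is_emmor M = (\<lambda>((x, r), (y, s), v, w) ((x', r'), (y', s'), v', w') (f, g).
     let X = Src (FA M); Y = Src (FB M) in
     is_algebra_mor (FA M) x r x' r' f \<and> is_algebra_mor (FB M) y s y' s' g \<and>
     g \<cdot>\<^bsub>Y\<^esub> w = w' \<cdot>\<^bsub>Y\<^esub> Fa (FH M) f \<and> f \<cdot>\<^bsub>X\<^esub> v = v' \<cdot>\<^bsub>X\<^esub> Fa (FT M) g)"

definition EM ::
  "('xo, 'xa, 'yo, 'ya) morita \<Rightarrow>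
   (('xo, 'xa, 'yo, 'ya) emobj, ('xo, 'xa, 'yo, 'ya) emarr) cat" where
  "EM M =
     hom_cat {e. is_emobj M e} (\<lambda>e e'. {h. is_emmor M e e' h})
       (\<lambda>((x, r), (y, s), v, w). (Ide (Src (FA M)) x, Ide (Src (FB M)) y))
       (\<lambda>(f', g') (f, g). (f' \<cdot>\<^bsub>Src (FA M)\<^esub> f, g' \<cdot>\<^bsub>Src (FB M)\<^esub> g))"

definition UA :: "('xo, 'xa, 'yo, 'ya) morita \<Rightarrow>
    (('xo, 'xa, 'yo, 'ya) emobj, ('xo, 'xa, 'yo, 'ya) emarr, 'xo, 'xa) func" where
  "UA M = mk_func (EM M) (Src (FA M)) (\<lambda>((x, r), (y, s), v, w). x) (\<lambda>(e, (f, g), e'). f)"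

definition UB :: "('xo, 'xa, 'yo, 'ya) morita \<Rightarrow>
    (('xo, 'xa, 'yo, 'ya) emobj, ('xo, 'xa, 'yo, 'ya) emarr, 'yo, 'ya) func" where
  "UB M = mk_func (EM M) (Src (FB M)) (\<lambda>((x, r), (y, s), v, w). y) (\<lambda>(e, (f, g), e'). g)"

definition GA_obj ::
  "('xo, 'xa, 'yo, 'ya) morita \<Rightarrow> 'xo \<Rightarrow> ('xo, 'xa, 'yo, 'ya) emobj" where
  "GA_obj M x =
     ((Fo (FA M) x, At (mA M) x), (Fo (FH M) x, At (lH M) x), At (ev M) x, At (rH M) x)"

definition GB_obj ::
  "('xo, 'xa, 'yo, 'ya) morita \<Rightarrow> 'yo \<Rightarrow> ('xo, 'xa, 'yo, 'ya) emobj" where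
  "GB_obj M y =
     ((Fo (FT M) y, At (lT M) y), (Fo (FB M) y, At (mB M) y), At (rT M) y, At (evh M) y)"

definition GA :: "('xo, 'xa, 'yo, 'ya) morita \<Rightarrow>
    ('xo, 'xa, ('xo, 'xa, 'yo, 'ya) emobj, ('xo, 'xa, 'yo, 'ya) emarr) func" where
  "GA M = (let X = Src (FA M) in mk_func X (EM M) (GA_obj M)
     (\<lambda>f. (GA_obj M (Dom X f), (Fa (FA M) f, Fa (FH M) f), GA_obj M (Cod X f))))"

definition GB :: "('xo, 'xa, 'yo, 'ya) morita \<Rightarrow>
    ('yo, 'ya, ('xo, 'xa, 'yo, 'ya) emobj, ('xo, 'xa, 'yo, 'ya) emarr) func" where
  "GB M = (let Y = Src (FB M) in mk_func Y (EM M) (GB_obj M)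
     (\<lambda>g. (GB_obj M (Dom Y g), (Fa (FT M) g, Fa (FB M) g), GB_obj M (Cod Y g))))"

text \<open>
  The double adjunction on the Eilenberg-Moore category itself; it lives over the types
  \<open>emobj\<close> and \<open>emarr\<close>.
\<close>

definition EM_dadj ::
  "('xo, 'xa, 'yo, 'ya) morita \<Rightarrow>
   ('xo, 'xa, 'yo, 'ya, ('xo, 'xa, 'yo, 'ya) emobj, ('xo, 'xa, 'yo, 'ya) emarr) dadj" where
  "EM_dadj M =
     \<lparr>ZC = EM M,
      LA = GA M, RA = UA M, etaA = uA M,
      epsA = mk_nt (GA M \<odot> UA M) (idf (EM M))
        (\<lambda>((x, r), (y, s), v, w). (GA_obj M x, (r, w), ((x, r), (y, s), v, w))),
      LB = GB M, RB = UB M, etaB = uB M,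
      epsB = mk_nt (GB M \<odot> UB M) (idf (EM M))
        (\<lambda>((x, r), (y, s), v, w). (GB_obj M y, (v, s), ((x, r), (y, s), v, w)))\<rparr>"

definition EM_func ::
  "('xo, 'xa, 'yo, 'ya) morita \<Rightarrow> ('xo, 'xa, 'yo, 'ya) morita_mor \<Rightarrow> ('xo, 'xa, 'yo, 'ya) morita \<Rightarrow>
   (('xo, 'xa, 'yo, 'ya) emobj, ('xo, 'xa, 'yo, 'ya) emarr,
    ('xo, 'xa, 'yo, 'ya) emobj, ('xo, 'xa, 'yo, 'ya) emarr) func" where
  "EM_func M \<phi> M' =
     (let X = Src (FA M); Y = Src (FB M);
          q = (\<lambda>((x, r), (y, s), v, w).
                ((x, r \<cdot>\<^bsub>X\<^esub> At (ph1 \<phi>) x), (y, s \<cdot>\<^bsub>Y\<^esub> At (ph2 \<phi>) y),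
                 v \<cdot>\<^bsub>X\<^esub> At (ph3 \<phi>) y, w \<cdot>\<^bsub>Y\<^esub> At (ph4 \<phi>) x))
      in mk_func (EM M') (EM M) q (\<lambda>(e, h, e'). (q e, h, q e')))"

definition comparison ::
  "('xo, 'xa, 'yo, 'ya, 'zo, 'za) dadj \<Rightarrow>
   ('zo, 'za, ('xo, 'xa, 'yo, 'ya) emobj, ('xo, 'xa, 'yo, 'ya) emarr) func" where
  "comparison D =
     (let k = (\<lambda>z. ((Fo (RA D) z, Fa (RA D) (At (epsA D) z)), (Fo (RB D) z, Fa (RB D) (At (epsB D) z)),
                    Fa (RA D) (At (epsB D) z), Fa (RB D) (At (epsA D) z)))
      in mk_func (ZC D) (EM (Ups_obj D)) k
           (\<lambda>f. (k (Dom (ZC D) f), (Fa (RA D) f, Fa (RB D) f), k (Cod (ZC D) f))))"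

definition moritable :: "('xo, 'xa, 'yo, 'ya, 'zo, 'za) dadj \<Rightarrow> bool" where
  "moritable D \<longleftrightarrow> is_equivalence (comparison D)"


section \<open>The functor from Morita contexts to double adjunctions\<close>

text \<open>
  The types \<open>'zo\<close> and \<open>'za\<close> of objects and arrows of the categories occurring in \<^const>\<open>Adj\<close> play
  the role of a universe.  They have to be large enough to contain the Eilenberg-Moore
  categories, which is expressed by injections \<open>io\<close> and \<open>ia\<close> of \<open>emobj\<close> into \<open>'zo\<close> and of \<open>emarr\<close>
  into \<open>'za\<close>.  The double adjunction \<^const>\<open>EM_dadj\<close> and the functors \<^const>\<open>EM_func\<close> are
  transported along the resulting isomorphism between a category and its image.
\<close>

definition image_cat ::
  "('o \<Rightarrow> 'p) \<Rightarrow> ('a \<Rightarrow> 'b) \<Rightarrow> ('o, 'a) cat \<Rightarrow> ('p, 'b) cat" where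
  "image_cat io ia C =
     mk_cat (io ` Obj C) (ia ` Arr C) (\<lambda>f. io (Dom C (inv ia f))) (\<lambda>f. io (Cod C (inv ia f)))
       (\<lambda>x. ia (Ide C (inv io x))) (\<lambda>g f. ia (inv ia g \<cdot>\<^bsub>C\<^esub> inv ia f))"

definition to_image ::
  "('o \<Rightarrow> 'p) \<Rightarrow> ('a \<Rightarrow> 'b) \<Rightarrow> ('o, 'a) cat \<Rightarrow> ('o, 'a, 'p, 'b) func" where
  "to_image io ia C = mk_func C (image_cat io ia C) io ia"

definition from_image ::
  "('o \<Rightarrow> 'p) \<Rightarrow> ('a \<Rightarrow> 'b) \<Rightarrow> ('o, 'a) cat \<Rightarrow> ('p, 'b, 'o, 'a) func" where
  "from_image io ia C = mk_func (image_cat io ia C) C (inv io) (inv ia)"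

definition image_dadj ::
  "('o \<Rightarrow> 'p) \<Rightarrow> ('a \<Rightarrow> 'b) \<Rightarrow> ('xo, 'xa, 'yo, 'ya, 'o, 'a) dadj \<Rightarrow>
   ('xo, 'xa, 'yo, 'ya, 'p, 'b) dadj" where
  "image_dadj io ia D =
     (let I = to_image io ia (ZC D); J = from_image io ia (ZC D) in
      \<lparr>ZC = image_cat io ia (ZC D),
       LA = I \<odot> LA D, RA = RA D \<odot> J, etaA = etaA D, epsA = I \<rhd> epsA D \<lhd> J,
       LB = I \<odot> LB D, RB = RB D \<odot> J, etaB = etaB D, epsB = I \<rhd> epsB D \<lhd> J\<rparr>)"

definition Gam_obj ::
  "(('xo, 'xa, 'yo, 'ya) emobj \<Rightarrow> 'zo) \<Rightarrow> (('xo, 'xa, 'yo, 'ya) emarr \<Rightarrow> 'za) \<Rightarrow>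
   ('xo, 'xa, 'yo, 'ya) morita \<Rightarrow> ('xo, 'xa, 'yo, 'ya, 'zo, 'za) dadj" where
  "Gam_obj io ia M = image_dadj io ia (EM_dadj M)"

definition Gam_mor ::
  "(('xo, 'xa, 'yo, 'ya) emobj \<Rightarrow> 'zo) \<Rightarrow> (('xo, 'xa, 'yo, 'ya) emarr \<Rightarrow> 'za) \<Rightarrow>
   ('xo, 'xa, 'yo, 'ya) morita \<Rightarrow> ('xo, 'xa, 'yo, 'ya) morita_mor \<Rightarrow> ('xo, 'xa, 'yo, 'ya) morita \<Rightarrow>
   ('zo, 'za, 'zo, 'za) func" where
  "Gam_mor io ia M \<phi> M' =
     to_image io ia (EM M) \<odot> EM_func M \<phi> M' \<odot> from_image io ia (EM M')"

definition Gam ::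
  "(('xo, 'xa, 'yo, 'ya) emobj \<Rightarrow> 'zo) \<Rightarrow> (('xo, 'xa, 'yo, 'ya) emarr \<Rightarrow> 'za) \<Rightarrow>
   ('xo, 'xa) cat \<Rightarrow> ('yo, 'ya) cat \<Rightarrow>
   (('xo, 'xa, 'yo, 'ya) morita, ('xo, 'xa, 'yo, 'ya) morita_arr,
    ('xo, 'xa, 'yo, 'ya, 'zo, 'za) dadj, ('xo, 'xa, 'yo, 'ya, 'zo, 'za) dadj_arr) func" where
  "Gam io ia X Y =
     mk_func (Mor X Y) (Adj X Y) (Gam_obj io ia)
       (\<lambda>(M, \<phi>, M'). (Gam_obj io ia M, Gam_mor io ia M \<phi> M', Gam_obj io ia M'))"


section \<open>Balanced herds and pre-torsors\<close>

type_synonym ('xo, 'xa, 'yo, 'ya) herd =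
  "('xo, 'xa, 'yo, 'ya) morita \<times> ('yo, 'ya, 'xo, 'xa) ntrans"

type_synonym ('xo, 'xa, 'yo, 'ya) herd_arr =
  "('xo, 'xa, 'yo, 'ya) herd \<times> ('xo, 'xa, 'yo, 'ya) morita_mor \<times> ('xo, 'xa, 'yo, 'ya) herd"

definition is_shepherd ::
  "('xo, 'xa, 'yo, 'ya) morita \<Rightarrow> ('yo, 'ya, 'xo, 'xa) ntrans \<Rightarrow> bool" where
  "is_shepherd M \<gamma> \<longleftrightarrow>
     is_nt \<gamma> (FT M) (FT M \<odot> FH M \<odot> FT M) \<and>
     (FT M \<rhd> evh M) \<bullet> \<gamma> = FT M \<rhd> uB M \<and>
     (ev M \<lhd> FT M) \<bullet> \<gamma> = uA M \<lhd> FT M \<and>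
     ((FT M \<odot> FH M) \<rhd> \<gamma>) \<bullet> \<gamma> = (\<gamma> \<lhd> (FH M \<odot> FT M)) \<bullet> \<gamma>"

definition Herd ::
  "('xo, 'xa) cat \<Rightarrow> ('yo, 'ya) cat \<Rightarrow>
   (('xo, 'xa, 'yo, 'ya) herd, ('xo, 'xa, 'yo, 'ya) herd_arr) cat" where
  "Herd X Y =
     hom_cat {(M, \<gamma>). is_morita X Y M \<and> is_shepherd M \<gamma>}
       (\<lambda>(M, \<gamma>) (M', \<gamma>'). {\<phi>. is_morita_mor M M' \<phi> \<and>
           (ph3 \<phi> \<star> ph4 \<phi> \<star> ph3 \<phi>) \<bullet> \<gamma> = \<gamma>' \<bullet> ph3 \<phi>})
       (\<lambda>(M, \<gamma>). morita_id M) morita_comp"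

type_synonym ('xo, 'xa, 'yo, 'ya, 'zo, 'za) pretor =
  "('xo, 'xa, 'yo, 'ya, 'zo, 'za) dadj \<times> ('yo, 'ya, 'xo, 'xa) ntrans"

type_synonym ('xo, 'xa, 'yo, 'ya, 'zo, 'za) pretor_arr =
  "('xo, 'xa, 'yo, 'ya, 'zo, 'za) pretor \<times> ('zo, 'za, 'zo, 'za) func \<times>
   ('xo, 'xa, 'yo, 'ya, 'zo, 'za) pretor"

definition is_pretorsor_structure ::
  "('xo, 'xa, 'yo, 'ya, 'zo, 'za) dadj \<Rightarrow> ('yo, 'ya, 'xo, 'xa) ntrans \<Rightarrow> bool" where
  "is_pretorsor_structure D \<tau> \<longleftrightarrow>
     is_nt \<tau> (RA D \<odot> LB D) (RA D \<odot> LB D \<odot> RB D \<odot> LA D \<odot> RA D \<odot> LB D) \<and>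
     ((RA D \<odot> LB D \<odot> RB D) \<rhd> epsA D \<lhd> LB D) \<bullet> \<tau> = (RA D \<odot> LB D) \<rhd> etaB D \<and>
     (RA D \<rhd> epsB D \<lhd> (LA D \<odot> RA D \<odot> LB D)) \<bullet> \<tau> = etaA D \<lhd> (RA D \<odot> LB D) \<and>
     ((RA D \<odot> LB D \<odot> RB D \<odot> LA D) \<rhd> \<tau>) \<bullet> \<tau> = (\<tau> \<lhd> (RB D \<odot> LA D \<odot> RA D \<odot> LB D)) \<bullet> \<tau>"

definition PreTor ::
  "('xo, 'xa) cat \<Rightarrow> ('yo, 'ya) cat \<Rightarrow>
   (('xo, 'xa, 'yo, 'ya, 'zo, 'za) pretor, ('xo, 'xa, 'yo, 'ya, 'zo, 'za) pretor_arr) cat" where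
  "PreTor X Y =
     hom_cat {(D, \<tau>). is_dadj X Y D \<and> is_pretorsor_structure D \<tau>}
       (\<lambda>(D, \<tau>) (D', \<tau>'). {F. is_dadj_mor D D' F \<and>
           ((RA D \<rhd> mate_b D F D') \<star> (RB D \<rhd> mate_a D F D') \<star> (RA D \<rhd> mate_b D F D')) \<bullet> \<tau> =
           \<tau>' \<bullet> (RA D \<rhd> mate_b D F D')})
       (\<lambda>(D, \<tau>). idf (ZC D)) (\<lambda>G F. F \<odot> G)"

definition Gam_bar ::
  "(('xo, 'xa, 'yo, 'ya) emobj \<Rightarrow> 'zo) \<Rightarrow> (('xo, 'xa, 'yo, 'ya) emarr \<Rightarrow> 'za) \<Rightarrow>
   ('xo, 'xa) cat \<Rightarrow> ('yo, 'ya) cat \<Rightarrow>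
   (('xo, 'xa, 'yo, 'ya) herd, ('xo, 'xa, 'yo, 'ya) herd_arr,
    ('xo, 'xa, 'yo, 'ya, 'zo, 'za) pretor, ('xo, 'xa, 'yo, 'ya, 'zo, 'za) pretor_arr) func" where
  "Gam_bar io ia X Y =
     mk_func (Herd X Y) (PreTor X Y) (\<lambda>(M, \<gamma>). (Gam_obj io ia M, \<gamma>))
       (\<lambda>((M, \<gamma>), \<phi>, (M', \<gamma>')). ((Gam_obj io ia M, \<gamma>), Gam_mor io ia M \<phi> M', (Gam_obj io ia M', \<gamma>')))"

definition Ups_bar ::
  "('xo, 'xa) cat \<Rightarrow> ('yo, 'ya) cat \<Rightarrow>
   (('xo, 'xa, 'yo, 'ya, 'zo, 'za) pretor, ('xo, 'xa, 'yo, 'ya, 'zo, 'za) pretor_arr,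
    ('xo, 'xa, 'yo, 'ya) herd, ('xo, 'xa, 'yo, 'ya) herd_arr) func" where
  "Ups_bar X Y =
     mk_func (PreTor X Y) (Herd X Y) (\<lambda>(D, \<tau>). (Ups_obj D, \<tau>))
       (\<lambda>((D, \<tau>), F, (D', \<tau>')). ((Ups_obj D, \<tau>), Ups_mor D F D', (Ups_obj D', \<tau>')))"

end

theory Submission
  imports Defs
begin

text \<open>
  Let \<open>\<Gamma>\<close> and \<open>\<Upsilon>\<close> denote the functors between Morita contexts and double adjunctions, and \<open>K\<^sub>D\<close>
  the comparison functor of a double adjunction \<open>D\<close>.

  \<open>\<Upsilon>\<Gamma>\<close> is the identity, on the nose: the right adjoints applied to the free modules give back
  the four functors of a Morita context, and applied to the counits at free modules they give
  back its structure maps. The functors \<open>K\<^sub>D\<close> are the components of a natural transformation \<open>\<epsilon>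
  : \<Gamma>\<Upsilon> \<rightarrow> id\<close> for which \<open>\<Upsilon>\<epsilon>\<close> and \<open>\<epsilon>\<Gamma>\<close> are identities. So \<open>\<Gamma>\<close> is left adjoint to \<open>\<Upsilon>\<close> with an
  identity as unit, and is fully faithful. These computations are done uniformly for double
  adjunctions whose adjunctions are lifted from the Eilenberg-Moore category along some functor
  \<open>F\<close> (\<open>Ups_over\<close>, \<open>comparison_over\<close>, \<open>comparison_lies_over\<close>, \<open>Ups_mor_over\<close>). A pre-torsor
  structure on \<open>D\<close> is the same as a shepherd on \<open>\<Upsilon>D\<close>, and compatibility of a morphism with such
  structures is a condition on its image under \<open>\<Upsilon>\<close>; hence the whole adjunction restricts to
  balanced herds and pre-torsors.

  Since the unit is an identity, the restricted functors are inverse equivalences precisely if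
  every component of \<open>\<epsilon>\<close> is invertible (\<open>inverse_equivalences_iff\<close>). Morphisms of double
  adjunctions commute strictly with the right adjoints, so that an invertible \<open>\<epsilon>\<^sub>D\<close> makes \<open>K\<^sub>D\<close>
  an isomorphism of categories, and \<open>D\<close> is moritable. The converse needs an argument, because a
  moritable \<open>D\<close> only has a \<open>K\<^sub>D\<close> that is an equivalence. Suppose that \<open>K\<^sub>D\<close> is an equivalence
  but not bijective on objects. Then one finds an object \<open>z\<^sub>0\<close>, in the Eilenberg-Moore category
  if \<open>K\<^sub>D\<close> is not surjective on objects and in the category underlying \<open>D\<close> if it is not
  injective, such that \<open>z\<^sub>0\<close> and another object are isomorphic as modules, while all free
  modules are realized by objects other than \<open>z\<^sub>0\<close>. Deleting the arrows that lead from \<open>z\<^sub>0\<close> to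
  other objects yields a double adjunction with the same Morita context
  (\<open>exists_not_moritable\<close>), which therefore carries the same pre-torsor structure but whose
  comparison functor is not full. Consequently, if all pre-torsors are moritable, then all their
  comparison functors are isomorphisms (\<open>invertible_if_all_moritable\<close>).

  If \<open>\<Gamma>\<close> and \<open>\<Upsilon>\<close> are inverse equivalences, then \<open>\<epsilon>\<close> is invertible because \<open>\<Upsilon>\<close> is fully faithful.
  An inverse of \<open>\<epsilon>\<^sub>D\<close> among double adjunctions has an identity as its image under \<open>\<Upsilon>\<close>, and so is
  compatible with every pre-torsor structure on \<open>D\<close>. This gives the last claim.
\<close>

section \<open>Calculus of categories, functors and natural transformations\<close>

lemma Hom_iff: "f \<in> Hom C x y \<longleftrightarrow> f \<in> Arr C \<and> Dom C f = x \<and> Cod C f = y"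
  by (simp add: Hom_def)

text \<open>Typing facts are stated with \<^const>\<open>Arr\<close>, \<^const>\<open>Dom\<close> and \<^const>\<open>Cod\<close> instead of hom-sets:
  domains and codomains are then computed by rewriting, and with them the side conditions of
  composites.\<close>

lemma cat_simps:
  assumes "category C"
  shows "f \<in> Arr C \<Longrightarrow> Dom C f \<in> Obj C" and "f \<in> Arr C \<Longrightarrow> Cod C f \<in> Obj C"
    and "x \<in> Obj C \<Longrightarrow> Ide C x \<in> Arr C" and "x \<in> Obj C \<Longrightarrow> Dom C (Ide C x) = x"
    and "x \<in> Obj C \<Longrightarrow> Cod C (Ide C x) = x"
    and "f \<in> Arr C \<Longrightarrow> g \<in> Arr C \<Longrightarrow> Dom C g = Cod C f \<Longrightarrow> g \<cdot>\<^bsub>C\<^esub> f \<in> Arr C"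
    and "f \<in> Arr C \<Longrightarrow> g \<in> Arr C \<Longrightarrow> Dom C g = Cod C f \<Longrightarrow> Dom C (g \<cdot>\<^bsub>C\<^esub> f) = Dom C f"
    and "f \<in> Arr C \<Longrightarrow> g \<in> Arr C \<Longrightarrow> Dom C g = Cod C f \<Longrightarrow> Cod C (g \<cdot>\<^bsub>C\<^esub> f) = Cod C g"
    and "f \<in> Arr C \<Longrightarrow> Dom C f = x \<Longrightarrow> f \<cdot>\<^bsub>C\<^esub> Ide C x = f"
    and "f \<in> Arr C \<Longrightarrow> Cod C f = x \<Longrightarrow> Ide C x \<cdot>\<^bsub>C\<^esub> f = f"
  using assms by (auto simp: category_def Hom_iff)

lemma cat_assoc:
  assumes "category C" "f \<in> Arr C" "g \<in> Arr C" "h \<in> Arr C" "Dom C g = Cod C f" "Dom C h = Cod C g"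
  shows "(h \<cdot>\<^bsub>C\<^esub> g) \<cdot>\<^bsub>C\<^esub> f = h \<cdot>\<^bsub>C\<^esub> (g \<cdot>\<^bsub>C\<^esub> f)"
  using assms by (simp add: category_def Hom_iff)

text \<open>An equation between composites stays usable when the left-hand side is followed by more
  factors in a composite that is bracketed to the right.\<close>

lemma comp_tail:
  assumes "category C" "g \<cdot>\<^bsub>C\<^esub> f = p" "f \<in> Arr C" "g \<in> Arr C" "Dom C g = Cod C f"
    "t \<in> Arr C" "Cod C t = Dom C f"
  shows "g \<cdot>\<^bsub>C\<^esub> (f \<cdot>\<^bsub>C\<^esub> t) = p \<cdot>\<^bsub>C\<^esub> t"
  using assms cat_assoc[of C t f g] by simp

lemma mk_cat_simps [simp]:
  "Obj (mk_cat Ob Ar d c i m) = Ob" "Arr (mk_cat Ob Ar d c i m) = Ar"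
  "f \<in> Ar \<Longrightarrow> Dom (mk_cat Ob Ar d c i m) f = d f" "f \<in> Ar \<Longrightarrow> Cod (mk_cat Ob Ar d c i m) f = c f"
  "x \<in> Ob \<Longrightarrow> Ide (mk_cat Ob Ar d c i m) x = i x"
  "f \<in> Ar \<Longrightarrow> g \<in> Ar \<Longrightarrow> d g = c f \<Longrightarrow> g \<cdot>\<^bsub>mk_cat Ob Ar d c i m\<^esub> f = m g f"
  by (simp_all add: mk_cat_def)

lemma mk_cat_category:
  assumes "\<And>f. f \<in> Ar \<Longrightarrow> d f \<in> Ob \<and> c f \<in> Ob"
    and "\<And>x. x \<in> Ob \<Longrightarrow> i x \<in> Ar \<and> d (i x) = x \<and> c (i x) = x"
    and "\<And>f g. f \<in> Ar \<Longrightarrow> g \<in> Ar \<Longrightarrow> d g = c f \<Longrightarrow> m g f \<in> Ar \<and> d (m g f) = d f \<and> c (m g f) = c g"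
    and "\<And>f. f \<in> Ar \<Longrightarrow> m f (i (d f)) = f \<and> m (i (c f)) f = f"
    and "\<And>f g h. f \<in> Ar \<Longrightarrow> g \<in> Ar \<Longrightarrow> h \<in> Ar \<Longrightarrow> d g = c f \<Longrightarrow> d h = c g \<Longrightarrow>
           m h (m g f) = m (m h g) f"
  shows "category (mk_cat Ob Ar d c i m)"
  unfolding category_def Hom_iff
  using assms by (auto simp: mk_cat_def)

lemma functor_simps:
  assumes "is_functor F C D"
  shows "Src F = C" "Tgt F = D" "x \<in> Obj C \<Longrightarrow> Fo F x \<in> Obj D"
    "f \<in> Arr C \<Longrightarrow> Fa F f \<in> Arr D"
    "f \<in> Arr C \<Longrightarrow> Dom D (Fa F f) = Fo F (Dom C f)"
    "f \<in> Arr C \<Longrightarrow> Cod D (Fa F f) = Fo F (Cod C f)"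
    "x \<in> Obj C \<Longrightarrow> Fa F (Ide C x) = Ide D (Fo F x)"
    "f \<in> Arr C \<Longrightarrow> g \<in> Arr C \<Longrightarrow> Dom C g = Cod C f \<Longrightarrow> Fa F (g \<cdot>\<^bsub>C\<^esub> f) = Fa F g \<cdot>\<^bsub>D\<^esub> Fa F f"
  using assms by (simp_all add: is_functor_def Hom_iff)

lemma functor_cat:
  assumes "is_functor F C D"
  shows "category C" "category D"
  using assms unfolding is_functor_def by blast+

lemma mk_func_simps [simp]:
  "Src (mk_func C D fo fa) = C" "Tgt (mk_func C D fo fa) = D"
  "x \<in> Obj C \<Longrightarrow> Fo (mk_func C D fo fa) x = fo x" "f \<in> Arr C \<Longrightarrow> Fa (mk_func C D fo fa) f = fa f"
  by (simp_all add: mk_func_def)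

lemma mk_func_functor:
  assumes "category C" "category D"
    and "\<And>x. x \<in> Obj C \<Longrightarrow> fo x \<in> Obj D"
    and "\<And>f. f \<in> Arr C \<Longrightarrow> fa f \<in> Arr D \<and> Dom D (fa f) = fo (Dom C f) \<and> Cod D (fa f) = fo (Cod C f)"
    and "\<And>x. x \<in> Obj C \<Longrightarrow> fa (Ide C x) = Ide D (fo x)"
    and "\<And>f g. f \<in> Arr C \<Longrightarrow> g \<in> Arr C \<Longrightarrow> Dom C g = Cod C f \<Longrightarrow> fa (g \<cdot>\<^bsub>C\<^esub> f) = fa g \<cdot>\<^bsub>D\<^esub> fa f"
  shows "is_functor (mk_func C D fo fa) C D"
  using assms(1,2) unfolding is_functor_def Hom_iff
  by (auto simp: mk_func_def cat_simps[OF assms(1)] assms(3-6))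

lemma func_eqI:
  assumes "is_functor F C D" "is_functor G C D"
    and "\<And>x. x \<in> Obj C \<Longrightarrow> Fo F x = Fo G x" and "\<And>f. f \<in> Arr C \<Longrightarrow> Fa F f = Fa G f"
  shows "F = G"
proof -
  have "Fo F = Fo G" using assms unfolding is_functor_def by (meson extensionalityI)
  moreover have "Fa F = Fa G" using assms unfolding is_functor_def by (meson extensionalityI)
  ultimately show ?thesis using assms(1,2) unfolding is_functor_def by (simp add: func.equality)
qed

lemma idf_simps [simp]:
  "Src (idf C) = C" "Tgt (idf C) = C" "x \<in> Obj C \<Longrightarrow> Fo (idf C) x = x" "f \<in> Arr C \<Longrightarrow> Fa (idf C) f = f"
  by (simp_all add: idf_def)

lemma idf_functor: "category C \<Longrightarrow> is_functor (idf C) C C"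
  unfolding idf_def by (rule mk_func_functor) auto

lemma fcomp_simps [simp]:
  "Src (G \<odot> F) = Src F" "Tgt (G \<odot> F) = Tgt G"
  "x \<in> Obj (Src F) \<Longrightarrow> Fo (G \<odot> F) x = Fo G (Fo F x)"
  "f \<in> Arr (Src F) \<Longrightarrow> Fa (G \<odot> F) f = Fa G (Fa F f)"
  by (simp_all add: fcomp_def)

lemma fcomp_functor:
  assumes "is_functor F C D" "is_functor G D E"
  shows "is_functor (G \<odot> F) C E"
proof -
  note [simp] = functor_simps[OF assms(1)] functor_simps[OF assms(2)]
  show ?thesis unfolding fcomp_def
    by simp (rule mk_func_functor; simp add: functor_cat(1)[OF assms(1)] functor_cat(2)[OF assms(2)])
qed

lemma fcomp_assoc:
  assumes "is_functor F C D" "is_functor G D E" "is_functor H E K"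
  shows "(H \<odot> G) \<odot> F = H \<odot> (G \<odot> F)"
proof -
  note [simp] = functor_simps[OF assms(1)] functor_simps[OF assms(2)]
  show ?thesis
    by (rule func_eqI[of _ C K]) (auto intro: fcomp_functor assms)
qed

lemma fcomp_idf:
  assumes "is_functor F C D"
  shows "F \<odot> idf C = F" "idf D \<odot> F = F"
proof -
  note [simp] = functor_simps[OF assms(1)]
  have i: "is_functor (idf C) C C" "is_functor (idf D) D D"
    using functor_cat[OF assms] idf_functor by auto
  show "F \<odot> idf C = F"
    by (rule func_eqI[of _ C D]) (auto intro: fcomp_functor assms i)
  show "idf D \<odot> F = F"
    by (rule func_eqI[of _ C D]) (auto intro: fcomp_functor assms i)
qed

lemma nt_simps:
  assumes "is_nt \<alpha> F G" "is_functor F C D"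
  shows "NSrc \<alpha> = F" "NTgt \<alpha> = G" "x \<in> Obj C \<Longrightarrow> At \<alpha> x \<in> Arr D"
    "x \<in> Obj C \<Longrightarrow> Dom D (At \<alpha> x) = Fo F x" "x \<in> Obj C \<Longrightarrow> Cod D (At \<alpha> x) = Fo G x"
  using assms functor_simps(1,2)[OF assms(2)] by (simp_all add: is_nt_def Hom_iff)

lemma nt_natural:
  assumes "is_nt \<alpha> F G" "is_functor F C D" "f \<in> Arr C" "Dom C f = x" "Cod C f = y"
  shows "At \<alpha> y \<cdot>\<^bsub>D\<^esub> Fa F f = Fa G f \<cdot>\<^bsub>D\<^esub> At \<alpha> x"
  using assms functor_simps(1,2)[OF assms(2)] by (auto simp: is_nt_def Hom_iff)

lemma nt_functor:
  assumes "is_nt \<alpha> F G"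
  shows "is_functor F (Src F) (Tgt F)" "is_functor G (Src F) (Tgt F)"
  using assms unfolding is_nt_def by blast+

lemma nt_functors:
  assumes "is_nt \<alpha> F G" "is_functor F C D"
  shows "is_functor G C D"
  using assms functor_simps(1,2)[OF assms(2)] unfolding is_nt_def by blast

lemma mk_nt_simps [simp]:
  "NSrc (mk_nt F G c) = F" "NTgt (mk_nt F G c) = G" "x \<in> Obj (Src F) \<Longrightarrow> At (mk_nt F G c) x = c x"
  by (simp_all add: mk_nt_def)

lemma mk_nt_nt:
  assumes "is_functor F C D" "is_functor G C D"
    and "\<And>x. x \<in> Obj C \<Longrightarrow> c x \<in> Arr D \<and> Dom D (c x) = Fo F x \<and> Cod D (c x) = Fo G x"
    and "\<And>f. f \<in> Arr C \<Longrightarrow> c (Cod C f) \<cdot>\<^bsub>D\<^esub> Fa F f = Fa G f \<cdot>\<^bsub>D\<^esub> c (Dom C f)"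
  shows "is_nt (mk_nt F G c) F G"
proof -
  note [simp] = functor_simps(1,2)[OF assms(1)] cat_simps[OF functor_cat(1)[OF assms(1)]]
  show ?thesis using assms unfolding is_nt_def Hom_iff by (auto simp: mk_nt_def)
qed

lemma nt_eqI:
  assumes "is_nt \<alpha> F G" "is_nt \<beta> F G" "\<And>x. x \<in> Obj (Src F) \<Longrightarrow> At \<alpha> x = At \<beta> x"
  shows "\<alpha> = \<beta>"
proof -
  have "At \<alpha> = At \<beta>" using assms unfolding is_nt_def by (meson extensionalityI)
  then show ?thesis using assms(1,2) unfolding is_nt_def by (simp add: ntrans.equality)
qed

lemma idn_simps [simp]:
  "NSrc (idn F) = F" "NTgt (idn F) = F" "x \<in> Obj (Src F) \<Longrightarrow> At (idn F) x = Ide (Tgt F) (Fo F x)"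
  by (simp_all add: idn_def)

lemma idn_nt: "is_functor F C D \<Longrightarrow> is_nt (idn F) F F"
  unfolding idn_def
proof -
  assume F: "is_functor F C D"
  show "is_nt (mk_nt F F (\<lambda>x. Ide (Tgt F) (Fo F x))) F F"
    by (rule mk_nt_nt[of F C D])
      (simp_all add: F functor_simps[OF F] cat_simps[OF functor_cat(1)[OF F]] cat_simps[OF functor_cat(2)[OF F]])
qed

lemma vcomp_simps [simp]:
  "NSrc (\<beta> \<bullet> \<alpha>) = NSrc \<alpha>" "NTgt (\<beta> \<bullet> \<alpha>) = NTgt \<beta>"
  "x \<in> Obj (Src (NSrc \<alpha>)) \<Longrightarrow> At (\<beta> \<bullet> \<alpha>) x = At \<beta> x \<cdot>\<^bsub>Tgt (NSrc \<alpha>)\<^esub> At \<alpha> x"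
  by (simp_all add: vcomp_def)

lemma vcomp_nt:
  assumes "is_nt \<alpha> F G" "is_nt \<beta> G H"
  shows "is_nt (\<beta> \<bullet> \<alpha>) F H"
proof -
  define C D where "C = Src F" and "D = Tgt F"
  have F: "is_functor F C D" and G: "is_functor G C D" and H: "is_functor H C D"
    using nt_functor[OF assms(1)] nt_functors[OF assms(2)] by (auto simp: C_def D_def)
  note cC = functor_cat(1)[OF F] and cD = functor_cat(2)[OF F]
  note [simp] = cat_simps[OF cC] cat_simps[OF cD] functor_simps[OF F] functor_simps[OF G]
    functor_simps[OF H] nt_simps[OF assms(1) F] nt_simps[OF assms(2) G]
  have "(At \<beta> (Cod C f) \<cdot>\<^bsub>D\<^esub> At \<alpha> (Cod C f)) \<cdot>\<^bsub>D\<^esub> Fa F f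
      = Fa H f \<cdot>\<^bsub>D\<^esub> (At \<beta> (Dom C f) \<cdot>\<^bsub>D\<^esub> At \<alpha> (Dom C f))" if f: "f \<in> Arr C" for f
  proof -
    have "(At \<beta> (Cod C f) \<cdot>\<^bsub>D\<^esub> At \<alpha> (Cod C f)) \<cdot>\<^bsub>D\<^esub> Fa F f
        = At \<beta> (Cod C f) \<cdot>\<^bsub>D\<^esub> (Fa G f \<cdot>\<^bsub>D\<^esub> At \<alpha> (Dom C f))"
      using f by (simp add: cat_assoc[OF cD] nt_natural[OF assms(1) F f])
    also have "\<dots> = (At \<beta> (Cod C f) \<cdot>\<^bsub>D\<^esub> Fa G f) \<cdot>\<^bsub>D\<^esub> At \<alpha> (Dom C f)"
      using f by (simp add: cat_assoc[OF cD])
    also have "\<dots> = Fa H f \<cdot>\<^bsub>D\<^esub> (At \<beta> (Dom C f) \<cdot>\<^bsub>D\<^esub> At \<alpha> (Dom C f))"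
      using f by (simp add: cat_assoc[OF cD] nt_natural[OF assms(2) G f])
    finally show ?thesis .
  qed
  then show ?thesis unfolding vcomp_def by simp (rule mk_nt_nt[OF F H]; simp)
qed

lemma whisker_simps [simp]:
  "NSrc (K \<rhd> \<alpha>) = K \<odot> NSrc \<alpha>" "NTgt (K \<rhd> \<alpha>) = K \<odot> NTgt \<alpha>"
  "x \<in> Obj (Src (NSrc \<alpha>)) \<Longrightarrow> At (K \<rhd> \<alpha>) x = Fa K (At \<alpha> x)"
  "NSrc (\<beta> \<lhd> L) = NSrc \<beta> \<odot> L" "NTgt (\<beta> \<lhd> L) = NTgt \<beta> \<odot> L"
  "y \<in> Obj (Src L) \<Longrightarrow> At (\<beta> \<lhd> L) y = At \<beta> (Fo L y)"
  by (simp_all add: whisker_left_def whisker_right_def)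

lemma whisker_left_nt:
  assumes "is_nt \<alpha> F G" "is_functor F C D" "is_functor K D E"
  shows "is_nt (K \<rhd> \<alpha>) (K \<odot> F) (K \<odot> G)"
proof -
  note G = nt_functors[OF assms(1,2)]
  note cC = functor_cat(1)[OF assms(2)] and cD = functor_cat(2)[OF assms(2)]
  note [simp] = cat_simps[OF cC] cat_simps[OF cD] functor_simps[OF assms(2)] functor_simps[OF G]
    functor_simps[OF assms(3)] nt_simps[OF assms(1,2)]
  have "Fa K (At \<alpha> (Cod C f)) \<cdot>\<^bsub>E\<^esub> Fa K (Fa F f) = Fa K (Fa G f) \<cdot>\<^bsub>E\<^esub> Fa K (At \<alpha> (Dom C f))"
    if f: "f \<in> Arr C" for f
    using f nt_natural[OF assms(1,2) f refl refl, THEN arg_cong[of _ _ "Fa K"]] by simp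
  then show ?thesis unfolding whisker_left_def
    by simp (rule mk_nt_nt[of _ C E]; simp add: fcomp_functor[OF assms(2,3)] fcomp_functor[OF G assms(3)])
qed

lemma whisker_right_nt:
  assumes "is_nt \<alpha> F G" "is_functor F C D" "is_functor K B C"
  shows "is_nt (\<alpha> \<lhd> K) (F \<odot> K) (G \<odot> K)"
proof -
  note G = nt_functors[OF assms(1,2)]
  note cC = functor_cat(1)[OF assms(3)]
  note [simp] = cat_simps[OF cC] functor_simps[OF assms(2)] functor_simps[OF G]
    functor_simps[OF assms(3)] nt_simps[OF assms(1,2)]
  show ?thesis unfolding whisker_right_def
    by simp (rule mk_nt_nt[of _ B D]; simp add: fcomp_functor[OF assms(3,2)] fcomp_functor[OF assms(3) G]
      nt_natural[OF assms(1,2)])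
qed

lemma godement_simps [simp]:
  "NSrc (\<alpha> \<star> \<beta>) = NSrc \<alpha> \<odot> NSrc \<beta>" "NTgt (\<alpha> \<star> \<beta>) = NTgt \<alpha> \<odot> NTgt \<beta>"
  by (simp_all add: godement_def)

lemma godement_at:
  assumes "is_nt \<beta> H K" "is_functor H B C" "x \<in> Obj B" "is_nt \<alpha> F G" "is_functor F C D"
  shows "At (\<alpha> \<star> \<beta>) x = At \<alpha> (Fo K x) \<cdot>\<^bsub>D\<^esub> Fa F (At \<beta> x)"
  using assms functor_simps(1,2)[OF assms(2)] functor_simps(1,2)[OF assms(5)] nt_simps[OF assms(1,2)]
    nt_simps[OF assms(4,5)] functor_simps(1,2)[OF nt_functors[OF assms(1,2)]]
  by (simp add: godement_def)

lemma godement_nt: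
  assumes "is_nt \<beta> H K" "is_functor H B C" "is_nt \<alpha> F G" "is_functor F C D"
  shows "is_nt (\<alpha> \<star> \<beta>) (F \<odot> H) (G \<odot> K)"
  unfolding godement_def nt_simps(1,2)[OF assms(1,2)] nt_simps(1,2)[OF assms(3,4)]
  by (rule vcomp_nt[OF whisker_left_nt[OF assms(1,2,4)]
        whisker_right_nt[OF assms(3,4) nt_functors[OF assms(1,2)]]])

lemma godement_alt:
  assumes "is_nt \<beta> H K" "is_functor H B C" "is_nt \<alpha> F G" "is_functor F C D"
  shows "(G \<rhd> \<beta>) \<bullet> (\<alpha> \<lhd> H) = \<alpha> \<star> \<beta>"
proof -
  note G = nt_functors[OF assms(3,4)] and K = nt_functors[OF assms(1,2)]
  note [simp] = functor_simps[OF assms(2)] functor_simps[OF assms(4)]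
    nt_simps[OF assms(1,2)]  nt_simps[OF assms(3,4)] functor_simps[OF G] functor_simps[OF K]
  show ?thesis
    by (rule nt_eqI[of _ "F \<odot> H" "G \<odot> K"])
      (auto simp: godement_at[OF assms(1,2) _ assms(3,4)] nt_natural[OF assms(3,4)] intro!: vcomp_nt whisker_left_nt[OF assms(1,2)] whisker_right_nt[OF assms(3,4)]
      G assms godement_nt)
qed

lemma vcomp_assoc:
  assumes "is_nt \<alpha> F G" "is_nt \<beta> G H" "is_nt \<gamma> H K"
  shows "(\<gamma> \<bullet> \<beta>) \<bullet> \<alpha> = \<gamma> \<bullet> (\<beta> \<bullet> \<alpha>)"
proof -
  define C D where "C = Src F" and "D = Tgt F"
  have F: "is_functor F C D" and G: "is_functor G C D" and H: "is_functor H C D"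
    using nt_functor[OF assms(1)] nt_functors[OF assms(2)] by (auto simp: C_def D_def)
  note [simp] = functor_simps[OF F] functor_simps[OF G]
    functor_simps[OF H] nt_simps[OF assms(1) F] nt_simps[OF assms(2) G] nt_simps[OF assms(3) H]
  show ?thesis
    by (rule nt_eqI[of _ F K]) (auto intro!: vcomp_nt assms simp: cat_assoc[OF functor_cat(2)[OF F]]
     intro: assms)
qed

lemma vcomp_idn:
  assumes "is_nt \<alpha> F G"
  shows "\<alpha> \<bullet> idn F = \<alpha>" "idn G \<bullet> \<alpha> = \<alpha>"
proof -
  define C D where "C = Src F" and "D = Tgt F"
  have F: "is_functor F C D" and G: "is_functor G C D"
    using nt_functor[OF assms(1)]  by (auto simp: C_def D_def)
  note [simp] = functor_simps[OF F] functor_simps[OF G] nt_simps[OF assms F] cat_simps[OF functor_cat(2)[OF F]]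
  show "\<alpha> \<bullet> idn F = \<alpha>" "idn G \<bullet> \<alpha> = \<alpha>"
    by (rule nt_eqI[of _ F G]; auto intro!: vcomp_nt assms idn_nt[OF F] idn_nt[OF G] intro: assms idn_nt[OF F] idn_nt[OF G])+
qed

lemma whisker_idn:
  assumes "is_functor F C D" "is_functor K D E"
  shows "K \<rhd> idn F = idn (K \<odot> F)" "idn K \<lhd> F = idn (K \<odot> F)"
proof -
  note cat_simps(3)[OF functor_cat(2)[OF assms(1)], simp]
  note [simp] = functor_simps[OF assms(1)] functor_simps[OF assms(2)]
  note KF = fcomp_functor[OF assms]
  show "K \<rhd> idn F = idn (K \<odot> F)" "idn K \<lhd> F = idn (K \<odot> F)"
    by (rule nt_eqI[of _ "K \<odot> F" "K \<odot> F"];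
        auto intro: idn_nt[OF KF] whisker_left_nt[OF idn_nt[OF assms(1)] assms] whisker_right_nt[OF idn_nt[OF assms(2)] assms(2,1)])+
qed

lemma godement_idn:
  assumes "is_functor F C D" "is_functor K D E"
  shows "idn K \<star> idn F = idn (K \<odot> F)"
  using whisker_idn[OF assms] vcomp_idn[OF idn_nt[OF fcomp_functor[OF assms]]]
  by (simp add: godement_def)

lemma interchange:
  assumes "is_nt \<beta> H H'" "is_nt \<beta>' H' H''" "is_functor H B C"
    and "is_nt \<alpha> F F'" "is_nt \<alpha>' F' F''" "is_functor F C D"
  shows "(\<alpha>' \<bullet> \<alpha>) \<star> (\<beta>' \<bullet> \<beta>) = (\<alpha>' \<star> \<beta>') \<bullet> (\<alpha> \<star> \<beta>)"
proof -
  note H' = nt_functors[OF assms(1,3)] and F' = nt_functors[OF assms(4,6)]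
  note H'' = nt_functors[OF assms(2) H'] and F'' = nt_functors[OF assms(5) F']
  note cD = functor_cat(2)[OF F']
  note [simp] = functor_simps[OF assms(3)] functor_simps[OF assms(6)] functor_simps[OF H']
    functor_simps[OF F'] functor_simps[OF H''] functor_simps[OF F'']
    nt_simps[OF assms(1,3)] nt_simps[OF assms(2) H'] nt_simps[OF assms(4,6)] nt_simps[OF assms(5) F']
    cat_simps[OF functor_cat(2)[OF H']] cat_simps[OF cD]
    godement_at[OF assms(1,3) _ assms(4,6)] godement_at[OF assms(2) H' _ assms(5) F']
    godement_at[OF vcomp_nt[OF assms(1,2)] assms(3) _ vcomp_nt[OF assms(4,5)] assms(6)]
  show ?thesis
  proof (rule nt_eqI[of _ "F \<odot> H" "F'' \<odot> H''"])
    fix x assume "x \<in> Obj (Src (F \<odot> H))"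
    then have x: "x \<in> Obj B" by simp
    \<comment> \<open>the two middle factors are exchanged by naturality of \<open>\<alpha>\<close> at the component of \<open>\<beta>'\<close>\<close>
    have n: "At \<alpha> (Fo H'' x) \<cdot>\<^bsub>D\<^esub> Fa F (At \<beta>' x) = Fa F' (At \<beta>' x) \<cdot>\<^bsub>D\<^esub> At \<alpha> (Fo H' x)"
      using x by (intro nt_natural[OF assms(4,6)]) auto
    show "At ((\<alpha>' \<bullet> \<alpha>) \<star> (\<beta>' \<bullet> \<beta>)) x = At ((\<alpha>' \<star> \<beta>') \<bullet> (\<alpha> \<star> \<beta>)) x"
      using x by (simp add: cat_assoc[OF cD] comp_tail[OF cD n])
  qed (auto intro: godement_nt[OF _ assms(3) _ assms(6)] godement_nt[OF _ H' _ F'] vcomp_nt assms)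
qed

lemma vcomp_eqI:
  assumes "NSrc \<alpha> = NSrc \<alpha>'" "NTgt \<beta> = NTgt \<beta>'"
    and "\<And>x. x \<in> Obj (Src (NSrc \<alpha>)) \<Longrightarrow>
           At \<beta> x \<cdot>\<^bsub>Tgt (NSrc \<alpha>)\<^esub> At \<alpha> x = At \<beta>' x \<cdot>\<^bsub>Tgt (NSrc \<alpha>)\<^esub> At \<alpha>' x"
  shows "\<beta> \<bullet> \<alpha> = \<beta>' \<bullet> \<alpha>'"
  using assms by (auto simp: vcomp_def mk_nt_def restrict_def)

lemma vcomp_idnI:
  assumes "NSrc \<alpha> = F" "NTgt \<beta> = F"
    and "\<And>x. x \<in> Obj (Src F) \<Longrightarrow> At \<beta> x \<cdot>\<^bsub>Tgt F\<^esub> At \<alpha> x = Ide (Tgt F) (Fo F x)"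
  shows "\<beta> \<bullet> \<alpha> = idn F"
  using assms by (auto simp: vcomp_def idn_def mk_nt_def restrict_def)

text \<open>Variants whose premises have no variables beyond those of the conclusion, for rewriting.\<close>

lemma fcomp_functor':
  "is_functor F C (Src G) \<Longrightarrow> is_functor G (Src G) E \<Longrightarrow> is_functor (G \<odot> F) C E"
  by (rule fcomp_functor)

lemma fcomp_assoc':
  "is_functor F (Src F) (Src G) \<Longrightarrow> is_functor G (Src G) (Src H) \<Longrightarrow> is_functor H (Src H) (Tgt H) \<Longrightarrow>
     (H \<odot> G) \<odot> F = H \<odot> (G \<odot> F)"
  by (rule fcomp_assoc)

lemma fcomp_idf':
  "is_functor F C (Tgt F) \<Longrightarrow> F \<odot> idf C = F" "is_functor F (Src F) D \<Longrightarrow> idf D \<odot> F = F"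
  by (rule fcomp_idf, assumption)+

lemma nt_cong: "is_nt \<alpha> F G \<Longrightarrow> F = F' \<Longrightarrow> G = G' \<Longrightarrow> is_nt \<alpha> F' G'"
  by simp

lemma vcomp_eqD:
  assumes "\<beta> \<bullet> \<alpha> = \<beta>' \<bullet> \<alpha>'" "x \<in> Obj (Src (NSrc \<alpha>))"
  shows "At \<beta> x \<cdot>\<^bsub>Tgt (NSrc \<alpha>)\<^esub> At \<alpha> x = At \<beta>' x \<cdot>\<^bsub>Tgt (NSrc \<alpha>)\<^esub> At \<alpha>' x"
  using arg_cong[OF assms(1), of NSrc] arg_cong[OF assms(1), of "\<lambda>\<alpha>. At \<alpha> x"] assms(2) by simp

lemma vcomp_idnD:
  assumes "\<beta> \<bullet> \<alpha> = idn F" "x \<in> Obj (Src (NSrc \<alpha>))"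
  shows "At \<beta> x \<cdot>\<^bsub>Tgt (NSrc \<alpha>)\<^esub> At \<alpha> x = Ide (Tgt F) (Fo F x)"
  using arg_cong[OF assms(1), of NSrc] arg_cong[OF assms(1), of "\<lambda>\<alpha>. At \<alpha> x"] assms(2) by simp

lemma whisker_whisker:
  assumes "is_nt \<alpha> F F'" "is_functor F C D" "is_functor G D E" "is_functor H E K"
  shows "H \<rhd> (G \<rhd> \<alpha>) = (H \<odot> G) \<rhd> \<alpha>"
proof -
  note F' = nt_functors[OF assms(1,2)] and HG = fcomp_functor[OF assms(3,4)]
  note l = whisker_left_nt[OF assms(1,2)]
  note [simp] = functor_simps[OF assms(2)] functor_simps[OF assms(3)] nt_simps[OF assms(1,2)]
  show ?thesis
    by (rule nt_eqI[OF nt_cong[OF whisker_left_nt[OF l[OF assms(3)] fcomp_functor[OF assms(2,3)] assms(4)]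
            fcomp_assoc[OF assms(2-4), symmetric] fcomp_assoc[OF F' assms(3,4), symmetric]] l[OF HG]]) simp
qed

lemma whisker_whisker_right:
  assumes "is_nt \<alpha> G G'" "is_functor H B C" "is_functor F C D" "is_functor G D E"
  shows "(\<alpha> \<lhd> F) \<lhd> H = \<alpha> \<lhd> (F \<odot> H)"
proof -
  note G' = nt_functors[OF assms(1,4)]
  note r = whisker_right_nt[OF assms(1,4)]
  note [simp] = functor_simps[OF assms(2)] functor_simps[OF assms(3)]
  show ?thesis
    by (rule nt_eqI[OF nt_cong[OF whisker_right_nt[OF r[OF assms(3)] fcomp_functor[OF assms(3,4)] assms(2)]
            fcomp_assoc[OF assms(2-4)] fcomp_assoc[OF assms(2,3) G']] r[OF fcomp_functor[OF assms(2,3)]]]) simp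
qed

lemma whisker_left_right:
  assumes "is_nt \<alpha> F F'" "is_functor H B C" "is_functor F C D" "is_functor G D E"
  shows "(G \<rhd> \<alpha>) \<lhd> H = G \<rhd> \<alpha> \<lhd> H"
proof -
  note F' = nt_functors[OF assms(1,3)]
  note [simp] = functor_simps[OF assms(2)] functor_simps[OF assms(3)] nt_simps[OF assms(1,3)]
  show ?thesis
    by (rule nt_eqI[OF nt_cong[OF whisker_right_nt[OF whisker_left_nt[OF assms(1,3,4)] fcomp_functor[OF assms(3,4)] assms(2)]
            fcomp_assoc[OF assms(2-4)] fcomp_assoc[OF assms(2) F' assms(4)]]
        whisker_left_nt[OF whisker_right_nt[OF assms(1,3,2)] fcomp_functor[OF assms(2,3)] assms(4)]]) simp
qed

lemma whisker_vcomp: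
  assumes "is_nt \<alpha> F G" "is_nt \<beta> G H" "is_functor F C D" "is_functor K D E"
  shows "K \<rhd> (\<beta> \<bullet> \<alpha>) = (K \<rhd> \<beta>) \<bullet> (K \<rhd> \<alpha>)"
proof -
  note G = nt_functors[OF assms(1,3)]
  note [simp] = functor_simps[OF assms(3)] functor_simps[OF assms(4)] functor_simps[OF G]
    nt_simps[OF assms(1,3)] nt_simps[OF assms(2) G]
  show ?thesis
    by (rule nt_eqI[OF whisker_left_nt[OF vcomp_nt[OF assms(1,2)] assms(3,4)]
          vcomp_nt[OF whisker_left_nt[OF assms(1,3,4)] whisker_left_nt[OF assms(2) G assms(4)]]]) simp
qed

section \<open>Equivalences and adjunctions whose unit is an identity\<close>

lemma naturally_isomorphic_refl: "is_functor F C D \<Longrightarrow> naturally_isomorphic F F"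
  unfolding naturally_isomorphic_def
  using idn_nt[of F C D] vcomp_idn(1)[OF idn_nt[of F C D]] by blast

lemma naturally_isomorphic_components:
  assumes "naturally_isomorphic F (idf C)" "is_functor F C C"
  obtains \<alpha> \<beta> where "is_nt \<alpha> F (idf C)" "is_nt \<beta> (idf C) F"
    "\<And>x. x \<in> Obj C \<Longrightarrow> At \<beta> x \<cdot>\<^bsub>C\<^esub> At \<alpha> x = Ide C (Fo F x)"
    "\<And>x. x \<in> Obj C \<Longrightarrow> At \<alpha> x \<cdot>\<^bsub>C\<^esub> At \<beta> x = Ide C x"
proof -
  obtain \<alpha> \<beta> where a: "is_nt \<alpha> F (idf C)" and b: "is_nt \<beta> (idf C) F"
    and e: "\<beta> \<bullet> \<alpha> = idn F" "\<alpha> \<bullet> \<beta> = idn (idf C)"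
    using assms(1) unfolding naturally_isomorphic_def by blast
  note [simp] = functor_simps[OF assms(2)] nt_simps(1,2)[OF a assms(2)]
    nt_simps(1,2)[OF b idf_functor[OF functor_cat(1)[OF assms(2)]]]
  have "At (\<beta> \<bullet> \<alpha>) x = At (idn F) x" "At (\<alpha> \<bullet> \<beta>) x = At (idn (idf C)) x" for x
    by (simp_all add: e)
  then have "At \<beta> x \<cdot>\<^bsub>C\<^esub> At \<alpha> x = Ide C (Fo F x)" "At \<alpha> x \<cdot>\<^bsub>C\<^esub> At \<beta> x = Ide C x"
    if "x \<in> Obj C" for x
    using that vcomp_simps(3)[of x \<alpha> \<beta>] vcomp_simps(3)[of x \<beta> \<alpha>] by simp_all
  then show ?thesis by (rule that[OF a b])
qed

definition inverse_arrows :: "('o, 'a) cat \<Rightarrow> 'a \<Rightarrow> 'a \<Rightarrow> bool" where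
  "inverse_arrows C f g \<longleftrightarrow> f \<in> Arr C \<and> g \<in> Arr C \<and> Dom C g = Cod C f \<and> Cod C g = Dom C f \<and>
     g \<cdot>\<^bsub>C\<^esub> f = Ide C (Dom C f) \<and> f \<cdot>\<^bsub>C\<^esub> g = Ide C (Cod C f)"

lemma naturally_isomorphicI:
  assumes "is_nt \<alpha> F G" "is_functor F C D" "\<And>x. x \<in> Obj C \<Longrightarrow> \<exists>g. inverse_arrows D (At \<alpha> x) g"
  shows "naturally_isomorphic F G"
proof -
  note G = nt_functors[OF assms(1,2)]
  note cC = functor_cat(1)[OF G] and cD = functor_cat(2)[OF G]
  note [simp] = functor_simps[OF assms(2)] functor_simps[OF G] nt_simps[OF assms(1,2)]
    cat_simps[OF cC] cat_simps[OF cD]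
  obtain b where b: "\<And>x. x \<in> Obj C \<Longrightarrow> inverse_arrows D (At \<alpha> x) (b x)"
    using assms(3) by metis
  have bs [simp]: "b x \<in> Arr D" "Dom D (b x) = Fo G x" "Cod D (b x) = Fo F x"
    "b x \<cdot>\<^bsub>D\<^esub> At \<alpha> x = Ide D (Fo F x)" "At \<alpha> x \<cdot>\<^bsub>D\<^esub> b x = Ide D (Fo G x)"
    if "x \<in> Obj C" for x
    using b[OF that] that by (auto simp: inverse_arrows_def)
  have nat: "b (Cod C f) \<cdot>\<^bsub>D\<^esub> Fa G f = Fa F f \<cdot>\<^bsub>D\<^esub> b (Dom C f)" if f: "f \<in> Arr C" for f
  proof -
    have "b (Cod C f) \<cdot>\<^bsub>D\<^esub> Fa G f = b (Cod C f) \<cdot>\<^bsub>D\<^esub> ((Fa G f \<cdot>\<^bsub>D\<^esub> At \<alpha> (Dom C f)) \<cdot>\<^bsub>D\<^esub> b (Dom C f))"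
      using f by (simp add: cat_assoc[OF cD])
    also have "\<dots> = (b (Cod C f) \<cdot>\<^bsub>D\<^esub> At \<alpha> (Cod C f)) \<cdot>\<^bsub>D\<^esub> (Fa F f \<cdot>\<^bsub>D\<^esub> b (Dom C f))"
      unfolding nt_natural[OF assms(1,2) f refl refl, symmetric]
      using f by (simp add: cat_assoc[OF cD] del: bs(4,5))
    also have "\<dots> = Fa F f \<cdot>\<^bsub>D\<^esub> b (Dom C f)" using f by simp
    finally show ?thesis .
  qed
  define \<beta> where "\<beta> = mk_nt G F b"
  have \<beta>: "is_nt \<beta> G F"
    unfolding \<beta>_def by (rule mk_nt_nt[OF G assms(2)]) (simp_all add: nat)
  have "\<beta> \<bullet> \<alpha> = idn F"
    by (rule nt_eqI[OF vcomp_nt[OF assms(1) \<beta>] idn_nt[OF assms(2)]]) (simp add: \<beta>_def)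
  moreover have "\<alpha> \<bullet> \<beta> = idn G"
    by (rule nt_eqI[OF vcomp_nt[OF \<beta> assms(1)] idn_nt[OF G]]) (simp add: \<beta>_def)
  ultimately show ?thesis
    unfolding naturally_isomorphic_def using assms(1) \<beta> by blast
qed

text \<open>The isomorphism of \<open>GF\<close> with the identity recovers \<open>f\<close> from \<open>GFf\<close> by conjugation.\<close>

lemma left_inverse_faithful:
  assumes F: "is_functor F C D" and G: "is_functor G D C"
    and ni: "naturally_isomorphic (G \<odot> F) (idf C)"
    and f: "f \<in> Arr C" "f' \<in> Arr C" "Dom C f = Dom C f'" "Cod C f = Cod C f'" "Fa F f = Fa F f'"
  shows "f = f'"
proof -
  note cC = functor_cat(1)[OF F]
  note GF = fcomp_functor[OF F G]
  obtain \<alpha> \<beta> where a: "is_nt \<alpha> (G \<odot> F) (idf C)" and b: "is_nt \<beta> (idf C) (G \<odot> F)"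
    and ab: "\<And>x. x \<in> Obj C \<Longrightarrow> At \<alpha> x \<cdot>\<^bsub>C\<^esub> At \<beta> x = Ide C x"
    by (rule naturally_isomorphic_components[OF ni GF]) blast
  note [simp] = functor_simps[OF F] functor_simps[OF G] nt_simps[OF a GF]
    nt_simps[OF b idf_functor[OF cC]] cat_simps[OF cC]
  have "h = (At \<alpha> (Cod C h) \<cdot>\<^bsub>C\<^esub> Fa G (Fa F h)) \<cdot>\<^bsub>C\<^esub> At \<beta> (Dom C h)" if h: "h \<in> Arr C" for h
    using h nt_natural[OF a GF h refl refl] by (simp add: cat_assoc[OF cC] ab)
  then show ?thesis using f by metis
qed

lemma inverse_equivalences_faithful:
  assumes "inverse_equivalences F G"
  shows "faithful F"
proof -
  have F: "is_functor F (Src F) (Tgt F)" and G: "is_functor G (Tgt F) (Src F)"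
    and n: "naturally_isomorphic (G \<odot> F) (idf (Src F))"
    using assms by (auto simp: inverse_equivalences_def)
  show ?thesis unfolding faithful_def
    by (intro ballI inj_onI left_inverse_faithful[OF F G n]) (auto simp: Hom_iff)
qed

lemma inverse_equivalences_sym:
  assumes "inverse_equivalences F G"
  shows "inverse_equivalences G F"
  using assms functor_simps(1,2)[of G] by (auto simp: inverse_equivalences_def)

text \<open>A preimage of \<open>h\<close> is the conjugate of \<open>Gh\<close> by the isomorphism of \<open>GF\<close> with the identity.  That
  \<open>F\<close> maps it to \<open>h\<close> can be tested after applying \<open>G\<close>, which is faithful as well.\<close>

lemma inverse_equivalences_full:
  assumes "inverse_equivalences F G"
  shows "full F"
proof -
  define C D where "C = Src F" and "D = Tgt F"
  have F: "is_functor F C D" and G: "is_functor G D C"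
    and n: "naturally_isomorphic (G \<odot> F) (idf C)" and n': "naturally_isomorphic (F \<odot> G) (idf D)"
    using assms by (auto simp: inverse_equivalences_def C_def D_def)
  note cC = functor_cat(1)[OF F] and cD = functor_cat(2)[OF F]
  note GF = fcomp_functor[OF F G]
  obtain \<alpha> \<beta> where a: "is_nt \<alpha> (G \<odot> F) (idf C)" and b: "is_nt \<beta> (idf C) (G \<odot> F)"
    and ab: "\<And>x. x \<in> Obj C \<Longrightarrow> At \<alpha> x \<cdot>\<^bsub>C\<^esub> At \<beta> x = Ide C x"
    and ba: "\<And>x. x \<in> Obj C \<Longrightarrow> At \<beta> x \<cdot>\<^bsub>C\<^esub> At \<alpha> x = Ide C (Fo (G \<odot> F) x)"
    by (rule naturally_isomorphic_components[OF n GF]) blast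
  note [simp] = functor_simps[OF F] functor_simps[OF G] nt_simps[OF a GF]
    nt_simps[OF b idf_functor[OF cC]] cat_simps[OF cC] cat_simps[OF cD]
  have "\<exists>f\<in>Hom C x y. Fa F f = h" if h: "x \<in> Obj C" "y \<in> Obj C" "h \<in> Hom D (Fo F x) (Fo F y)" for x y h
  proof
    have hh [simp]: "h \<in> Arr D" "Dom D h = Fo F x" "Cod D h = Fo F y" using h by (auto simp: Hom_iff)
    define f where "f = At \<alpha> y \<cdot>\<^bsub>C\<^esub> (Fa G h \<cdot>\<^bsub>C\<^esub> At \<beta> x)"
    have f: "f \<in> Arr C" "Dom C f = x" "Cod C f = y" using h(1,2) by (auto simp: f_def)
    then show "f \<in> Hom C x y" by (simp add: Hom_iff)
    have "Fa G (Fa F f) = (At \<beta> y \<cdot>\<^bsub>C\<^esub> At \<alpha> y) \<cdot>\<^bsub>C\<^esub> Fa G (Fa F f)"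
      using f h(1,2) ba[of y] by simp
    also have "\<dots> = At \<beta> y \<cdot>\<^bsub>C\<^esub> (f \<cdot>\<^bsub>C\<^esub> At \<alpha> x)"
      using f h(1,2) nt_natural[OF a GF f] by (simp add: cat_assoc[OF cC])
    also have "\<dots> = (At \<beta> y \<cdot>\<^bsub>C\<^esub> At \<alpha> y) \<cdot>\<^bsub>C\<^esub> (Fa G h \<cdot>\<^bsub>C\<^esub> (At \<beta> x \<cdot>\<^bsub>C\<^esub> At \<alpha> x))"
      unfolding f_def using h(1,2) by (simp add: cat_assoc[OF cC])
    also have "\<dots> = Fa G h" using h(1,2) by (simp add: ab ba)
    finally show "Fa F f = h"
      using f by (intro left_inverse_faithful[OF G F n']) simp_all
  qed
  then show ?thesis unfolding full_def C_def D_def by blast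
qed

lemma inverse_equivalences_surjective:
  assumes "inverse_equivalences F G" "is_functor F C D" "y \<in> Obj D"
  obtains x f g where "x \<in> Obj C" "inverse_arrows D f g" "Dom D f = y" "Cod D f = Fo F x"
proof -
  have G: "is_functor G D C" and n: "naturally_isomorphic (F \<odot> G) (idf D)"
    using assms functor_simps(1,2)[OF assms(2)] by (auto simp: inverse_equivalences_def)
  note FG = fcomp_functor[OF G assms(2)]
  obtain \<alpha> \<beta> where a: "is_nt \<alpha> (F \<odot> G) (idf D)" and b: "is_nt \<beta> (idf D) (F \<odot> G)"
    and ab: "At \<alpha> y \<cdot>\<^bsub>D\<^esub> At \<beta> y = Ide D y" "At \<beta> y \<cdot>\<^bsub>D\<^esub> At \<alpha> y = Ide D (Fo (F \<odot> G) y)"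
    using assms(3) by (auto intro: naturally_isomorphic_components[OF n FG])
  note [simp] = functor_simps[OF G] nt_simps[OF a FG] nt_simps[OF b idf_functor[OF functor_cat(2)[OF FG]]]
  show ?thesis
    by (rule that[of "Fo G y" "At \<beta> y" "At \<alpha> y"]) (use assms(3) ab in \<open>auto simp: inverse_arrows_def\<close>)
qed

text \<open>Injectivity on objects makes the images of arrows between different pairs of objects differ in
  their domains or codomains, so the bijections on hom-sets add up to a bijection on arrows.\<close>

lemma bijective_functor_inverse:
  assumes F: "is_functor F C D" and "full F" and "faithful F" and "bij_betw (Fo F) (Obj C) (Obj D)"
  obtains G where "is_functor G D C" "G \<odot> F = idf C" "F \<odot> G = idf D"
proof -
  note cC = functor_cat(1)[OF F] and cD = functor_cat(2)[OF F]
  note [simp] = functor_simps[OF F] cat_simps[OF cC] cat_simps[OF cD]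
  have inj: "inj_on (Fo F) (Obj C)" and sur: "Fo F ` Obj C = Obj D"
    using assms(4) by (auto simp: bij_betw_def)
  have ainj: "inj_on (Fa F) (Arr C)"
  proof (rule inj_onI)
    fix f f' assume f: "f \<in> Arr C" "f' \<in> Arr C" "Fa F f = Fa F f'"
    have "Fo F (Dom C f) = Fo F (Dom C f')" "Fo F (Cod C f) = Fo F (Cod C f')"
      using f functor_simps(5,6)[OF F] by metis+
    then have d: "Dom C f = Dom C f'" "Cod C f = Cod C f'"
      using f inj by (auto dest: inj_onD)
    have "inj_on (Fa F) (Hom C (Dom C f) (Cod C f))"
      using assms(3) f(1) unfolding faithful_def by simp
    then show "f = f'" using f d by (auto simp: Hom_iff dest: inj_onD)
  qed
  have asur: "Fa F ` Arr C = Arr D"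
  proof (intro equalityI subsetI)
    fix g assume g: "g \<in> Arr D"
    obtain x y where xy: "x \<in> Obj C" "y \<in> Obj C" "Dom D g = Fo F x" "Cod D g = Fo F y"
      using sur cat_simps(1,2)[OF cD g] by (metis imageE)
    then have "g \<in> Hom D (Fo F x) (Fo F y)" using g by (simp add: Hom_iff)
    then obtain f where "f \<in> Hom C x y" "Fa F f = g"
      using assms(2) xy unfolding full_def by fastforce
    then show "g \<in> Fa F ` Arr C" by (auto simp: Hom_iff)
  qed auto
  define q where "q = inv_into (Obj C) (Fo F)"
  define r where "r = inv_into (Arr C) (Fa F)"
  have q [simp]: "y \<in> Obj D \<Longrightarrow> q y \<in> Obj C" "y \<in> Obj D \<Longrightarrow> Fo F (q y) = y"
    "x \<in> Obj C \<Longrightarrow> q (Fo F x) = x" for x y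
    using sur inj by (auto simp: q_def inv_into_into f_inv_into_f)
  have r [simp]: "g \<in> Arr D \<Longrightarrow> r g \<in> Arr C" "g \<in> Arr D \<Longrightarrow> Fa F (r g) = g"
    "f \<in> Arr C \<Longrightarrow> r (Fa F f) = f" for f g
    using asur ainj by (auto simp: r_def inv_into_into f_inv_into_f)
  have rd: "Dom C (r g) = q (Dom D g)" "Cod C (r g) = q (Cod D g)" if g: "g \<in> Arr D" for g
    using functor_simps(5,6)[OF F r(1)[OF g]] g by (metis q(3) r(1,2) cat_simps(1,2)[OF cC])+
  have reqI: "r g = f" if "g \<in> Arr D" "f \<in> Arr C" "Fa F f = g" for f g
    using that by auto
  define G where "G = mk_func D C q r"
  have "is_functor G D C"
    unfolding G_def by (rule mk_func_functor[OF cD cC]) (auto simp: rd intro!: reqI)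
  moreover have "G \<odot> F = idf C"
    by (rule func_eqI[OF fcomp_functor[OF F calculation] idf_functor[OF cC]]) (auto simp: G_def)
  moreover have "F \<odot> G = idf D"
    by (rule func_eqI[OF fcomp_functor[OF calculation(1) F] idf_functor[OF cD]]) (auto simp: G_def)
  ultimately show ?thesis using that by blast
qed

text \<open>
  An adjunction between \<open>F\<close> and \<open>G\<close> whose unit is the identity.  Then \<open>F\<close> is fully faithful, as
  for every adjunction with invertible unit.  If \<open>F\<close> and \<open>G\<close> are inverse equivalences by
  isomorphisms that need not be related to the counit \<open>\<epsilon>\<close>, then \<open>\<epsilon>\<close> is invertible nevertheless:
  \<open>G\<close> is fully faithful, hence reflects the invertibility of \<open>G\<epsilon> = id\<close>.
\<close>

locale identity_unit_adjunction =
  fixes C :: "('o, 'a) cat" and D :: "('p, 'b) cat" and F G \<epsilon>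
  assumes F: "is_functor F C D" and G: "is_functor G D C" and GF: "G \<odot> F = idf C"
    and eps: "is_nt \<epsilon> (F \<odot> G) (idf D)"
    and G_eps: "d \<in> Obj D \<Longrightarrow> Fa G (At \<epsilon> d) = Ide C (Fo G d)"
    and eps_F: "c \<in> Obj C \<Longrightarrow> At \<epsilon> (Fo F c) = Ide D (Fo F c)"
begin

lemmas cC = functor_cat(1)[OF F] and cD = functor_cat(2)[OF F] and FG = fcomp_functor[OF G F]

lemmas [simp] = functor_simps[OF F] functor_simps[OF G] nt_simps[OF eps FG] cat_simps[OF cC] cat_simps[OF cD]

lemma GF_simps [simp]:
  "c \<in> Obj C \<Longrightarrow> Fo G (Fo F c) = c" "f \<in> Arr C \<Longrightarrow> Fa G (Fa F f) = f"
  using GF fcomp_simps(3)[of c F G] fcomp_simps(4)[of f F G] by simp_all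

lemma adjoint: "adjoint_pair F G"
proof -
  have I: "is_nt (idn (idf C)) (idf C) (G \<odot> F)"
    using GF idn_nt[OF idf_functor[OF cC]] by simp
  have "(\<epsilon> \<lhd> F) \<bullet> (F \<rhd> idn (idf C)) = idn F"
    by (rule nt_eqI[of _ F F])
      (auto simp: eps_F fcomp_idf[OF F] intro: idn_nt[OF F]
        intro!: vcomp_nt[of _ F "F \<odot> G \<odot> F"] whisker_left_nt[OF I idf_functor[OF cC] F, simplified fcomp_idf[OF F]]
          whisker_right_nt[OF eps FG F, simplified fcomp_idf[OF F] fcomp_assoc[OF F G F]])
  moreover have "(G \<rhd> \<epsilon>) \<bullet> (idn (idf C) \<lhd> G) = idn G"
    by (rule nt_eqI[of _ G G])
      (auto simp: G_eps fcomp_idf[OF G] intro: idn_nt[OF G]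
        intro!: vcomp_nt[of _ G "G \<odot> F \<odot> G"] whisker_left_nt[OF eps FG G, simplified fcomp_idf[OF G]]
          whisker_right_nt[OF I idf_functor[OF cC] G, simplified fcomp_idf[OF G] fcomp_assoc[OF G F G]])
  ultimately show ?thesis
    unfolding adjoint_pair_def is_adjunction_def using F G eps I by auto
qed

lemma full: "full F"
  unfolding full_def
proof (intro ballI, simp)
  fix x y g assume x: "x \<in> Obj C" and y: "y \<in> Obj C" and "g \<in> Hom D (Fo F x) (Fo F y)"
  then have g: "g \<in> Arr D" "Dom D g = Fo F x" "Cod D g = Fo F y" by (auto simp: Hom_iff)
  have "Fa F (Fa G g) = g"
    using nt_natural[OF eps FG g] x y g by (simp add: eps_F)
  then show "\<exists>f\<in>Hom C x y. Fa F f = g" using x y g by (intro bexI[of _ "Fa G g"]) (simp_all add: Hom_iff)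
qed

lemma faithful: "faithful F"
  unfolding faithful_def by (auto simp: Hom_iff intro!: inj_onI) (metis GF_simps(2))

lemma inverse_equivalences_iff:
  "inverse_equivalences F G \<longleftrightarrow> (\<forall>d\<in>Obj D. \<exists>h. inverse_arrows D (At \<epsilon> d) h)"
proof
  assume "\<forall>d\<in>Obj D. \<exists>h. inverse_arrows D (At \<epsilon> d) h"
  then have "naturally_isomorphic (F \<odot> G) (idf D)"
    by (intro naturally_isomorphicI[OF eps FG]) auto
  then show "inverse_equivalences F G"
    using F G GF naturally_isomorphic_refl[OF idf_functor[OF cC]] by (simp add: inverse_equivalences_def)
next
  assume e: "inverse_equivalences F G"
  note s = inverse_equivalences_sym[OF e]
  have nFG: "naturally_isomorphic (F \<odot> G) (idf D)" using e by (simp add: inverse_equivalences_def)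
  show "\<forall>d\<in>Obj D. \<exists>h. inverse_arrows D (At \<epsilon> d) h"
  proof
    fix d assume d: "d \<in> Obj D"
    have "Ide C (Fo G d) \<in> Hom C (Fo G d) (Fo G (Fo F (Fo G d)))" using d by (simp add: Hom_iff)
    then obtain h where "h \<in> Hom D d (Fo F (Fo G d))" and Gh: "Fa G h = Ide C (Fo G d)"
      using inverse_equivalences_full[OF s] d unfolding full_def by fastforce
    then have h: "h \<in> Arr D" "Dom D h = d" "Cod D h = Fo F (Fo G d)" by (auto simp: Hom_iff)
    have "At \<epsilon> d \<cdot>\<^bsub>D\<^esub> h = Ide D d"
      using d h Gh by (intro left_inverse_faithful[OF G F nFG]) (simp_all add: G_eps)
    moreover have "h \<cdot>\<^bsub>D\<^esub> At \<epsilon> d = Ide D (Fo F (Fo G d))"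
      using d h Gh by (intro left_inverse_faithful[OF G F nFG]) (simp_all add: G_eps)
    ultimately show "\<exists>h. inverse_arrows D (At \<epsilon> d) h"
      using d h by (intro exI[of _ h]) (simp add: inverse_arrows_def)
  qed
qed

end

section \<open>Categories given by objects, hom-sets, identities and composition\<close>

lemma hom_cat_simps [simp]:
  "Obj (hom_cat Ob H i m) = Ob"
  "(a, f, b) \<in> Arr (hom_cat Ob H i m) \<longleftrightarrow> a \<in> Ob \<and> b \<in> Ob \<and> f \<in> H a b"
  "a \<in> Ob \<Longrightarrow> b \<in> Ob \<Longrightarrow> f \<in> H a b \<Longrightarrow> Dom (hom_cat Ob H i m) (a, f, b) = a"
  "a \<in> Ob \<Longrightarrow> b \<in> Ob \<Longrightarrow> f \<in> H a b \<Longrightarrow> Cod (hom_cat Ob H i m) (a, f, b) = b"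
  "a \<in> Ob \<Longrightarrow> Ide (hom_cat Ob H i m) a = (a, i a, a)"
  "a \<in> Ob \<Longrightarrow> b \<in> Ob \<Longrightarrow> c \<in> Ob \<Longrightarrow> f \<in> H a b \<Longrightarrow> g \<in> H b c \<Longrightarrow>
     (b, g, c) \<cdot>\<^bsub>hom_cat Ob H i m\<^esub> (a, f, b) = (a, m g f, c)"
  by (simp_all add: hom_cat_def)

lemma hom_cat_arrE:
  assumes "f \<in> Arr (hom_cat Ob H i m)"
  obtains a h b where "f = (a, h, b)" "a \<in> Ob" "b \<in> Ob" "h \<in> H a b"
  using assms by (cases f) auto

lemma hom_cat_category:
  assumes "\<And>a. a \<in> Ob \<Longrightarrow> i a \<in> H a a"
    and "\<And>a b c f g. a \<in> Ob \<Longrightarrow> b \<in> Ob \<Longrightarrow> c \<in> Ob \<Longrightarrow> f \<in> H a b \<Longrightarrow> g \<in> H b c \<Longrightarrow> m g f \<in> H a c"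
    and "\<And>a b f. a \<in> Ob \<Longrightarrow> b \<in> Ob \<Longrightarrow> f \<in> H a b \<Longrightarrow> m f (i a) = f \<and> m (i b) f = f"
    and "\<And>a b c d f g h. a \<in> Ob \<Longrightarrow> b \<in> Ob \<Longrightarrow> c \<in> Ob \<Longrightarrow> d \<in> Ob \<Longrightarrow>
           f \<in> H a b \<Longrightarrow> g \<in> H b c \<Longrightarrow> h \<in> H c d \<Longrightarrow> m h (m g f) = m (m h g) f"
  shows "category (hom_cat Ob H i m)"
  unfolding hom_cat_def by (rule mk_cat_category) (use assms in auto)

lemma hom_cat_functor:
  assumes "category (hom_cat Ob H i m)" "category D"
    and "\<And>a. a \<in> Ob \<Longrightarrow> fo a \<in> Obj D"
    and "\<And>a b f. a \<in> Ob \<Longrightarrow> b \<in> Ob \<Longrightarrow> f \<in> H a b \<Longrightarrow> fa (a, f, b) \<in> Hom D (fo a) (fo b)"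
    and "\<And>a. a \<in> Ob \<Longrightarrow> fa (a, i a, a) = Ide D (fo a)"
    and "\<And>a b c f g. a \<in> Ob \<Longrightarrow> b \<in> Ob \<Longrightarrow> c \<in> Ob \<Longrightarrow> f \<in> H a b \<Longrightarrow> g \<in> H b c \<Longrightarrow>
           fa (a, m g f, c) = fa (b, g, c) \<cdot>\<^bsub>D\<^esub> fa (a, f, b)"
  shows "is_functor (mk_func (hom_cat Ob H i m) D fo fa) (hom_cat Ob H i m) D"
proof (rule mk_func_functor[OF assms(1,2)])
  show "fa f \<in> Arr D \<and> Dom D (fa f) = fo (Dom (hom_cat Ob H i m) f) \<and>
      Cod D (fa f) = fo (Cod (hom_cat Ob H i m) f)" if "f \<in> Arr (hom_cat Ob H i m)" for f
    using that assms(4) by (auto elim!: hom_cat_arrE simp: Hom_iff)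
  show "fa (g \<cdot>\<^bsub>hom_cat Ob H i m\<^esub> f) = fa g \<cdot>\<^bsub>D\<^esub> fa f"
    if "f \<in> Arr (hom_cat Ob H i m)" "g \<in> Arr (hom_cat Ob H i m)"
      "Dom (hom_cat Ob H i m) g = Cod (hom_cat Ob H i m) f" for f g
    using that assms(6) by (auto elim!: hom_cat_arrE)
qed (use assms in auto)

section \<open>Adjunctions in components\<close>

locale adjunction =
  fixes C :: "('o, 'a) cat" and D :: "('p, 'b) cat" and L R \<eta> \<epsilon>
  assumes adj: "is_adjunction C D L R \<eta> \<epsilon>"
begin

lemma L: "is_functor L C D" and R: "is_functor R D C"
  and eta: "is_nt \<eta> (idf C) (R \<odot> L)" and eps: "is_nt \<epsilon> (L \<odot> R) (idf D)"
  using adj by (simp_all add: is_adjunction_def)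

lemmas cC = functor_cat(1)[OF L] and cD = functor_cat(2)[OF L]
lemmas idC = idf_functor[OF cC] and LR = fcomp_functor[OF R L]

lemmas base_simps = functor_simps[OF L] functor_simps[OF R] cat_simps[OF cC] cat_simps[OF cD]

lemma eta_simps: "NSrc \<eta> = idf C" "NTgt \<eta> = R \<odot> L"
  "x \<in> Obj C \<Longrightarrow> At \<eta> x \<in> Arr C" "x \<in> Obj C \<Longrightarrow> Dom C (At \<eta> x) = x"
  "x \<in> Obj C \<Longrightarrow> Cod C (At \<eta> x) = Fo R (Fo L x)"
  using nt_simps[OF eta idC] functor_simps[OF L] by auto

lemma eps_simps: "NSrc \<epsilon> = L \<odot> R" "NTgt \<epsilon> = idf D"
  "z \<in> Obj D \<Longrightarrow> At \<epsilon> z \<in> Arr D" "z \<in> Obj D \<Longrightarrow> Dom D (At \<epsilon> z) = Fo L (Fo R z)"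
  "z \<in> Obj D \<Longrightarrow> Cod D (At \<epsilon> z) = z"
  using nt_simps[OF eps LR] functor_simps[OF R] by auto

lemmas adj_simps = base_simps eta_simps eps_simps

lemma eta_nat:
  "f \<in> Arr C \<Longrightarrow> Cod C f = y \<Longrightarrow> At \<eta> y \<cdot>\<^bsub>C\<^esub> f = Fa R (Fa L f) \<cdot>\<^bsub>C\<^esub> At \<eta> (Dom C f)"
  using nt_natural[OF eta idC, of f _ y] by (simp add: base_simps)

lemma eps_nat:
  "f \<in> Arr D \<Longrightarrow> Cod D f = y \<Longrightarrow> At \<epsilon> y \<cdot>\<^bsub>D\<^esub> Fa L (Fa R f) = f \<cdot>\<^bsub>D\<^esub> At \<epsilon> (Dom D f)"
  using nt_natural[OF eps LR, of f _ y] by (simp add: base_simps)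

lemma triangle_L: "x \<in> Obj C \<Longrightarrow> At \<epsilon> (Fo L x) \<cdot>\<^bsub>D\<^esub> Fa L (At \<eta> x) = Ide D (Fo L x)"
proof -
  assume x: "x \<in> Obj C"
  have "At ((\<epsilon> \<lhd> L) \<bullet> (L \<rhd> \<eta>)) x = At (idn L) x" using adj by (simp add: is_adjunction_def)
  then show ?thesis using x by (simp add: adj_simps)
qed

lemma triangle_R: "z \<in> Obj D \<Longrightarrow> Fa R (At \<epsilon> z) \<cdot>\<^bsub>C\<^esub> At \<eta> (Fo R z) = Ide C (Fo R z)"
proof -
  assume z: "z \<in> Obj D"
  have "At ((R \<rhd> \<epsilon>) \<bullet> (\<eta> \<lhd> R)) z = At (idn R) z" using adj by (simp add: is_adjunction_def)
  then show ?thesis using z by (simp add: adj_simps)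
qed

end

lemma is_adjunctionI:
  assumes L: "is_functor L C D" and R: "is_functor R D C"
    and eta: "is_nt \<eta> (idf C) (R \<odot> L)" and eps: "is_nt \<epsilon> (L \<odot> R) (idf D)"
    and "\<And>x. x \<in> Obj C \<Longrightarrow> At \<epsilon> (Fo L x) \<cdot>\<^bsub>D\<^esub> Fa L (At \<eta> x) = Ide D (Fo L x)"
    and "\<And>z. z \<in> Obj D \<Longrightarrow> Fa R (At \<epsilon> z) \<cdot>\<^bsub>C\<^esub> At \<eta> (Fo R z) = Ide C (Fo R z)"
  shows "is_adjunction C D L R \<eta> \<epsilon>"
proof -
  note [simp] = functor_simps[OF L] functor_simps[OF R] L R
    nt_simps(1,2)[OF eta idf_functor[OF functor_cat(1)[OF L]]] nt_simps(1,2)[OF eps fcomp_functor[OF R L]]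
  have "(\<epsilon> \<lhd> L) \<bullet> (L \<rhd> \<eta>) = idn L" "(R \<rhd> \<epsilon>) \<bullet> (\<eta> \<lhd> R) = idn R"
    by (rule vcomp_idnI; simp add: fcomp_idf' assms)+
  then show ?thesis using L R eta eps by (simp add: is_adjunction_def)
qed

text \<open>
  If \<open>\<alpha>\<close> and \<open>\<beta>\<close> are the counits of two adjunctions on the same category, this is the interchange law
  \<open>\<beta> \<circ> \<alpha>L\<^sub>2R\<^sub>2 = \<alpha> \<circ> L\<^sub>1R\<^sub>1\<beta>\<close>, placed between \<open>R\<close> and \<open>L\<close>.  All the associativity conditions of the
  Morita context of a double adjunction are instances of it.
\<close>

lemma counit_assoc:
  assumes R: "is_functor R Z W" and L: "is_functor L V Z"
    and L1: "is_functor L1 X1 Z" and R1: "is_functor R1 Z X1" and \<alpha>: "is_nt \<alpha> (L1 \<odot> R1) (idf Z)"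
    and L2: "is_functor L2 X2 Z" and R2: "is_functor R2 Z X2" and \<beta>: "is_nt \<beta> (L2 \<odot> R2) (idf Z)"
  shows "(R \<rhd> \<beta> \<lhd> L) \<bullet> ((R \<rhd> \<alpha> \<lhd> L2) \<lhd> (R2 \<odot> L)) = (R \<rhd> \<alpha> \<lhd> L) \<bullet> ((R \<odot> L1) \<rhd> (R1 \<rhd> \<beta> \<lhd> L))"
proof -
  note LR1 = fcomp_functor[OF R1 L1] and LR2 = fcomp_functor[OF R2 L2] and cZ = functor_cat(1)[OF R]
  note [simp] = functor_simps[OF R] functor_simps[OF L] functor_simps[OF L1] functor_simps[OF R1]
    functor_simps[OF L2] functor_simps[OF R2] nt_simps[OF \<alpha> LR1] nt_simps[OF \<beta> LR2]
    R L L1 R1 L2 R2 fcomp_functor' fcomp_assoc' fcomp_idf' cat_simps[OF cZ]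
  show ?thesis
  proof (rule vcomp_eqI; simp)
    fix x assume x: "x \<in> Obj V"
    have "At \<beta> (Fo L x) \<cdot>\<^bsub>Z\<^esub> At \<alpha> (Fo L2 (Fo R2 (Fo L x)))
        = At \<alpha> (Fo L x) \<cdot>\<^bsub>Z\<^esub> Fa L1 (Fa R1 (At \<beta> (Fo L x)))"
      using nt_natural[OF \<alpha> LR1 _ refl refl, of "At \<beta> (Fo L x)"] x by simp
    from arg_cong[OF this, of "Fa R"]
    show "Fa R (At \<beta> (Fo L x)) \<cdot>\<^bsub>W\<^esub> Fa R (At \<alpha> (Fo L2 (Fo R2 (Fo L x))))
        = Fa R (At \<alpha> (Fo L x)) \<cdot>\<^bsub>W\<^esub> Fa R (Fa L1 (Fa R1 (At \<beta> (Fo L x))))"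
      using x by simp
  qed
qed

lemma counit_nt:
  assumes R: "is_functor R Z W" and L: "is_functor L V Z"
    and L1: "is_functor L1 X1 Z" and R1: "is_functor R1 Z X1" and \<alpha>: "is_nt \<alpha> (L1 \<odot> R1) (idf Z)"
  shows "is_nt (R \<rhd> \<alpha> \<lhd> L) ((R \<odot> L1) \<odot> (R1 \<odot> L)) (R \<odot> L)"
proof -
  note LR1 = fcomp_functor[OF R1 L1]
  note [simp] = functor_simps(1,2)[OF R] functor_simps(1,2)[OF L] functor_simps(1,2)[OF L1] functor_simps(1,2)[OF R1]
    R L L1 R1 fcomp_functor' fcomp_assoc' fcomp_idf'
  show ?thesis
    by (rule nt_cong[OF whisker_left_nt[OF whisker_right_nt[OF \<alpha> LR1 L] fcomp_functor[OF L LR1] R]]) simp_all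
qed

lemma (in adjunction) counit_unit:
  assumes K: "is_functor K V D" 
  shows "(R \<rhd> \<epsilon> \<lhd> K) \<bullet> (\<eta> \<lhd> (R \<odot> K)) = idn (R \<odot> K)"
proof -
  note [simp] = adj_simps functor_simps[OF K] K L R fcomp_functor' fcomp_assoc' fcomp_idf'
  show ?thesis by (rule vcomp_idnI) (simp_all add: triangle_R)
qed

lemma (in adjunction) unit_counit:
  assumes S: "is_functor S D W"
  shows "(S \<rhd> \<epsilon> \<lhd> L) \<bullet> ((S \<odot> L) \<rhd> \<eta>) = idn (S \<odot> L)"
proof -
  note [simp] = adj_simps functor_simps[OF S] S L R fcomp_functor' fcomp_assoc' fcomp_idf'
  show ?thesis
    by (rule vcomp_idnI) (simp_all add: triangle_L functor_simps(8)[OF S, symmetric] del: functor_simps(8)[OF S])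
qed

text \<open>
  A functor \<open>F\<close> that commutes with the right adjoints and its mate, which is \<open>mate_a\<close> or \<open>mate_b\<close>
  according to the adjunction of the double adjunction in question.
\<close>

locale adjunction_morphism =
  A: adjunction C D L R \<eta> \<epsilon> + A': adjunction C D' L' R' \<eta>' \<epsilon>'
  for C :: "('o, 'a) cat" and D :: "('p, 'b) cat" and L R \<eta> \<epsilon>
    and D' :: "('q, 'c) cat" and L' R' \<eta>' \<epsilon>' +
  fixes F
  assumes F: "is_functor F D' D" and RF: "R \<odot> F = R'"
begin

definition mate where "mate = (\<epsilon> \<lhd> (F \<odot> L')) \<bullet> (L \<rhd> \<eta>')"

lemma RF_simps: "z \<in> Obj D' \<Longrightarrow> Fo R (Fo F z) = Fo R' z" "f \<in> Arr D' \<Longrightarrow> Fa R (Fa F f) = Fa R' f"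
  using fcomp_simps(3)[of z F R] fcomp_simps(4)[of f F R] functor_simps(1)[OF F] by (simp_all add: RF)

lemmas all_simps = A.adj_simps A'.adj_simps functor_simps[OF F] RF_simps

lemma mate_nt: "is_nt mate L (F \<odot> L')"
proof -
  note [simp] = all_simps A.L A.R A'.L A'.R F fcomp_functor' fcomp_assoc' fcomp_idf'
  have "L \<odot> R \<odot> F \<odot> L' = L \<odot> R' \<odot> L'"
    using fcomp_assoc[OF A'.L F A.R] by (simp add: RF)
  then show ?thesis unfolding mate_def
    by (intro vcomp_nt[OF nt_cong[OF whisker_left_nt[OF A'.eta A.idC A.L]]
          nt_cong[OF whisker_right_nt[OF A.eps A.LR fcomp_functor[OF A'.L F]]]])
      auto
qed

lemma mate_at: "x \<in> Obj C \<Longrightarrow> At mate x = At \<epsilon> (Fo F (Fo L' x)) \<cdot>\<^bsub>D\<^esub> Fa L (At \<eta>' x)"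
  by (simp add: mate_def all_simps)

lemma mate_simps: "NSrc mate = L" "NTgt mate = F \<odot> L'" "x \<in> Obj C \<Longrightarrow> At mate x \<in> Arr D"
  "x \<in> Obj C \<Longrightarrow> Dom D (At mate x) = Fo L x" "x \<in> Obj C \<Longrightarrow> Cod D (At mate x) = Fo F (Fo L' x)"
  using nt_simps[OF mate_nt A.L] functor_simps[OF A'.L] by auto

lemma mate_unit: "(R \<rhd> mate) \<bullet> \<eta> = \<eta>'"
proof -
  note [simp] = all_simps mate_simps
  have FL: "is_functor (F \<odot> L') C D" by (rule fcomp_functor[OF A'.L F])
  have "R \<odot> (F \<odot> L') = R' \<odot> L'" using fcomp_assoc[OF A'.L F A.R] by (simp add: RF)
  then have 1: "is_nt ((R \<rhd> mate) \<bullet> \<eta>) (idf C) (R' \<odot> L')"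
    using vcomp_nt[OF A.eta whisker_left_nt[OF mate_nt A.L A.R]] by simp
  show ?thesis
  proof (rule nt_eqI[OF 1 A'.eta], simp)
    fix x assume x: "x \<in> Obj C"
    have "Fa R (At \<epsilon> (Fo F (Fo L' x))) \<cdot>\<^bsub>C\<^esub> (Fa R (Fa L (At \<eta>' x)) \<cdot>\<^bsub>C\<^esub> At \<eta> x)
        = Fa R (At \<epsilon> (Fo F (Fo L' x))) \<cdot>\<^bsub>C\<^esub> (At \<eta> (Fo R' (Fo L' x)) \<cdot>\<^bsub>C\<^esub> At \<eta>' x)"
      using x A.eta_nat[of "At \<eta>' x"] by simp
    also have "\<dots> = At \<eta>' x"
      using x comp_tail[OF A.cC A.triangle_R[of "Fo F (Fo L' x)"], of "At \<eta>' x"] by simp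
    finally show "Fa R (At mate x) \<cdot>\<^bsub>C\<^esub> At \<eta> x = At \<eta>' x"
      using x by (simp add: mate_at cat_assoc[OF A.cC])
  qed
qed

text \<open>
  The mate carries the counit of the second adjunction to that of the first.  Both the
  multiplicativity of the mates and the naturality of the comparison functors come from here.
\<close>

lemma mate_counit:
  assumes z: "z \<in> Obj D'"
  shows "Fa F (At \<epsilon>' z) \<cdot>\<^bsub>D\<^esub> At mate (Fo R' z) = At \<epsilon> (Fo F z)"
proof -
  note [simp] = all_simps mate_simps z
  have "Fa F (At \<epsilon>' z) \<cdot>\<^bsub>D\<^esub> At mate (Fo R' z)
      = (At \<epsilon> (Fo F z) \<cdot>\<^bsub>D\<^esub> Fa L (Fa R (Fa F (At \<epsilon>' z)))) \<cdot>\<^bsub>D\<^esub> Fa L (At \<eta>' (Fo R' z))"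
    by (subst A.eps_nat) (simp_all add: mate_at cat_assoc[OF A.cD])
  also have "\<dots> = At \<epsilon> (Fo F z) \<cdot>\<^bsub>D\<^esub> Fa L (Fa R' (At \<epsilon>' z) \<cdot>\<^bsub>C\<^esub> At \<eta>' (Fo R' z))"
    by (simp add: cat_assoc[OF A.cD])
  also have "\<dots> = At \<epsilon> (Fo F z)" by (simp only: A'.triangle_R[OF z]) simp
  finally show ?thesis .
qed

text \<open>With either adjunction of a double adjunction in place of \<open>L, R\<close>, and with \<open>S\<close> and \<open>a\<close> ranging over
  its right adjoints and mates, these are the eight conditions on multiplications in \<open>is_morita_mor_iff\<close>.\<close>

lemma mate_mult:
  assumes S: "is_functor S D W" and S': "S \<odot> F = S'"
    and K: "is_functor K V D" and K': "is_functor K' V D'" and a: "is_nt a K (F \<odot> K')"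
  shows "(S \<rhd> a) \<bullet> (S \<rhd> \<epsilon> \<lhd> K) = (S' \<rhd> \<epsilon>' \<lhd> K') \<bullet> ((S \<rhd> mate) \<star> (R \<rhd> a))"
proof -
  have SF: "is_functor S' D' W" using fcomp_functor[OF F S] S' by simp
  have S'_simps: "z \<in> Obj D' \<Longrightarrow> Fo S' z = Fo S (Fo F z)" "f \<in> Arr D' \<Longrightarrow> Fa S' f = Fa S (Fa F f)" for z f
    using fcomp_simps(3)[of z F S] fcomp_simps(4)[of f F S] functor_simps(1)[OF F] by (simp_all add: S')
  have a_simps: "NSrc a = K" "NTgt a = F \<odot> K'" "x \<in> Obj V \<Longrightarrow> At a x \<in> Arr D"
    "x \<in> Obj V \<Longrightarrow> Dom D (At a x) = Fo K x" "x \<in> Obj V \<Longrightarrow> Cod D (At a x) = Fo F (Fo K' x)" for x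
    using nt_simps[OF a K] functor_simps[OF K'] by auto
  note [simp] = all_simps mate_simps S'_simps a_simps functor_simps[OF S] functor_simps(1-3)[OF SF]
    functor_simps[OF K] functor_simps[OF K']
    A.L A.R A'.L A'.R F S SF K K' fcomp_functor' fcomp_assoc' fcomp_idf'
  show ?thesis
  proof (rule vcomp_eqI)
    show "NSrc (S \<rhd> \<epsilon> \<lhd> K) = NSrc ((S \<rhd> mate) \<star> (R \<rhd> a))" by simp
    show "NTgt (S \<rhd> a) = NTgt (S' \<rhd> \<epsilon>' \<lhd> K')" using fcomp_assoc[OF K' F S] by (simp add: S')
    fix x assume "x \<in> Obj (Src (NSrc (S \<rhd> \<epsilon> \<lhd> K)))"
    then have x: "x \<in> Obj V" by simp
    have e: "At a x \<cdot>\<^bsub>D\<^esub> At \<epsilon> (Fo K x)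
       = Fa F (At \<epsilon>' (Fo K' x)) \<cdot>\<^bsub>D\<^esub> (At mate (Fo R' (Fo K' x)) \<cdot>\<^bsub>D\<^esub> Fa L (Fa R (At a x)))"
      using x comp_tail[OF A.cD mate_counit[of "Fo K' x"], of "Fa L (Fa R (At a x))"]
        A.eps_nat[of "At a x"] by simp
    have "NTgt (R \<rhd> a) = R \<odot> F \<odot> K'" by simp
    then have g: "At ((S \<rhd> mate) \<star> (R \<rhd> a)) x = Fa S (At mate (Fo R' (Fo K' x))) \<cdot>\<^bsub>W\<^esub> Fa S (Fa L (Fa R (At a x)))"
      using x by (simp add: godement_def)
    show "At (S \<rhd> a) x \<cdot>\<^bsub>Tgt (NSrc (S \<rhd> \<epsilon> \<lhd> K))\<^esub> At (S \<rhd> \<epsilon> \<lhd> K) x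
       = At (S' \<rhd> \<epsilon>' \<lhd> K') x \<cdot>\<^bsub>Tgt (NSrc (S \<rhd> \<epsilon> \<lhd> K))\<^esub> At ((S \<rhd> mate) \<star> (R \<rhd> a)) x"
      using x arg_cong[OF e, of "Fa S"] by (simp add: g)
  qed
qed

end

lemma (in adjunction) mate_idf: "(\<epsilon> \<lhd> (idf D \<odot> L)) \<bullet> (L \<rhd> \<eta>) = idn L"
  using adj fcomp_idf[OF L] by (simp add: is_adjunction_def)

lemma mate_comp:
  assumes "adjunction_morphism C D L R \<eta> \<epsilon> D' L' R' \<eta>' \<epsilon>' F"
    and "adjunction_morphism C D' L' R' \<eta>' \<epsilon>' D'' L'' R'' \<eta>'' \<epsilon>'' F'"
  shows "(\<epsilon> \<lhd> ((F \<odot> F') \<odot> L'')) \<bullet> (L \<rhd> \<eta>'') =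
    (F \<rhd> ((\<epsilon>' \<lhd> (F' \<odot> L'')) \<bullet> (L' \<rhd> \<eta>''))) \<bullet> ((\<epsilon> \<lhd> (F \<odot> L')) \<bullet> (L \<rhd> \<eta>'))"
proof -
  interpret M: adjunction_morphism C D L R \<eta> \<epsilon> D' L' R' \<eta>' \<epsilon>' F by (rule assms(1))
  interpret N: adjunction_morphism C D' L' R' \<eta>' \<epsilon>' D'' L'' R'' \<eta>'' \<epsilon>'' F' by (rule assms(2))
  note [simp] = M.all_simps N.all_simps M.mate_simps N.mate_simps M.F N.F N.A'.L fcomp_functor' fcomp_assoc' fcomp_idf'
  show ?thesis
    unfolding M.mate_def[symmetric] N.mate_def[symmetric]
  proof (rule vcomp_eqI)
    fix x assume "x \<in> Obj (Src (NSrc (L \<rhd> \<eta>'')))"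
    then have x: "x \<in> Obj C" by simp
    note c1 = comp_tail[OF M.A.cD M.mate_counit[of "Fo F' (Fo L'' x)"], of "Fa L (At \<eta>'' x)"]
    have "At M.mate (Fo R' (Fo F' (Fo L'' x))) \<cdot>\<^bsub>D\<^esub> Fa L (At \<eta>'' x) = Fa F (Fa L' (At \<eta>'' x)) \<cdot>\<^bsub>D\<^esub> At M.mate x"
      using x nt_natural[OF M.mate_nt M.A.L _ refl refl, of "At \<eta>'' x"] by simp
    then show "At (\<epsilon> \<lhd> ((F \<odot> F') \<odot> L'')) x \<cdot>\<^bsub>Tgt (NSrc (L \<rhd> \<eta>''))\<^esub> At (L \<rhd> \<eta>'') x
      = At (F \<rhd> N.mate) x \<cdot>\<^bsub>Tgt (NSrc (L \<rhd> \<eta>''))\<^esub> At M.mate x"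
      using x c1 by (simp add: N.mate_at cat_assoc[OF M.A.cD])
  qed (use M.A.L in simp_all)
qed

section \<open>The categories of Morita contexts and of balanced herds\<close>

locale morita_context =
  fixes X :: "('xo, 'xa) cat" and Y :: "('yo, 'ya) cat" and M :: "('xo, 'xa, 'yo, 'ya) morita"
  assumes morita: "is_morita X Y M"
begin

lemma functors: "is_functor (FA M) X X" "is_functor (FB M) Y Y" "is_functor (FT M) Y X" "is_functor (FH M) X Y"
  using morita by (simp_all add: is_morita_def is_monad_def is_bialgebra_functor_def)

lemma nts:
  "is_nt (mA M) (FA M \<odot> FA M) (FA M)" "is_nt (uA M) (idf X) (FA M)"
  "is_nt (mB M) (FB M \<odot> FB M) (FB M)" "is_nt (uB M) (idf Y) (FB M)"
  "is_nt (lT M) (FA M \<odot> FT M) (FT M)" "is_nt (rT M) (FT M \<odot> FB M) (FT M)"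
  "is_nt (lH M) (FB M \<odot> FH M) (FH M)" "is_nt (rH M) (FH M \<odot> FA M) (FH M)"
  "is_nt (ev M) (FT M \<odot> FH M) (FA M)" "is_nt (evh M) (FH M \<odot> FT M) (FB M)"
  using morita by (simp_all add: is_morita_def is_monad_def is_bialgebra_functor_def)

lemmas FA = functors(1) and FB = functors(2) and FT = functors(3) and FH = functors(4)
lemmas cX = functor_cat(1)[OF FA] and cY = functor_cat(1)[OF FB]

end

text \<open>
  Every compatibility condition on a morphism of Morita contexts, except for the two on units, says
  that the morphism preserves a multiplication \<open>PQ \<rightarrow> S\<close>, where \<open>P\<close>, \<open>Q\<close> and \<open>S\<close> are among the
  four functors of the context.  In this form a single argument covers all of them.
\<close>

lemma is_morita_mor_iff:
  assumes M: "is_morita X Y M" and M': "is_morita X Y M'"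
  shows "is_morita_mor M M' \<phi> \<longleftrightarrow>
    is_nt (ph1 \<phi>) (FA M) (FA M') \<and> is_nt (ph2 \<phi>) (FB M) (FB M') \<and>
    is_nt (ph3 \<phi>) (FT M) (FT M') \<and> is_nt (ph4 \<phi>) (FH M) (FH M') \<and>
    ph1 \<phi> \<bullet> uA M = uA M' \<and> ph2 \<phi> \<bullet> uB M = uB M' \<and>
    ph1 \<phi> \<bullet> mA M = mA M' \<bullet> (ph1 \<phi> \<star> ph1 \<phi>) \<and> ph2 \<phi> \<bullet> mB M = mB M' \<bullet> (ph2 \<phi> \<star> ph2 \<phi>) \<and>
    ph3 \<phi> \<bullet> lT M = lT M' \<bullet> (ph1 \<phi> \<star> ph3 \<phi>) \<and> ph3 \<phi> \<bullet> rT M = rT M' \<bullet> (ph3 \<phi> \<star> ph2 \<phi>) \<and>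
    ph4 \<phi> \<bullet> lH M = lH M' \<bullet> (ph2 \<phi> \<star> ph4 \<phi>) \<and> ph4 \<phi> \<bullet> rH M = rH M' \<bullet> (ph4 \<phi> \<star> ph1 \<phi>) \<and>
    ph1 \<phi> \<bullet> ev M = ev M' \<bullet> (ph3 \<phi> \<star> ph4 \<phi>) \<and> ph2 \<phi> \<bullet> evh M = evh M' \<bullet> (ph4 \<phi> \<star> ph3 \<phi>)"
proof (cases "is_nt (ph1 \<phi>) (FA M) (FA M') \<and> is_nt (ph2 \<phi>) (FB M) (FB M') \<and>
    is_nt (ph3 \<phi>) (FT M) (FT M') \<and> is_nt (ph4 \<phi>) (FH M) (FH M')")
  case True
  then have p: "is_nt (ph1 \<phi>) (FA M) (FA M')" "is_nt (ph2 \<phi>) (FB M) (FB M')"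
    "is_nt (ph3 \<phi>) (FT M) (FT M')" "is_nt (ph4 \<phi>) (FH M) (FH M')" by auto
  interpret M: morita_context X Y M by (rule morita_context.intro[OF M])
  have s: "NSrc (ph1 \<phi>) = FA M" "NSrc (ph2 \<phi>) = FB M" "NTgt (ph3 \<phi>) = FT M'" "NTgt (ph4 \<phi>) = FH M'"
    using nt_simps(1)[OF p(1) M.FA] nt_simps(1)[OF p(2) M.FB] nt_simps(2)[OF p(3) M.FT] nt_simps(2)[OF p(4) M.FH]
    by auto
  have "(FT M' \<rhd> ph2 \<phi>) \<bullet> (ph3 \<phi> \<lhd> FB M) = ph3 \<phi> \<star> ph2 \<phi>"
    "(FH M' \<rhd> ph1 \<phi>) \<bullet> (ph4 \<phi> \<lhd> FA M) = ph4 \<phi> \<star> ph1 \<phi>"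
    by (rule godement_alt[OF p(2) M.FB p(3) M.FT] godement_alt[OF p(1) M.FA p(4) M.FH])+
  moreover have "(ph1 \<phi> \<lhd> FT M') \<bullet> (FA M \<rhd> ph3 \<phi>) = ph1 \<phi> \<star> ph3 \<phi>"
    "(ph2 \<phi> \<lhd> FH M') \<bullet> (FB M \<rhd> ph4 \<phi>) = ph2 \<phi> \<star> ph4 \<phi>"
    by (simp_all add: godement_def s)
  ultimately show ?thesis
    unfolding is_morita_mor_def is_monad_mor_def by (simp add: p) blast
next
  case False
  then show ?thesis unfolding is_morita_mor_def is_monad_mor_def by blast
qed

lemma preserves_mult_comp:
  assumes P: "is_functor P C D" and Q: "is_functor Q B C"
    and \<mu>: "is_nt \<mu> (P \<odot> Q) S" and \<mu>': "is_nt \<mu>' (P' \<odot> Q') S'" and \<mu>'': "is_nt \<mu>'' (P'' \<odot> Q'') S''"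
    and p: "is_nt p P P'" "is_nt p' P' P''" and q: "is_nt q Q Q'" "is_nt q' Q' Q''"
    and s: "is_nt s S S'" "is_nt s' S' S''"
    and e: "s \<bullet> \<mu> = \<mu>' \<bullet> (p \<star> q)" and e': "s' \<bullet> \<mu>' = \<mu>'' \<bullet> (p' \<star> q')"
  shows "(s' \<bullet> s) \<bullet> \<mu> = \<mu>'' \<bullet> ((p' \<bullet> p) \<star> (q' \<bullet> q))"
proof -
  note g = godement_nt[OF q(1) Q p(1) P]
    and g' = godement_nt[OF q(2) nt_functors[OF q(1) Q] p(2) nt_functors[OF p(1) P]]
  have "(s' \<bullet> s) \<bullet> \<mu> = s' \<bullet> (\<mu>' \<bullet> (p \<star> q))" using vcomp_assoc[OF \<mu> s] by (simp add: e)
  also have "\<dots> = \<mu>'' \<bullet> ((p' \<star> q') \<bullet> (p \<star> q))"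
    using vcomp_assoc[OF g \<mu>' s(2)] vcomp_assoc[OF g g' \<mu>''] by (simp add: e')
  finally show ?thesis by (simp add: interchange[OF q Q p P])
qed

lemma morita_mor_nts:
  assumes "is_morita_mor M M' \<phi>"
  shows "is_nt (ph1 \<phi>) (FA M) (FA M')" "is_nt (ph2 \<phi>) (FB M) (FB M')"
    "is_nt (ph3 \<phi>) (FT M) (FT M')" "is_nt (ph4 \<phi>) (FH M) (FH M')"
  using assms by (simp_all add: is_morita_mor_def is_monad_mor_def)

lemma morita_comp_sel:
  "ph1 (morita_comp \<psi> \<phi>) = ph1 \<psi> \<bullet> ph1 \<phi>" "ph2 (morita_comp \<psi> \<phi>) = ph2 \<psi> \<bullet> ph2 \<phi>"
  "ph3 (morita_comp \<psi> \<phi>) = ph3 \<psi> \<bullet> ph3 \<phi>" "ph4 (morita_comp \<psi> \<phi>) = ph4 \<psi> \<bullet> ph4 \<phi>"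
  by (simp_all add: morita_comp_def)

lemma morita_id_sel:
  "ph1 (morita_id M) = idn (FA M)" "ph2 (morita_id M) = idn (FB M)"
  "ph3 (morita_id M) = idn (FT M)" "ph4 (morita_id M) = idn (FH M)"
  by (simp_all add: morita_id_def)

lemma morita_mor_comp:
  assumes "is_morita X Y M" "is_morita X Y M'" "is_morita X Y M''"
    and \<phi>: "is_morita_mor M M' \<phi>" and \<psi>: "is_morita_mor M' M'' \<psi>"
  shows "is_morita_mor M M'' (morita_comp \<psi> \<phi>)"
proof -
  interpret M: morita_context X Y M by (rule morita_context.intro[OF assms(1)])
  interpret M': morita_context X Y M' by (rule morita_context.intro[OF assms(2)])
  interpret M'': morita_context X Y M'' by (rule morita_context.intro[OF assms(3)])
  note p = morita_mor_nts[OF \<phi>] and q = morita_mor_nts[OF \<psi>]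
  note e = \<phi>[unfolded is_morita_mor_iff[OF assms(1,2)]] and e' = \<psi>[unfolded is_morita_mor_iff[OF assms(2,3)]]
  have "(ph1 \<psi> \<bullet> ph1 \<phi>) \<bullet> uA M = uA M''" "(ph2 \<psi> \<bullet> ph2 \<phi>) \<bullet> uB M = uB M''"
    using vcomp_assoc[OF M.nts(2) p(1) q(1)] vcomp_assoc[OF M.nts(4) p(2) q(2)] e e' by simp_all
  then show ?thesis
    unfolding is_morita_mor_iff[OF assms(1,3)] morita_comp_sel using e e'
    by (intro conjI vcomp_nt[OF p(1) q(1)] vcomp_nt[OF p(2) q(2)] vcomp_nt[OF p(3) q(3)] vcomp_nt[OF p(4) q(4)]
      preserves_mult_comp[OF M.FA M.FA M.nts(1) M'.nts(1) M''.nts(1) p(1) q(1) p(1) q(1) p(1) q(1)]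
      preserves_mult_comp[OF M.FB M.FB M.nts(3) M'.nts(3) M''.nts(3) p(2) q(2) p(2) q(2) p(2) q(2)]
      preserves_mult_comp[OF M.FA M.FT M.nts(5) M'.nts(5) M''.nts(5) p(1) q(1) p(3) q(3) p(3) q(3)]
      preserves_mult_comp[OF M.FT M.FB M.nts(6) M'.nts(6) M''.nts(6) p(3) q(3) p(2) q(2) p(3) q(3)]
      preserves_mult_comp[OF M.FB M.FH M.nts(7) M'.nts(7) M''.nts(7) p(2) q(2) p(4) q(4) p(4) q(4)]
      preserves_mult_comp[OF M.FH M.FA M.nts(8) M'.nts(8) M''.nts(8) p(4) q(4) p(1) q(1) p(4) q(4)]
      preserves_mult_comp[OF M.FT M.FH M.nts(9) M'.nts(9) M''.nts(9) p(3) q(3) p(4) q(4) p(1) q(1)]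
      preserves_mult_comp[OF M.FH M.FT M.nts(10) M'.nts(10) M''.nts(10) p(4) q(4) p(3) q(3) p(2) q(2)])
      (elim conjE; assumption)+
qed

lemma morita_mor_id:
  assumes "is_morita X Y M"
  shows "is_morita_mor M M (morita_id M)"
proof -
  interpret M: morita_context X Y M by (rule morita_context.intro[OF assms])
  note i = idn_nt[OF M.FA] idn_nt[OF M.FB] idn_nt[OF M.FT] idn_nt[OF M.FH]
  show ?thesis
    unfolding is_morita_mor_iff[OF assms assms] morita_id_sel
    using i by (simp add: godement_idn[OF M.FA M.FA] godement_idn[OF M.FB M.FB] godement_idn[OF M.FT M.FA]
      godement_idn[OF M.FB M.FT] godement_idn[OF M.FH M.FB] godement_idn[OF M.FA M.FH]
      godement_idn[OF M.FH M.FT] godement_idn[OF M.FT M.FH]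
      M.nts[THEN vcomp_idn(1)] M.nts[THEN vcomp_idn(2)])
qed

lemma morita_comp_assoc:
  assumes "is_morita_mor M M' \<phi>" "is_morita_mor M' M'' \<psi>" "is_morita_mor M'' M''' \<chi>"
  shows "morita_comp \<chi> (morita_comp \<psi> \<phi>) = morita_comp (morita_comp \<chi> \<psi>) \<phi>"
  using morita_mor_nts[OF assms(1)] morita_mor_nts[OF assms(2)] morita_mor_nts[OF assms(3)]
  by (simp add: morita_comp_def vcomp_assoc)

lemma morita_comp_id:
  assumes "is_morita_mor M M' \<phi>"
  shows "morita_comp \<phi> (morita_id M) = \<phi>" "morita_comp (morita_id M') \<phi> = \<phi>"
  using morita_mor_nts[OF assms, THEN vcomp_idn(1)] morita_mor_nts[OF assms, THEN vcomp_idn(2)]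
  by (simp_all add: morita_comp_def morita_id_def)

lemma Mor_category: "category (Mor X Y)"
  unfolding Mor_def
  by (rule hom_cat_category) (auto intro: morita_mor_comp morita_mor_id morita_comp_assoc morita_comp_id)

definition preserves_shepherd where
  "preserves_shepherd \<phi> \<gamma> \<gamma>' \<longleftrightarrow> (ph3 \<phi> \<star> ph4 \<phi> \<star> ph3 \<phi>) \<bullet> \<gamma> = \<gamma>' \<bullet> ph3 \<phi>"

lemma preserves_shepherd_comp:
  assumes M: "is_morita X Y M" and \<phi>: "is_morita_mor M M' \<phi>" and \<psi>: "is_morita_mor M' M'' \<psi>"
    and \<gamma>: "is_shepherd M \<gamma>" "is_shepherd M' \<gamma>'" "is_shepherd M'' \<gamma>''"
    and e: "preserves_shepherd \<phi> \<gamma> \<gamma>'" "preserves_shepherd \<psi> \<gamma>' \<gamma>''"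
  shows "preserves_shepherd (morita_comp \<psi> \<phi>) \<gamma> \<gamma>''"
proof -
  interpret M: morita_context X Y M by (rule morita_context.intro[OF M])
  note p = morita_mor_nts[OF \<phi>] and q = morita_mor_nts[OF \<psi>]
  note FT' = nt_functors[OF p(3) M.FT] and FH' = nt_functors[OF p(4) M.FH]
  note HT = fcomp_functor[OF M.FT M.FH] and HT' = fcomp_functor[OF FT' FH']
  note g1 = godement_nt[OF p(3) M.FT p(4) M.FH] and g2 = godement_nt[OF q(3) FT' q(4) FH']
  note h1 = godement_nt[OF g1 HT p(3) M.FT] and h2 = godement_nt[OF g2 HT' q(3) FT']
  have n: "is_nt \<gamma> (FT M) (FT M \<odot> FH M \<odot> FT M)" "is_nt \<gamma>' (FT M') (FT M' \<odot> FH M' \<odot> FT M')"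
    "is_nt \<gamma>'' (FT M'') (FT M'' \<odot> FH M'' \<odot> FT M'')"
    using \<gamma> by (simp_all add: is_shepherd_def)
  have "((ph3 \<psi> \<bullet> ph3 \<phi>) \<star> (ph4 \<psi> \<bullet> ph4 \<phi>) \<star> (ph3 \<psi> \<bullet> ph3 \<phi>)) \<bullet> \<gamma>
      = ((ph3 \<psi> \<star> ph4 \<psi> \<star> ph3 \<psi>) \<bullet> (ph3 \<phi> \<star> ph4 \<phi> \<star> ph3 \<phi>)) \<bullet> \<gamma>"
    by (simp add: interchange[OF p(3) q(3) M.FT p(4) q(4) M.FH] interchange[OF g1 g2 HT p(3) q(3) M.FT])
  also have "\<dots> = (ph3 \<psi> \<star> ph4 \<psi> \<star> ph3 \<psi>) \<bullet> \<gamma>' \<bullet> ph3 \<phi>"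
    using vcomp_assoc[OF n(1) h1 h2] e by (simp add: preserves_shepherd_def)
  also have "\<dots> = \<gamma>'' \<bullet> ph3 \<psi> \<bullet> ph3 \<phi>"
    using vcomp_assoc[OF p(3) n(2) h2] vcomp_assoc[OF p(3) q(3) n(3)] e by (simp add: preserves_shepherd_def)
  finally show ?thesis by (simp add: preserves_shepherd_def morita_comp_sel)
qed

lemma preserves_shepherd_id:
  assumes M: "is_morita X Y M" and "is_shepherd M \<gamma>"
  shows "preserves_shepherd (morita_id M) \<gamma> \<gamma>"
proof -
  interpret M: morita_context X Y M by (rule morita_context.intro[OF M])
  have n: "is_nt \<gamma> (FT M) (FT M \<odot> FH M \<odot> FT M)" using assms(2) by (simp add: is_shepherd_def)
  show ?thesis
    using vcomp_idn[OF n] godement_idn[OF M.FT M.FH] godement_idn[OF fcomp_functor[OF M.FT M.FH] M.FT]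
    by (simp add: preserves_shepherd_def morita_id_sel)
qed

lemma Herd_eq:
  "Herd X Y = hom_cat {(M, \<gamma>). is_morita X Y M \<and> is_shepherd M \<gamma>}
     (\<lambda>(M, \<gamma>) (M', \<gamma>'). {\<phi>. is_morita_mor M M' \<phi> \<and> preserves_shepherd \<phi> \<gamma> \<gamma>'})
     (\<lambda>(M, \<gamma>). morita_id M) morita_comp"
  by (simp add: Herd_def preserves_shepherd_def)

lemma Herd_category: "category (Herd X Y)"
  unfolding Herd_eq
  by (rule hom_cat_category)
    (auto intro: morita_mor_comp morita_mor_id morita_comp_assoc morita_comp_id
      preserves_shepherd_id preserves_shepherd_comp)

section \<open>Double adjunctions, pre-torsors and their Morita contexts\<close>

locale double_adjunction =
  fixes X :: "('xo, 'xa) cat" and Y :: "('yo, 'ya) cat" and D :: "('xo, 'xa, 'yo, 'ya, 'zo, 'za) dadj"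
  assumes dadj: "is_dadj X Y D"
begin

sublocale A: adjunction X "ZC D" "LA D" "RA D" "etaA D" "epsA D"
  using dadj by unfold_locales (simp add: is_dadj_def)

sublocale B: adjunction Y "ZC D" "LB D" "RB D" "etaB D" "epsB D"
  using dadj by unfold_locales (simp add: is_dadj_def)

lemma Ups_morita: "is_morita X Y (Ups_obj D)"
proof -
  note A = A.L A.R A.eps and B = B.L B.R B.eps
  note f = fcomp_functor[OF A(1,2)] fcomp_functor[OF B(1,2)] fcomp_functor[OF B(1) A(2)] fcomp_functor[OF A(1) B(2)]
  show ?thesis
    unfolding is_morita_def is_monad_def is_bialgebra_functor_def Ups_obj_def morita.select_convs
    by (intro conjI;
        (rule A.eta B.eta f
        | (rule counit_nt, (rule A B)+)
        | (rule A.counit_unit B.counit_unit A.unit_counit B.unit_counit, rule A B)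
        | (rule counit_assoc, (rule A B)+)
        | (rule counit_assoc[symmetric], (rule A B)+)))
qed

text \<open>Pre-torsor structures thus depend on the Morita context only, and a double adjunction may be
  replaced by another one with the same Morita context.\<close>

lemma pretorsor_iff_shepherd: "is_pretorsor_structure D \<tau> \<longleftrightarrow> is_shepherd (Ups_obj D) \<tau>"
proof -
  note [simp] = functor_simps(1,2)[OF A.L] functor_simps(1,2)[OF A.R] functor_simps(1,2)[OF B.L] functor_simps(1,2)[OF B.R]
    A.L A.R B.L B.R fcomp_functor' fcomp_assoc'
  note RALB = fcomp_functor[OF B.L A.R] 
  have 1: "(RA D \<odot> LB D) \<rhd> (RB D \<rhd> epsA D \<lhd> LB D) = (RA D \<odot> LB D \<odot> RB D) \<rhd> epsA D \<lhd> LB D"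
    using whisker_whisker[OF whisker_right_nt[OF A.eps A.LR B.L] fcomp_functor[OF B.L A.LR] B.R RALB] by simp
  have 2: "(RA D \<rhd> epsB D \<lhd> LA D) \<lhd> (RA D \<odot> LB D) = RA D \<rhd> epsB D \<lhd> (LA D \<odot> RA D \<odot> LB D)"
    using whisker_left_right[OF whisker_right_nt[OF B.eps B.LR A.L] RALB fcomp_functor[OF A.L B.LR] A.R]
      whisker_whisker_right[OF B.eps RALB A.L B.LR] by simp
  show ?thesis
    by (simp add: is_pretorsor_structure_def is_shepherd_def Ups_obj_def 1 2)
qed

end

lemma is_dadj_mor_morphisms:
  assumes "is_dadj X Y D" "is_dadj X Y D'" "is_dadj_mor D D' F"
  shows "adjunction_morphism X (ZC D) (LA D) (RA D) (etaA D) (epsA D) (ZC D') (LA D') (RA D') (etaA D') (epsA D') F"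
    "adjunction_morphism Y (ZC D) (LB D) (RB D) (etaB D) (epsB D) (ZC D') (LB D') (RB D') (etaB D') (epsB D') F"
  using assms
  by (auto simp: is_dadj_def is_dadj_mor_def intro!: adjunction_morphism.intro adjunction.intro
      adjunction_morphism_axioms.intro)

lemma (in adjunction_morphism) whisker_mate_nt:
  assumes "is_functor S D W" "S \<odot> F = S'"
  shows "is_nt (S \<rhd> mate) (S \<odot> L) (S' \<odot> L')"
  using whisker_left_nt[OF mate_nt A.L assms(1)] fcomp_assoc[OF A'.L F assms(1)] assms(2) by simp

lemma Ups_mor_morita:
  assumes D: "is_dadj X Y D" and D': "is_dadj X Y D'" and F: "is_dadj_mor D D' F"
  shows "is_morita_mor (Ups_obj D) (Ups_obj D') (Ups_mor D F D')"
proof -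
  interpret D: double_adjunction X Y D by (rule double_adjunction.intro[OF D])
  interpret D': double_adjunction X Y D' by (rule double_adjunction.intro[OF D'])
  interpret A: adjunction_morphism X "ZC D" "LA D" "RA D" "etaA D" "epsA D" "ZC D'" "LA D'" "RA D'" "etaA D'" "epsA D'" F
    by (rule is_dadj_mor_morphisms[OF assms])
  interpret B: adjunction_morphism Y "ZC D" "LB D" "RB D" "etaB D" "epsB D" "ZC D'" "LB D'" "RB D'" "etaB D'" "epsB D'" F
    by (rule is_dadj_mor_morphisms[OF assms])
  have m: "mate_a D F D' = A.mate" "mate_b D F D' = B.mate"
    by (simp_all add: mate_a_def mate_b_def A.mate_def B.mate_def)
  note R = D.A.R A.RF and S = D.B.R B.RF
    and a = D.A.L D'.A.L A.mate_nt and b = D.B.L D'.B.L B.mate_nt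
  show ?thesis
    unfolding is_morita_mor_iff[OF D.Ups_morita D'.Ups_morita]
    unfolding Ups_mor_def morita_mor.select_convs m Ups_obj_def morita.select_convs
    by (intro conjI A.whisker_mate_nt[OF R] A.whisker_mate_nt[OF S] B.whisker_mate_nt[OF R] B.whisker_mate_nt[OF S]
        A.mate_unit B.mate_unit A.mate_mult[OF R a] A.mate_mult[OF R b] A.mate_mult[OF S a] A.mate_mult[OF S b]
        B.mate_mult[OF R a] B.mate_mult[OF R b] B.mate_mult[OF S a] B.mate_mult[OF S b])
qed

lemma dadj_mor_id:
  assumes "is_dadj X Y D"
  shows "is_dadj_mor D D (idf (ZC D))"
proof -
  interpret D: double_adjunction X Y D by (rule double_adjunction.intro[OF assms])
  show ?thesis using fcomp_idf[OF D.A.R] fcomp_idf[OF D.B.R] idf_functor[OF D.A.cD] by (simp add: is_dadj_mor_def)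
qed

lemma dadj_mor_comp:
  assumes "is_dadj X Y D" "is_dadj_mor D D' F" "is_dadj_mor D' D'' F'"
  shows "is_dadj_mor D D'' (F \<odot> F')"
proof -
  interpret D: double_adjunction X Y D by (rule double_adjunction.intro[OF assms(1)])
  have F: "is_functor F (ZC D') (ZC D)" "is_functor F' (ZC D'') (ZC D')"
    using assms(2,3) by (simp_all add: is_dadj_mor_def)
  show ?thesis
    using assms(2,3) fcomp_assoc[OF F(2,1) D.A.R, symmetric] fcomp_assoc[OF F(2,1) D.B.R, symmetric]
    by (simp add: is_dadj_mor_def fcomp_functor[OF F(2,1)])
qed

lemma Ups_mor_id:
  assumes "is_dadj X Y D"
  shows "Ups_mor D (idf (ZC D)) D = morita_id (Ups_obj D)"
proof -
  interpret D: double_adjunction X Y D by (rule double_adjunction.intro[OF assms])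
  show ?thesis
    by (simp add: Ups_mor_def morita_id_def Ups_obj_def mate_a_def mate_b_def D.A.mate_idf D.B.mate_idf
        whisker_idn(1)[OF D.A.L] whisker_idn(1)[OF D.B.L] whisker_idn(1)[OF D.A.L D.A.R] whisker_idn(1)[OF D.B.L D.B.R]
        whisker_idn(1)[OF D.B.L D.A.R] whisker_idn(1)[OF D.A.L D.B.R])
qed

lemma whisker_mate_comp:
  assumes S: "is_functor S Z W" "S \<odot> F = S'" and F: "is_functor F Z' Z"
    and n: "is_nt n K' (F' \<odot> K'')" "is_functor K' V Z'"
    and m: "is_nt m K (F \<odot> K')" "is_functor K V Z"
  shows "S \<rhd> ((F \<rhd> n) \<bullet> m) = (S' \<rhd> n) \<bullet> (S \<rhd> m)"
  using whisker_vcomp[OF m(1) whisker_left_nt[OF n F] m(2) S(1)] whisker_whisker[OF n F S(1)] S(2) by simp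

lemma Ups_mor_comp:
  assumes D: "is_dadj X Y D" and D': "is_dadj X Y D'" and D'': "is_dadj X Y D''"
    and F: "is_dadj_mor D D' F" and F': "is_dadj_mor D' D'' F'"
  shows "Ups_mor D (F \<odot> F') D'' = morita_comp (Ups_mor D' F' D'') (Ups_mor D F D')"
proof -
  note a = is_dadj_mor_morphisms[OF D D' F] and a' = is_dadj_mor_morphisms[OF D' D'' F']
  interpret A: adjunction_morphism X "ZC D" "LA D" "RA D" "etaA D" "epsA D" "ZC D'" "LA D'" "RA D'" "etaA D'" "epsA D'" F
    by (rule a(1))
  interpret B: adjunction_morphism Y "ZC D" "LB D" "RB D" "etaB D" "epsB D" "ZC D'" "LB D'" "RB D'" "etaB D'" "epsB D'" F
    by (rule a(2))
  interpret A': adjunction_morphism X "ZC D'" "LA D'" "RA D'" "etaA D'" "epsA D'" "ZC D''" "LA D''" "RA D''" "etaA D''" "epsA D''" F'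
    by (rule a'(1))
  interpret B': adjunction_morphism Y "ZC D'" "LB D'" "RB D'" "etaB D'" "epsB D'" "ZC D''" "LB D''" "RB D''" "etaB D''" "epsB D''" F'
    by (rule a'(2))
  note wA = whisker_mate_comp[OF _ _ A.F A'.mate_nt A.A'.L A.mate_nt A.A.L]
    and wB = whisker_mate_comp[OF _ _ B.F B'.mate_nt B.A'.L B.mate_nt B.A.L]
  show ?thesis
    unfolding Ups_mor_def morita_comp_def mate_a_def mate_b_def mate_comp[OF a(1) a'(1)] mate_comp[OF a(2) a'(2)]
      A.mate_def[symmetric] A'.mate_def[symmetric] B.mate_def[symmetric] B'.mate_def[symmetric]
      wA[OF A.A.R A.RF] wA[OF B.A.R B.RF] wB[OF A.A.R A.RF] wB[OF B.A.R B.RF]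
    by simp
qed

lemma Adj_category: "category (Adj X Y)"
  unfolding Adj_def
proof (rule hom_cat_category; (simp only: mem_Collect_eq)?)
  show "idf (ZC D) \<odot> F = F \<and> F \<odot> idf (ZC D') = F" if "is_dadj_mor D D' F" for D D' F
    using that fcomp_idf[of F "ZC D'" "ZC D"] by (simp add: is_dadj_mor_def)
  show "(F \<odot> F') \<odot> F'' = F \<odot> F' \<odot> F''"
    if "is_dadj_mor D D' F" "is_dadj_mor D' D'' F'" "is_dadj_mor D'' D''' F''" for D D' D'' D''' F F' F''
    using that fcomp_assoc by (auto simp: is_dadj_mor_def)
qed (auto intro: dadj_mor_id dadj_mor_comp)

text \<open>The compatibility of a morphism with pre-torsor structures involves the morphism only through its
  image under \<^const>\<open>Ups_mor\<close>.\<close>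

lemma PreTor_eq:
  "PreTor X Y = hom_cat {(D, \<tau>). is_dadj X Y D \<and> is_pretorsor_structure D \<tau>}
     (\<lambda>(D, \<tau>) (D', \<tau>'). {F. is_dadj_mor D D' F \<and> preserves_shepherd (Ups_mor D F D') \<tau> \<tau>'})
     (\<lambda>(D, \<tau>). idf (ZC D)) (\<lambda>G F. F \<odot> G)"
  by (simp add: PreTor_def preserves_shepherd_def Ups_mor_def)

lemma PreTor_category: "category (PreTor X Y)"
proof -
  have id: "preserves_shepherd (Ups_mor D (idf (ZC D)) D) \<tau> \<tau>"
    if "is_dadj X Y D" "is_pretorsor_structure D \<tau>" for D \<tau>
    using that(2) preserves_shepherd_id[OF double_adjunction.Ups_morita[OF double_adjunction.intro[OF that(1)]]]
      double_adjunction.pretorsor_iff_shepherd[OF double_adjunction.intro[OF that(1)]]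
    by (simp add: Ups_mor_id[OF that(1)])
  have comp: "preserves_shepherd (Ups_mor D (F \<odot> F') D'') \<tau> \<tau>''"
    if "is_dadj X Y D" "is_dadj X Y D'" "is_dadj X Y D''" "is_dadj_mor D D' F" "is_dadj_mor D' D'' F'"
      "is_pretorsor_structure D \<tau>" "is_pretorsor_structure D' \<tau>'" "is_pretorsor_structure D'' \<tau>''"
      "preserves_shepherd (Ups_mor D F D') \<tau> \<tau>'" "preserves_shepherd (Ups_mor D' F' D'') \<tau>' \<tau>''"
    for D D' D'' \<tau> \<tau>' \<tau>'' F F'
    unfolding Ups_mor_comp[OF that(1-5)]
    using that double_adjunction.pretorsor_iff_shepherd[OF double_adjunction.intro]
      preserves_shepherd_comp[OF double_adjunction.Ups_morita[OF double_adjunction.intro[OF that(1)]]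
        Ups_mor_morita[OF that(1,2,4)] Ups_mor_morita[OF that(2,3,5)]] by blast
  show ?thesis
    unfolding PreTor_eq
  proof (rule hom_cat_category; clarsimp)
    show "idf (ZC D) \<odot> F = F \<and> F \<odot> idf (ZC D') = F" if "is_dadj_mor D D' F" for D D' F
      using that fcomp_idf[of F "ZC D'" "ZC D"] by (simp add: is_dadj_mor_def)
    show "(F \<odot> F') \<odot> F'' = F \<odot> F' \<odot> F''"
      if "is_dadj_mor D D' F" "is_dadj_mor D' D'' F'" "is_dadj_mor D'' D''' F''" for D D' D'' D''' F F' F''
      using that fcomp_assoc by (auto simp: is_dadj_mor_def)
  qed (auto intro: dadj_mor_id dadj_mor_comp id comp)
qed

lemma Ups_functor: "is_functor (Ups X Y) (Adj X Y) (Mor X Y)"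
  unfolding Ups_def Adj_def
  by (rule hom_cat_functor[OF Adj_category[unfolded Adj_def] Mor_category];
      simp add: Mor_def Hom_iff double_adjunction.Ups_morita[OF double_adjunction.intro]
        Ups_mor_morita Ups_mor_id Ups_mor_comp)

lemma Ups_bar_functor: "is_functor (Ups_bar X Y) (PreTor X Y) (Herd X Y)"
  unfolding Ups_bar_def PreTor_eq
  by (rule hom_cat_functor[OF PreTor_category[unfolded PreTor_eq] Herd_category];
      auto simp add: Herd_eq Hom_iff double_adjunction.Ups_morita[OF double_adjunction.intro]
        double_adjunction.pretorsor_iff_shepherd[OF double_adjunction.intro]
        Ups_mor_morita Ups_mor_id Ups_mor_comp)

section \<open>The Eilenberg-Moore category of a Morita context\<close>

context morita_context
begin

lemmas base_simps = functor_simps[OF FA] functor_simps[OF FB] functor_simps[OF FT] functor_simps[OF FH]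
  cat_simps[OF cX] cat_simps[OF cY]

lemma X_components:
  assumes "x \<in> Obj X"
  shows "At (mA M) x \<in> Arr X" "Dom X (At (mA M) x) = Fo (FA M) (Fo (FA M) x)" "Cod X (At (mA M) x) = Fo (FA M) x"
    "At (uA M) x \<in> Arr X" "Dom X (At (uA M) x) = x" "Cod X (At (uA M) x) = Fo (FA M) x"
    "At (ev M) x \<in> Arr X" "Dom X (At (ev M) x) = Fo (FT M) (Fo (FH M) x)" "Cod X (At (ev M) x) = Fo (FA M) x"
    "At (lH M) x \<in> Arr Y" "Dom Y (At (lH M) x) = Fo (FB M) (Fo (FH M) x)" "Cod Y (At (lH M) x) = Fo (FH M) x"
    "At (rH M) x \<in> Arr Y" "Dom Y (At (rH M) x) = Fo (FH M) (Fo (FA M) x)" "Cod Y (At (rH M) x) = Fo (FH M) x"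
  using assms nt_simps(3-5)[OF nts(1) fcomp_functor[OF FA FA]] nt_simps(3-5)[OF nts(2) idf_functor[OF cX]]
    nt_simps(3-5)[OF nts(9) fcomp_functor[OF FH FT]] nt_simps(3-5)[OF nts(7) fcomp_functor[OF FH FB]]
    nt_simps(3-5)[OF nts(8) fcomp_functor[OF FA FH]]
  by (simp_all add: base_simps)

lemma Y_components:
  assumes "y \<in> Obj Y"
  shows "At (mB M) y \<in> Arr Y" "Dom Y (At (mB M) y) = Fo (FB M) (Fo (FB M) y)" "Cod Y (At (mB M) y) = Fo (FB M) y"
    "At (uB M) y \<in> Arr Y" "Dom Y (At (uB M) y) = y" "Cod Y (At (uB M) y) = Fo (FB M) y"
    "At (evh M) y \<in> Arr Y" "Dom Y (At (evh M) y) = Fo (FH M) (Fo (FT M) y)" "Cod Y (At (evh M) y) = Fo (FB M) y"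
    "At (lT M) y \<in> Arr X" "Dom X (At (lT M) y) = Fo (FA M) (Fo (FT M) y)" "Cod X (At (lT M) y) = Fo (FT M) y"
    "At (rT M) y \<in> Arr X" "Dom X (At (rT M) y) = Fo (FT M) (Fo (FB M) y)" "Cod X (At (rT M) y) = Fo (FT M) y"
  using assms nt_simps(3-5)[OF nts(3) fcomp_functor[OF FB FB]] nt_simps(3-5)[OF nts(4) idf_functor[OF cY]]
    nt_simps(3-5)[OF nts(10) fcomp_functor[OF FT FH]] nt_simps(3-5)[OF nts(5) fcomp_functor[OF FT FA]]
    nt_simps(3-5)[OF nts(6) fcomp_functor[OF FB FT]]
  by (simp_all add: base_simps)

lemma sources: "NSrc (mA M) = FA M \<odot> FA M" "NSrc (uA M) = idf X" "NSrc (mB M) = FB M \<odot> FB M" "NSrc (uB M) = idf Y"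
  "NSrc (lT M) = FA M \<odot> FT M" "NSrc (rT M) = FT M \<odot> FB M" "NSrc (lH M) = FB M \<odot> FH M" "NSrc (rH M) = FH M \<odot> FA M"
  "NSrc (ev M) = FT M \<odot> FH M" "NSrc (evh M) = FH M \<odot> FT M"
  using nts by (simp_all add: is_nt_def)

lemmas all_simps = base_simps X_components Y_components sources

lemma laws:
  "mA M \<bullet> (mA M \<lhd> FA M) = mA M \<bullet> (FA M \<rhd> mA M)"
  "mA M \<bullet> (uA M \<lhd> FA M) = idn (FA M)" "mA M \<bullet> (FA M \<rhd> uA M) = idn (FA M)"
  "ev M \<bullet> (lT M \<lhd> FH M) = mA M \<bullet> (FA M \<rhd> ev M)" "ev M \<bullet> (FT M \<rhd> rH M) = mA M \<bullet> (ev M \<lhd> FA M)"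
  "ev M \<bullet> (rT M \<lhd> FH M) = ev M \<bullet> (FT M \<rhd> lH M)"
  "rH M \<bullet> (FH M \<rhd> mA M) = rH M \<bullet> (rH M \<lhd> FA M)" "rH M \<bullet> (FH M \<rhd> uA M) = idn (FH M)"
  "lH M \<bullet> (mB M \<lhd> FH M) = lH M \<bullet> (FB M \<rhd> lH M)" "lH M \<bullet> (uB M \<lhd> FH M) = idn (FH M)"
  "rH M \<bullet> (lH M \<lhd> FA M) = lH M \<bullet> (FB M \<rhd> rH M)" "lH M \<bullet> (evh M \<lhd> FH M) = rH M \<bullet> (FH M \<rhd> ev M)"
  "mB M \<bullet> (mB M \<lhd> FB M) = mB M \<bullet> (FB M \<rhd> mB M)"
  "mB M \<bullet> (uB M \<lhd> FB M) = idn (FB M)" "mB M \<bullet> (FB M \<rhd> uB M) = idn (FB M)"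
  "evh M \<bullet> (lH M \<lhd> FT M) = mB M \<bullet> (FB M \<rhd> evh M)" "evh M \<bullet> (FH M \<rhd> rT M) = mB M \<bullet> (evh M \<lhd> FB M)"
  "evh M \<bullet> (FH M \<rhd> lT M) = evh M \<bullet> (rH M \<lhd> FT M)"
  "rT M \<bullet> (FT M \<rhd> mB M) = rT M \<bullet> (rT M \<lhd> FB M)" "rT M \<bullet> (FT M \<rhd> uB M) = idn (FT M)"
  "lT M \<bullet> (mA M \<lhd> FT M) = lT M \<bullet> (FA M \<rhd> lT M)" "lT M \<bullet> (uA M \<lhd> FT M) = idn (FT M)"
  "rT M \<bullet> (lT M \<lhd> FB M) = lT M \<bullet> (FA M \<rhd> rT M)" "rT M \<bullet> (FT M \<rhd> evh M) = lT M \<bullet> (ev M \<lhd> FT M)"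
  using morita by (simp_all add: is_morita_def is_monad_def is_bialgebra_functor_def)

lemma X_equations:
  assumes "x \<in> Obj X"
  shows "At (mA M) x \<cdot>\<^bsub>X\<^esub> At (mA M) (Fo (FA M) x) = At (mA M) x \<cdot>\<^bsub>X\<^esub> Fa (FA M) (At (mA M) x)"
    "At (mA M) x \<cdot>\<^bsub>X\<^esub> At (uA M) (Fo (FA M) x) = Ide X (Fo (FA M) x)"
    "At (mA M) x \<cdot>\<^bsub>X\<^esub> Fa (FA M) (At (uA M) x) = Ide X (Fo (FA M) x)"
    "At (ev M) x \<cdot>\<^bsub>X\<^esub> At (lT M) (Fo (FH M) x) = At (mA M) x \<cdot>\<^bsub>X\<^esub> Fa (FA M) (At (ev M) x)"
    "At (ev M) x \<cdot>\<^bsub>X\<^esub> Fa (FT M) (At (rH M) x) = At (mA M) x \<cdot>\<^bsub>X\<^esub> At (ev M) (Fo (FA M) x)"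
    "At (ev M) x \<cdot>\<^bsub>X\<^esub> At (rT M) (Fo (FH M) x) = At (ev M) x \<cdot>\<^bsub>X\<^esub> Fa (FT M) (At (lH M) x)"
    "At (rH M) x \<cdot>\<^bsub>Y\<^esub> Fa (FH M) (At (mA M) x) = At (rH M) x \<cdot>\<^bsub>Y\<^esub> At (rH M) (Fo (FA M) x)"
    "At (rH M) x \<cdot>\<^bsub>Y\<^esub> Fa (FH M) (At (uA M) x) = Ide Y (Fo (FH M) x)"
    "At (lH M) x \<cdot>\<^bsub>Y\<^esub> At (mB M) (Fo (FH M) x) = At (lH M) x \<cdot>\<^bsub>Y\<^esub> Fa (FB M) (At (lH M) x)"
    "At (lH M) x \<cdot>\<^bsub>Y\<^esub> At (uB M) (Fo (FH M) x) = Ide Y (Fo (FH M) x)"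
    "At (rH M) x \<cdot>\<^bsub>Y\<^esub> At (lH M) (Fo (FA M) x) = At (lH M) x \<cdot>\<^bsub>Y\<^esub> Fa (FB M) (At (rH M) x)"
    "At (lH M) x \<cdot>\<^bsub>Y\<^esub> At (evh M) (Fo (FH M) x) = At (rH M) x \<cdot>\<^bsub>Y\<^esub> Fa (FH M) (At (ev M) x)"
  supply [simp] = all_simps assms
  subgoal using vcomp_eqD[OF laws(1), of x] by simp
  subgoal using vcomp_idnD[OF laws(2), of x] by simp
  subgoal using vcomp_idnD[OF laws(3), of x] by simp
  subgoal using vcomp_eqD[OF laws(4), of x] by simp
  subgoal using vcomp_eqD[OF laws(5), of x] by simp
  subgoal using vcomp_eqD[OF laws(6), of x] by simp
  subgoal using vcomp_eqD[OF laws(7), of x] by simp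
  subgoal using vcomp_idnD[OF laws(8), of x] by simp
  subgoal using vcomp_eqD[OF laws(9), of x] by simp
  subgoal using vcomp_idnD[OF laws(10), of x] by simp
  subgoal using vcomp_eqD[OF laws(11), of x] by simp
  subgoal using vcomp_eqD[OF laws(12), of x] by simp
  done

lemma Y_equations:
  assumes "y \<in> Obj Y"
  shows "At (mB M) y \<cdot>\<^bsub>Y\<^esub> At (mB M) (Fo (FB M) y) = At (mB M) y \<cdot>\<^bsub>Y\<^esub> Fa (FB M) (At (mB M) y)"
    "At (mB M) y \<cdot>\<^bsub>Y\<^esub> At (uB M) (Fo (FB M) y) = Ide Y (Fo (FB M) y)"
    "At (mB M) y \<cdot>\<^bsub>Y\<^esub> Fa (FB M) (At (uB M) y) = Ide Y (Fo (FB M) y)"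
    "At (evh M) y \<cdot>\<^bsub>Y\<^esub> At (lH M) (Fo (FT M) y) = At (mB M) y \<cdot>\<^bsub>Y\<^esub> Fa (FB M) (At (evh M) y)"
    "At (evh M) y \<cdot>\<^bsub>Y\<^esub> Fa (FH M) (At (rT M) y) = At (mB M) y \<cdot>\<^bsub>Y\<^esub> At (evh M) (Fo (FB M) y)"
    "At (evh M) y \<cdot>\<^bsub>Y\<^esub> At (rH M) (Fo (FT M) y) = At (evh M) y \<cdot>\<^bsub>Y\<^esub> Fa (FH M) (At (lT M) y)"
    "At (rT M) y \<cdot>\<^bsub>X\<^esub> Fa (FT M) (At (mB M) y) = At (rT M) y \<cdot>\<^bsub>X\<^esub> At (rT M) (Fo (FB M) y)"
    "At (rT M) y \<cdot>\<^bsub>X\<^esub> Fa (FT M) (At (uB M) y) = Ide X (Fo (FT M) y)"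
    "At (lT M) y \<cdot>\<^bsub>X\<^esub> At (mA M) (Fo (FT M) y) = At (lT M) y \<cdot>\<^bsub>X\<^esub> Fa (FA M) (At (lT M) y)"
    "At (lT M) y \<cdot>\<^bsub>X\<^esub> At (uA M) (Fo (FT M) y) = Ide X (Fo (FT M) y)"
    "At (rT M) y \<cdot>\<^bsub>X\<^esub> At (lT M) (Fo (FB M) y) = At (lT M) y \<cdot>\<^bsub>X\<^esub> Fa (FA M) (At (rT M) y)"
    "At (lT M) y \<cdot>\<^bsub>X\<^esub> At (ev M) (Fo (FT M) y) = At (rT M) y \<cdot>\<^bsub>X\<^esub> Fa (FT M) (At (evh M) y)"
  supply [simp] = all_simps assms
  subgoal using vcomp_eqD[OF laws(13), of y] by simp
  subgoal using vcomp_idnD[OF laws(14), of y] by simp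
  subgoal using vcomp_idnD[OF laws(15), of y] by simp
  subgoal using vcomp_eqD[OF laws(16), of y] by simp
  subgoal using vcomp_eqD[OF laws(17), of y] by simp
  subgoal using vcomp_eqD[OF laws(18), of y] by simp
  subgoal using vcomp_eqD[OF laws(19), of y] by simp
  subgoal using vcomp_idnD[OF laws(20), of y] by simp
  subgoal using vcomp_eqD[OF laws(21), of y] by simp
  subgoal using vcomp_idnD[OF laws(22), of y] by simp
  subgoal using vcomp_eqD[OF laws(23), of y] by simp
  subgoal using vcomp_eqD[OF laws(24), of y] by simp
  done

lemma X_naturality:
  assumes "f \<in> Arr X" "Dom X f = x" "Cod X f = x'"
  shows "At (mA M) x' \<cdot>\<^bsub>X\<^esub> Fa (FA M) (Fa (FA M) f) = Fa (FA M) f \<cdot>\<^bsub>X\<^esub> At (mA M) x"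
    "At (ev M) x' \<cdot>\<^bsub>X\<^esub> Fa (FT M) (Fa (FH M) f) = Fa (FA M) f \<cdot>\<^bsub>X\<^esub> At (ev M) x"
    "At (lH M) x' \<cdot>\<^bsub>Y\<^esub> Fa (FB M) (Fa (FH M) f) = Fa (FH M) f \<cdot>\<^bsub>Y\<^esub> At (lH M) x"
    "At (rH M) x' \<cdot>\<^bsub>Y\<^esub> Fa (FH M) (Fa (FA M) f) = Fa (FH M) f \<cdot>\<^bsub>Y\<^esub> At (rH M) x"
  using assms nt_natural[OF nts(1) fcomp_functor[OF FA FA] assms]
    nt_natural[OF nts(9) fcomp_functor[OF FH FT] assms] nt_natural[OF nts(7) fcomp_functor[OF FH FB] assms]
    nt_natural[OF nts(8) fcomp_functor[OF FA FH] assms]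
  by (simp_all add: all_simps)

lemma Y_naturality:
  assumes "f \<in> Arr Y" "Dom Y f = y" "Cod Y f = y'"
  shows "At (mB M) y' \<cdot>\<^bsub>Y\<^esub> Fa (FB M) (Fa (FB M) f) = Fa (FB M) f \<cdot>\<^bsub>Y\<^esub> At (mB M) y"
    "At (evh M) y' \<cdot>\<^bsub>Y\<^esub> Fa (FH M) (Fa (FT M) f) = Fa (FB M) f \<cdot>\<^bsub>Y\<^esub> At (evh M) y"
    "At (lT M) y' \<cdot>\<^bsub>X\<^esub> Fa (FA M) (Fa (FT M) f) = Fa (FT M) f \<cdot>\<^bsub>X\<^esub> At (lT M) y"
    "At (rT M) y' \<cdot>\<^bsub>X\<^esub> Fa (FT M) (Fa (FB M) f) = Fa (FT M) f \<cdot>\<^bsub>X\<^esub> At (rT M) y"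
  using assms nt_natural[OF nts(3) fcomp_functor[OF FB FB] assms]
    nt_natural[OF nts(10) fcomp_functor[OF FT FH] assms] nt_natural[OF nts(5) fcomp_functor[OF FT FA] assms]
    nt_natural[OF nts(6) fcomp_functor[OF FB FT] assms]
  by (simp_all add: all_simps)

lemma emobj_iff:
  "is_emobj M ((x, r), (y, s), v, w) \<longleftrightarrow> x \<in> Obj X \<and> y \<in> Obj Y \<and>
     r \<in> Hom X (Fo (FA M) x) x \<and> s \<in> Hom Y (Fo (FB M) y) y \<and>
     v \<in> Hom X (Fo (FT M) y) x \<and> w \<in> Hom Y (Fo (FH M) x) y \<and>
     r \<cdot>\<^bsub>X\<^esub> At (uA M) x = Ide X x \<and> s \<cdot>\<^bsub>Y\<^esub> At (uB M) y = Ide Y y \<and>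
     r \<cdot>\<^bsub>X\<^esub> Fa (FA M) r = r \<cdot>\<^bsub>X\<^esub> At (mA M) x \<and> s \<cdot>\<^bsub>Y\<^esub> Fa (FB M) s = s \<cdot>\<^bsub>Y\<^esub> At (mB M) y \<and>
     r \<cdot>\<^bsub>X\<^esub> Fa (FA M) v = v \<cdot>\<^bsub>X\<^esub> At (lT M) y \<and> v \<cdot>\<^bsub>X\<^esub> Fa (FT M) s = v \<cdot>\<^bsub>X\<^esub> At (rT M) y \<and>
     s \<cdot>\<^bsub>Y\<^esub> Fa (FB M) w = w \<cdot>\<^bsub>Y\<^esub> At (lH M) x \<and> w \<cdot>\<^bsub>Y\<^esub> Fa (FH M) r = w \<cdot>\<^bsub>Y\<^esub> At (rH M) x \<and>
     v \<cdot>\<^bsub>X\<^esub> Fa (FT M) w = r \<cdot>\<^bsub>X\<^esub> At (ev M) x \<and> w \<cdot>\<^bsub>Y\<^esub> Fa (FH M) v = s \<cdot>\<^bsub>Y\<^esub> At (evh M) y"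
  by (auto simp: is_emobj_def is_algebra_def Let_def base_simps)

lemma emmor_iff:
  "is_emmor M ((x, r), (y, s), v, w) ((x', r'), (y', s'), v', w') (f, g) \<longleftrightarrow>
     f \<in> Hom X x x' \<and> g \<in> Hom Y y y' \<and>
     f \<cdot>\<^bsub>X\<^esub> r = r' \<cdot>\<^bsub>X\<^esub> Fa (FA M) f \<and> g \<cdot>\<^bsub>Y\<^esub> s = s' \<cdot>\<^bsub>Y\<^esub> Fa (FB M) g \<and>
     f \<cdot>\<^bsub>X\<^esub> v = v' \<cdot>\<^bsub>X\<^esub> Fa (FT M) g \<and> g \<cdot>\<^bsub>Y\<^esub> w = w' \<cdot>\<^bsub>Y\<^esub> Fa (FH M) f"
  by (auto simp: is_emmor_def is_algebra_mor_def Let_def base_simps)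

end

lemma paste_squares:
  assumes F: "is_functor F C D" and h: "h \<in> Hom C a b" "h' \<in> Hom C b c"
    and f: "f \<in> Hom D x x'" "f' \<in> Hom D x' x''"
    and r: "r \<in> Hom D (Fo F a) x" "r' \<in> Hom D (Fo F b) x'" "r'' \<in> Hom D (Fo F c) x''"
    and e: "f \<cdot>\<^bsub>D\<^esub> r = r' \<cdot>\<^bsub>D\<^esub> Fa F h" "f' \<cdot>\<^bsub>D\<^esub> r' = r'' \<cdot>\<^bsub>D\<^esub> Fa F h'"
  shows "(f' \<cdot>\<^bsub>D\<^esub> f) \<cdot>\<^bsub>D\<^esub> r = r'' \<cdot>\<^bsub>D\<^esub> Fa F (h' \<cdot>\<^bsub>C\<^esub> h)"
proof -
  note cD = functor_cat(2)[OF F]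
  note [simp] = functor_simps[OF F] cat_simps[OF cD]
  have "(f' \<cdot>\<^bsub>D\<^esub> f) \<cdot>\<^bsub>D\<^esub> r = (f' \<cdot>\<^bsub>D\<^esub> r') \<cdot>\<^bsub>D\<^esub> Fa F h"
    using h f r by (simp add: cat_assoc[OF cD] e(1) Hom_iff)
  also have "\<dots> = r'' \<cdot>\<^bsub>D\<^esub> Fa F (h' \<cdot>\<^bsub>C\<^esub> h)"
    using h f r by (simp add: cat_assoc[OF cD] e(2) Hom_iff)
  finally show ?thesis .
qed

context morita_context
begin

lemma EM_category: "category (EM M)"
  unfolding EM_def
proof (rule hom_cat_category; clarsimp simp: base_simps)
  fix x r y s v w assume "is_emobj M ((x, r), (y, s), v, w)"
  then show "is_emmor M ((x, r), (y, s), v, w) ((x, r), (y, s), v, w) (Ide X x, Ide Y y)"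
    by (simp add: emobj_iff emmor_iff Hom_iff all_simps)
next
  fix x r y s v w x' r' y' s' v' w' x'' r'' y'' s'' v'' w'' f g f' g'
  assume o: "is_emobj M ((x, r), (y, s), v, w)" "is_emobj M ((x', r'), (y', s'), v', w')"
    "is_emobj M ((x'', r''), (y'', s''), v'', w'')"
    and m: "is_emmor M ((x, r), (y, s), v, w) ((x', r'), (y', s'), v', w') (f, g)"
    "is_emmor M ((x', r'), (y', s'), v', w') ((x'', r''), (y'', s''), v'', w'') (f', g')"
  note o = o[unfolded emobj_iff] and m = m[unfolded emmor_iff]
  have r: "r \<in> Hom X (Fo (FA M) x) x" "r' \<in> Hom X (Fo (FA M) x') x'" "r'' \<in> Hom X (Fo (FA M) x'') x''"
    and s: "s \<in> Hom Y (Fo (FB M) y) y" "s' \<in> Hom Y (Fo (FB M) y') y'" "s'' \<in> Hom Y (Fo (FB M) y'') y''"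
    and v: "v \<in> Hom X (Fo (FT M) y) x" "v' \<in> Hom X (Fo (FT M) y') x'" "v'' \<in> Hom X (Fo (FT M) y'') x''"
    and w: "w \<in> Hom Y (Fo (FH M) x) y" "w' \<in> Hom Y (Fo (FH M) x') y'" "w'' \<in> Hom Y (Fo (FH M) x'') y''"
    using o by blast+
  have f: "f \<in> Hom X x x'" "f' \<in> Hom X x' x''" and g: "g \<in> Hom Y y y'" "g' \<in> Hom Y y' y''"
    using m by blast+
  show "is_emmor M ((x, r), (y, s), v, w) ((x'', r''), (y'', s''), v'', w'') (f' \<cdot>\<^bsub>X\<^esub> f, g' \<cdot>\<^bsub>Y\<^esub> g)"
    unfolding emmor_iff
    using paste_squares[OF FA f f r] paste_squares[OF FB g g s] paste_squares[OF FT g f v]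
      paste_squares[OF FH f g w] m f g by (simp add: Hom_iff base_simps)
next
  show "f \<cdot>\<^bsub>X\<^esub> Ide X x = f \<and> g \<cdot>\<^bsub>Y\<^esub> Ide Y y = g \<and> Ide X x' \<cdot>\<^bsub>X\<^esub> f = f \<and> Ide Y y' \<cdot>\<^bsub>Y\<^esub> g = g"
    if "is_emmor M ((x, r), (y, s), v, w) ((x', r'), (y', s'), v', w') (f, g)"
    for x r y s v w x' r' y' s' v' w' f g
    using that by (simp add: emmor_iff Hom_iff base_simps)
qed (auto simp: emmor_iff Hom_iff cat_assoc[OF cX] cat_assoc[OF cY])

end

context morita_context
begin

lemma src_simps [simp]: "Src (FA M) = X" "Src (FB M) = Y" "Src (FT M) = Y" "Src (FH M) = X"
  "Tgt (FA M) = X" "Tgt (FB M) = Y" "Tgt (FT M) = X" "Tgt (FH M) = Y"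
  by (simp_all add: base_simps)

lemma EM_simps:
  "e \<in> Obj (EM M) \<longleftrightarrow> is_emobj M e"
  "(e, h, e') \<in> Arr (EM M) \<longleftrightarrow> is_emobj M e \<and> is_emobj M e' \<and> is_emmor M e e' h"
  "(e, h, e') \<in> Arr (EM M) \<Longrightarrow> Dom (EM M) (e, h, e') = e"
  "(e, h, e') \<in> Arr (EM M) \<Longrightarrow> Cod (EM M) (e, h, e') = e'"
  "is_emobj M ((x, r), (y, s), v, w) \<Longrightarrow>
     Ide (EM M) ((x, r), (y, s), v, w) = (((x, r), (y, s), v, w), (Ide X x, Ide Y y), ((x, r), (y, s), v, w))"
  "(e, (f, g), e') \<in> Arr (EM M) \<Longrightarrow> (e', (f', g'), e'') \<in> Arr (EM M) \<Longrightarrow>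
     (e', (f', g'), e'') \<cdot>\<^bsub>EM M\<^esub> (e, (f, g), e') = (e, (f' \<cdot>\<^bsub>X\<^esub> f, g' \<cdot>\<^bsub>Y\<^esub> g), e'')"
  by (simp_all add: EM_def)

lemma EM_arrE:
  assumes "a \<in> Arr (EM M)"
  obtains e f g e' where "a = (e, (f, g), e')" "is_emobj M e" "is_emobj M e'" "is_emmor M e e' (f, g)"
  using assms by (cases a) (auto simp: EM_simps)

lemma UA_functor: "is_functor (UA M) (EM M) X"
  unfolding UA_def EM_def src_simps
  by (rule hom_cat_functor[OF EM_category[unfolded EM_def] cX, simplified])
    (auto simp: emobj_iff emmor_iff Hom_iff)

lemma UB_functor: "is_functor (UB M) (EM M) Y"
  unfolding UB_def EM_def src_simps
  by (rule hom_cat_functor[OF EM_category[unfolded EM_def] cY, simplified])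
    (auto simp: emobj_iff emmor_iff Hom_iff)

lemma U_simps:
  "is_emobj M ((x, r), (y, s), v, w) \<Longrightarrow> Fo (UA M) ((x, r), (y, s), v, w) = x"
  "is_emobj M ((x, r), (y, s), v, w) \<Longrightarrow> Fo (UB M) ((x, r), (y, s), v, w) = y"
  "(e, (f, g), e') \<in> Arr (EM M) \<Longrightarrow> Fa (UA M) (e, (f, g), e') = f"
  "(e, (f, g), e') \<in> Arr (EM M) \<Longrightarrow> Fa (UB M) (e, (f, g), e') = g"
  by (simp_all add: UA_def UB_def EM_simps(1))

lemma GA_emobj: "x \<in> Obj X \<Longrightarrow> is_emobj M (GA_obj M x)"
  by (simp add: GA_obj_def emobj_iff Hom_iff all_simps X_equations)

lemma GB_emobj: "y \<in> Obj Y \<Longrightarrow> is_emobj M (GB_obj M y)"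
  by (simp add: GB_obj_def emobj_iff Hom_iff all_simps Y_equations)

lemma GA_emmor:
  "f \<in> Arr X \<Longrightarrow> is_emmor M (GA_obj M (Dom X f)) (GA_obj M (Cod X f)) (Fa (FA M) f, Fa (FH M) f)"
  by (simp add: GA_obj_def emmor_iff Hom_iff all_simps X_naturality)

lemma GB_emmor:
  "f \<in> Arr Y \<Longrightarrow> is_emmor M (GB_obj M (Dom Y f)) (GB_obj M (Cod Y f)) (Fa (FT M) f, Fa (FB M) f)"
  by (simp add: GB_obj_def emmor_iff Hom_iff all_simps Y_naturality)

lemma GA_functor: "is_functor (GA M) X (EM M)"
  unfolding GA_def Let_def src_simps
proof (rule mk_func_functor[OF cX EM_category])
  fix x assume x: "x \<in> Obj X"
  show "GA_obj M x \<in> Obj (EM M)" using x by (simp add: EM_simps GA_emobj)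
  show "(GA_obj M (Dom X (Ide X x)), (Fa (FA M) (Ide X x), Fa (FH M) (Ide X x)), GA_obj M (Cod X (Ide X x)))
      = Ide (EM M) (GA_obj M x)"
    using x EM_simps(5)[OF GA_emobj[OF x, unfolded GA_obj_def]] by (simp add: GA_obj_def base_simps)
qed (auto simp: EM_simps GA_emobj GA_emmor base_simps,
    metis EM_simps(2,6) GA_emmor GA_emobj cat_simps(1,2)[OF cX])

lemma GB_functor: "is_functor (GB M) Y (EM M)"
  unfolding GB_def Let_def src_simps
proof (rule mk_func_functor[OF cY EM_category])
  fix y assume y: "y \<in> Obj Y"
  show "GB_obj M y \<in> Obj (EM M)" using y by (simp add: EM_simps GB_emobj)
  show "(GB_obj M (Dom Y (Ide Y y)), (Fa (FT M) (Ide Y y), Fa (FB M) (Ide Y y)), GB_obj M (Cod Y (Ide Y y)))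
      = Ide (EM M) (GB_obj M y)"
    using y EM_simps(5)[OF GB_emobj[OF y, unfolded GB_obj_def]] by (simp add: GB_obj_def base_simps)
qed (auto simp: EM_simps GB_emobj GB_emmor base_simps,
    metis EM_simps(2,6) GB_emmor GB_emobj cat_simps(1,2)[OF cY])

lemma G_simps:
  "x \<in> Obj X \<Longrightarrow> Fo (GA M) x = GA_obj M x" "y \<in> Obj Y \<Longrightarrow> Fo (GB M) y = GB_obj M y"
  "f \<in> Arr X \<Longrightarrow> Fa (GA M) f = (GA_obj M (Dom X f), (Fa (FA M) f, Fa (FH M) f), GA_obj M (Cod X f))"
  "g \<in> Arr Y \<Longrightarrow> Fa (GB M) g = (GB_obj M (Dom Y g), (Fa (FT M) g, Fa (FB M) g), GB_obj M (Cod Y g))"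
  by (simp_all add: GA_def GB_def Let_def)

lemma U_G_obj:
  "x \<in> Obj X \<Longrightarrow> Fo (UA M) (GA_obj M x) = Fo (FA M) x" "x \<in> Obj X \<Longrightarrow> Fo (UB M) (GA_obj M x) = Fo (FH M) x"
  "y \<in> Obj Y \<Longrightarrow> Fo (UA M) (GB_obj M y) = Fo (FT M) y" "y \<in> Obj Y \<Longrightarrow> Fo (UB M) (GB_obj M y) = Fo (FB M) y"
  using GA_emobj[of x] GB_emobj[of y] by (simp_all add: GA_obj_def GB_obj_def U_simps)

lemma U_G_arr:
  "f \<in> Arr X \<Longrightarrow> Fa (UA M) (Fa (GA M) f) = Fa (FA M) f" "f \<in> Arr X \<Longrightarrow> Fa (UB M) (Fa (GA M) f) = Fa (FH M) f"
  "g \<in> Arr Y \<Longrightarrow> Fa (UA M) (Fa (GB M) g) = Fa (FT M) g" "g \<in> Arr Y \<Longrightarrow> Fa (UB M) (Fa (GB M) g) = Fa (FB M) g"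
  using functor_simps(4)[OF GA_functor, of f] functor_simps(4)[OF GB_functor, of g]
  by (simp_all add: G_simps U_simps)

lemma U_G:
  "UA M \<odot> GA M = FA M" "UB M \<odot> GA M = FH M" "UA M \<odot> GB M = FT M" "UB M \<odot> GB M = FB M"
  by (rule func_eqI[OF fcomp_functor[OF GA_functor UA_functor] FA]
      func_eqI[OF fcomp_functor[OF GA_functor UB_functor] FH]
      func_eqI[OF fcomp_functor[OF GB_functor UA_functor] FT]
      func_eqI[OF fcomp_functor[OF GB_functor UB_functor] FB];
      simp add: functor_simps(1)[OF GA_functor] functor_simps(1)[OF GB_functor] U_G_arr G_simps(1,2) U_G_obj)+

lemma EM_dadj_sel:
  "ZC (EM_dadj M) = EM M" "LA (EM_dadj M) = GA M" "RA (EM_dadj M) = UA M" "etaA (EM_dadj M) = uA M"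
  "LB (EM_dadj M) = GB M" "RB (EM_dadj M) = UB M" "etaB (EM_dadj M) = uB M"
  by (simp_all add: EM_dadj_def)

lemma EM_eps:
  assumes "is_emobj M ((x, r), (y, s), v, w)"
  shows "At (epsA (EM_dadj M)) ((x, r), (y, s), v, w) = (GA_obj M x, (r, w), ((x, r), (y, s), v, w))"
    "At (epsB (EM_dadj M)) ((x, r), (y, s), v, w) = (GB_obj M y, (v, s), ((x, r), (y, s), v, w))"
    "(GA_obj M x, (r, w), ((x, r), (y, s), v, w)) \<in> Arr (EM M)"
    "(GB_obj M y, (v, s), ((x, r), (y, s), v, w)) \<in> Arr (EM M)"
proof -
  note o = assms[unfolded emobj_iff]
  have x: "x \<in> Obj X" and y: "y \<in> Obj Y" using o by auto
  show "(GA_obj M x, (r, w), ((x, r), (y, s), v, w)) \<in> Arr (EM M)"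
    using assms x GA_emobj[OF x] o by (simp add: EM_simps) (simp add: GA_obj_def emmor_iff)
  show "(GB_obj M y, (v, s), ((x, r), (y, s), v, w)) \<in> Arr (EM M)"
    using assms y GB_emobj[OF y] o by (simp add: EM_simps) (simp add: GB_obj_def emmor_iff)
qed (use assms in \<open>simp_all add: EM_dadj_def EM_simps functor_simps(1)[OF UA_functor] functor_simps(1)[OF UB_functor]\<close>)

lemma epsA_nt: "is_nt (epsA (EM_dadj M)) (GA M \<odot> UA M) (idf (EM M))"
proof -
  note [simp] = functor_simps[OF UA_functor] functor_simps[OF GA_functor]
  let ?c = "\<lambda>((x, r), (y, s), v, w). (GA_obj M x, (r, w), ((x, r), (y, s), v, w))"
  show ?thesis
    unfolding EM_dadj_def dadj.select_convs
  proof (rule mk_nt_nt[OF fcomp_functor[OF UA_functor GA_functor] idf_functor[OF EM_category]])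
    fix e assume e: "e \<in> Obj (EM M)"
    obtain x r y s v w where E: "e = ((x, r), (y, s), v, w)" by (cases e) auto
    show "?c e \<in> Arr (EM M) \<and> Dom (EM M) (?c e) = Fo (GA M \<odot> UA M) e \<and> Cod (EM M) (?c e) = Fo (idf (EM M)) e"
      using e E EM_eps(3)[of x r y s v w] by (simp add: EM_simps U_simps emobj_iff G_simps)
  next
    fix a assume a: "a \<in> Arr (EM M)"
    obtain x r y s v w f g x' r' y' s' v' w' where
      A: "a = (((x, r), (y, s), v, w), (f, g), ((x', r'), (y', s'), v', w'))" by (cases a) auto
    have o: "is_emobj M ((x, r), (y, s), v, w)" "is_emobj M ((x', r'), (y', s'), v', w')"
      and m: "is_emmor M ((x, r), (y, s), v, w) ((x', r'), (y', s'), v', w') (f, g)"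
      using a A by (simp_all add: EM_simps)
    have f: "f \<in> Arr X" "Dom X f = x" "Cod X f = x'" using m by (simp_all add: emmor_iff Hom_iff)
    have Gf: "(GA_obj M x, (Fa (FA M) f, Fa (FH M) f), GA_obj M x') \<in> Arr (EM M)"
      using functor_simps(4)[OF GA_functor f(1)] f by (simp add: G_simps)
    show "?c (Cod (EM M) a) \<cdot>\<^bsub>EM M\<^esub> Fa (GA M \<odot> UA M) a = Fa (idf (EM M)) a \<cdot>\<^bsub>EM M\<^esub> ?c (Dom (EM M) a)"
      using a A f EM_simps(6)[OF Gf EM_eps(3)[OF o(2)]] EM_simps(6)[OF EM_eps(3)[OF o(1)], of f g "((x', r'), (y', s'), v', w')"] m
      by (simp add: EM_simps(3,4) U_simps G_simps emmor_iff)
  qed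
qed

lemma epsB_nt: "is_nt (epsB (EM_dadj M)) (GB M \<odot> UB M) (idf (EM M))"
proof -
  note [simp] = functor_simps[OF UB_functor] functor_simps[OF GB_functor]
  let ?c = "\<lambda>((x, r), (y, s), v, w). (GB_obj M y, (v, s), ((x, r), (y, s), v, w))"
  show ?thesis
    unfolding EM_dadj_def dadj.select_convs
  proof (rule mk_nt_nt[OF fcomp_functor[OF UB_functor GB_functor] idf_functor[OF EM_category]])
    fix e assume e: "e \<in> Obj (EM M)"
    obtain x r y s v w where E: "e = ((x, r), (y, s), v, w)" by (cases e) auto
    show "?c e \<in> Arr (EM M) \<and> Dom (EM M) (?c e) = Fo (GB M \<odot> UB M) e \<and> Cod (EM M) (?c e) = Fo (idf (EM M)) e"
      using e E EM_eps(4)[of x r y s v w] by (simp add: EM_simps U_simps emobj_iff G_simps)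
  next
    fix a assume a: "a \<in> Arr (EM M)"
    obtain x r y s v w f g x' r' y' s' v' w' where
      A: "a = (((x, r), (y, s), v, w), (f, g), ((x', r'), (y', s'), v', w'))" by (cases a) auto
    have o: "is_emobj M ((x, r), (y, s), v, w)" "is_emobj M ((x', r'), (y', s'), v', w')"
      and m: "is_emmor M ((x, r), (y, s), v, w) ((x', r'), (y', s'), v', w') (f, g)"
      using a A by (simp_all add: EM_simps)
    have g: "g \<in> Arr Y" "Dom Y g = y" "Cod Y g = y'" using m by (simp_all add: emmor_iff Hom_iff)
    have Gg: "(GB_obj M y, (Fa (FT M) g, Fa (FB M) g), GB_obj M y') \<in> Arr (EM M)"
      using functor_simps(4)[OF GB_functor g(1)] g by (simp add: G_simps)
    show "?c (Cod (EM M) a) \<cdot>\<^bsub>EM M\<^esub> Fa (GB M \<odot> UB M) a = Fa (idf (EM M)) a \<cdot>\<^bsub>EM M\<^esub> ?c (Dom (EM M) a)"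
      using a A g EM_simps(6)[OF Gg EM_eps(4)[OF o(2)]] EM_simps(6)[OF EM_eps(4)[OF o(1)], of f g "((x', r'), (y', s'), v', w')"] m
      by (simp add: EM_simps(3,4) U_simps G_simps emmor_iff)
  qed
qed

lemma EM_counit_simps:
  assumes "e = ((x, r), (y, s), v, w)" "is_emobj M e"
  shows "Fa (UA M) (At (epsA (EM_dadj M)) e) = r" "Fa (UB M) (At (epsA (EM_dadj M)) e) = w"
    "Fa (UA M) (At (epsB (EM_dadj M)) e) = v" "Fa (UB M) (At (epsB (EM_dadj M)) e) = s"
  using assms EM_eps[of x r y s v w] by (simp_all add: U_simps)

lemma EM_dadj: "is_dadj X Y (EM_dadj M)"
  unfolding is_dadj_def EM_dadj_sel
proof (intro conjI is_adjunctionI[OF GA_functor UA_functor] is_adjunctionI[OF GB_functor UB_functor] epsA_nt epsB_nt)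
  show "is_nt (uA M) (idf X) (UA M \<odot> GA M)" "is_nt (uB M) (idf Y) (UB M \<odot> GB M)"
    using nts by (simp_all add: U_G)
  fix x assume x: "x \<in> Obj X"
  show "At (epsA (EM_dadj M)) (Fo (GA M) x) \<cdot>\<^bsub>EM M\<^esub> Fa (GA M) (At (uA M) x) = Ide (EM M) (Fo (GA M) x)"
    using x functor_simps(4)[OF GA_functor, of "At (uA M) x"] GA_emobj[of x, unfolded GA_obj_def]
      EM_eps[OF GA_emobj[of x, unfolded GA_obj_def]]
    by (simp add: G_simps EM_simps(5,6) all_simps X_equations GA_obj_def)
next
  fix y assume y: "y \<in> Obj Y"
  show "At (epsB (EM_dadj M)) (Fo (GB M) y) \<cdot>\<^bsub>EM M\<^esub> Fa (GB M) (At (uB M) y) = Ide (EM M) (Fo (GB M) y)"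
    using y functor_simps(4)[OF GB_functor, of "At (uB M) y"] GB_emobj[of y, unfolded GB_obj_def]
      EM_eps[OF GB_emobj[of y, unfolded GB_obj_def]]
    by (simp add: G_simps EM_simps(5,6) all_simps Y_equations GB_obj_def)
next
  fix e assume "e \<in> Obj (EM M)"
  moreover obtain x r y s v w where "e = ((x, r), (y, s), v, w)" by (cases e) auto
  ultimately show "Fa (UA M) (At (epsA (EM_dadj M)) e) \<cdot>\<^bsub>X\<^esub> At (uA M) (Fo (UA M) e) = Ide X (Fo (UA M) e)"
    "Fa (UB M) (At (epsB (EM_dadj M)) e) \<cdot>\<^bsub>Y\<^esub> At (uB M) (Fo (UB M) e) = Ide Y (Fo (UB M) e)"
    by (simp_all add: EM_simps EM_counit_simps U_simps emobj_iff)
qed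

end

text \<open>The eight associativity conditions on an object of the Eilenberg-Moore category all have the form
  \<open>a \<circ> P'b = c \<circ> \<mu>'\<close>, with \<open>\<mu>' : P'Q' \<rightarrow> S'\<close> a structure map of the Morita context.  This is how they
  are inherited along a morphism of Morita contexts.\<close>

lemma restrict_action:
  assumes P: "is_functor P C D" and Q: "is_functor Q B C" and \<mu>: "is_nt \<mu> (P \<odot> Q) S" and \<mu>': "is_nt \<mu>' (P' \<odot> Q') S'"
    and p: "is_nt p P P'" and q: "is_nt q Q Q'" and s: "is_nt s S S'" and e: "s \<bullet> \<mu> = \<mu>' \<bullet> (p \<star> q)"
    and z: "z \<in> Obj B" and b: "b \<in> Hom C (Fo Q' z) t" and a: "a \<in> Hom D (Fo P' t) t'" and c: "c \<in> Hom D (Fo S' z) t'"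
    and ab: "a \<cdot>\<^bsub>D\<^esub> Fa P' b = c \<cdot>\<^bsub>D\<^esub> At \<mu>' z"
  shows "(a \<cdot>\<^bsub>D\<^esub> At p t) \<cdot>\<^bsub>D\<^esub> Fa P (b \<cdot>\<^bsub>C\<^esub> At q z) = (c \<cdot>\<^bsub>D\<^esub> At s z) \<cdot>\<^bsub>D\<^esub> At \<mu> z"
proof -
  note PQ = fcomp_functor[OF Q P] and P' = nt_functors[OF p P] and Q' = nt_functors[OF q Q]
  note PQ' = fcomp_functor[OF Q' P'] and S = nt_functors[OF \<mu> PQ]
  note S' = nt_functors[OF s S]
  note cC = functor_cat(2)[OF Q] and cD = functor_cat(2)[OF P]
  have t: "t \<in> Obj C" using b cat_simps(2)[OF cC, of b] by (auto simp: Hom_iff)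
  note [simp] = functor_simps[OF P] functor_simps[OF Q] functor_simps[OF P'] functor_simps[OF Q'] functor_simps[OF S] functor_simps[OF S']
    nt_simps[OF \<mu> PQ] nt_simps[OF \<mu>' PQ'] nt_simps[OF p P] nt_simps[OF q Q] nt_simps[OF s S] z t cat_simps[OF cC] cat_simps[OF cD]
  have [simp]: "b \<in> Arr C" "Dom C b = Fo Q' z" "Cod C b = t" "a \<in> Arr D" "Dom D a = Fo P' t" "Cod D a = t'"
    "c \<in> Arr D" "Dom D c = Fo S' z" "Cod D c = t'" using a b c by (auto simp: Hom_iff)
  have n: "At p t \<cdot>\<^bsub>D\<^esub> Fa P b = Fa P' b \<cdot>\<^bsub>D\<^esub> At p (Fo Q' z)" by (rule nt_natural[OF p P]) simp_all
  have "(a \<cdot>\<^bsub>D\<^esub> At p t) \<cdot>\<^bsub>D\<^esub> Fa P (b \<cdot>\<^bsub>C\<^esub> At q z) = (a \<cdot>\<^bsub>D\<^esub> Fa P' b) \<cdot>\<^bsub>D\<^esub> (At p (Fo Q' z) \<cdot>\<^bsub>D\<^esub> Fa P (At q z))"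
    by (simp add: cat_assoc[OF cD] comp_tail[OF cD n])
  also have "\<dots> = c \<cdot>\<^bsub>D\<^esub> (At \<mu>' z \<cdot>\<^bsub>D\<^esub> At (p \<star> q) z)"
    by (simp add: ab cat_assoc[OF cD] godement_at[OF q Q z p P])
  also have "At \<mu>' z \<cdot>\<^bsub>D\<^esub> At (p \<star> q) z = At s z \<cdot>\<^bsub>D\<^esub> At \<mu> z"
    using vcomp_eqD[OF e[symmetric], of z] by simp
  finally show ?thesis by (simp add: cat_assoc[OF cD])
qed

lemma restrict_square:
  assumes P: "is_functor P C D" and p: "is_nt p P P'" and h: "h \<in> Hom C t t'" and f: "f \<in> Hom D u u'"
    and a: "a \<in> Hom D (Fo P' t) u" "a' \<in> Hom D (Fo P' t') u'" and e: "f \<cdot>\<^bsub>D\<^esub> a = a' \<cdot>\<^bsub>D\<^esub> Fa P' h"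
  shows "f \<cdot>\<^bsub>D\<^esub> (a \<cdot>\<^bsub>D\<^esub> At p t) = (a' \<cdot>\<^bsub>D\<^esub> At p t') \<cdot>\<^bsub>D\<^esub> Fa P h"
proof -
  note P' = nt_functors[OF p P] and cD = functor_cat(2)[OF P] and cC = functor_cat(1)[OF P]
  have [simp]: "h \<in> Arr C" "Dom C h = t" "Cod C h = t'" "f \<in> Arr D" "Dom D f = u" "Cod D f = u'"
    "a \<in> Arr D" "Dom D a = Fo P' t" "Cod D a = u" "a' \<in> Arr D" "Dom D a' = Fo P' t'" "Cod D a' = u'"
    "t \<in> Obj C" "t' \<in> Obj C"
    using h f a cat_simps(1,2)[OF cC, of h] by (auto simp: Hom_iff)
  note [simp] = functor_simps[OF P] functor_simps[OF P'] nt_simps[OF p P] cat_simps[OF cD]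
  have n: "At p t' \<cdot>\<^bsub>D\<^esub> Fa P h = Fa P' h \<cdot>\<^bsub>D\<^esub> At p t" by (rule nt_natural[OF p P]) simp_all
  show ?thesis
    by (simp add: cat_assoc[OF cD] n comp_tail[OF cD e])
qed

locale morita_morphism = M: morita_context X Y M + M': morita_context X Y M'
  for X :: "('xo, 'xa) cat" and Y :: "('yo, 'ya) cat" and M M' :: "('xo, 'xa, 'yo, 'ya) morita" +
  fixes \<phi>
  assumes mor: "is_morita_mor M M' \<phi>"
begin

lemmas p = morita_mor_nts[OF mor]

lemmas laws = mor[unfolded is_morita_mor_iff[OF M.morita M'.morita], THEN conjunct2, THEN conjunct2, THEN conjunct2, THEN conjunct2]

abbreviation restr where
  "restr \<equiv> (\<lambda>((x, r), (y, s), v, w).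
     ((x, r \<cdot>\<^bsub>X\<^esub> At (ph1 \<phi>) x), (y, s \<cdot>\<^bsub>Y\<^esub> At (ph2 \<phi>) y), v \<cdot>\<^bsub>X\<^esub> At (ph3 \<phi>) y, w \<cdot>\<^bsub>Y\<^esub> At (ph4 \<phi>) x))"

lemma phi_simps:
  "x \<in> Obj X \<Longrightarrow> At (ph1 \<phi>) x \<in> Arr X" "x \<in> Obj X \<Longrightarrow> Dom X (At (ph1 \<phi>) x) = Fo (FA M) x" "x \<in> Obj X \<Longrightarrow> Cod X (At (ph1 \<phi>) x) = Fo (FA M') x"
  "y \<in> Obj Y \<Longrightarrow> At (ph2 \<phi>) y \<in> Arr Y" "y \<in> Obj Y \<Longrightarrow> Dom Y (At (ph2 \<phi>) y) = Fo (FB M) y" "y \<in> Obj Y \<Longrightarrow> Cod Y (At (ph2 \<phi>) y) = Fo (FB M') y"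
  "y \<in> Obj Y \<Longrightarrow> At (ph3 \<phi>) y \<in> Arr X" "y \<in> Obj Y \<Longrightarrow> Dom X (At (ph3 \<phi>) y) = Fo (FT M) y" "y \<in> Obj Y \<Longrightarrow> Cod X (At (ph3 \<phi>) y) = Fo (FT M') y"
  "x \<in> Obj X \<Longrightarrow> At (ph4 \<phi>) x \<in> Arr Y" "x \<in> Obj X \<Longrightarrow> Dom Y (At (ph4 \<phi>) x) = Fo (FH M) x" "x \<in> Obj X \<Longrightarrow> Cod Y (At (ph4 \<phi>) x) = Fo (FH M') x"
  by (simp_all add: nt_simps(3-5)[OF p(1) M.FA] nt_simps(3-5)[OF p(2) M.FB] nt_simps(3-5)[OF p(3) M.FT] nt_simps(3-5)[OF p(4) M.FH])

lemma phi_unit: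
  assumes "x \<in> Obj X" "y \<in> Obj Y"
  shows "At (ph1 \<phi>) x \<cdot>\<^bsub>X\<^esub> At (uA M) x = At (uA M') x" "At (ph2 \<phi>) y \<cdot>\<^bsub>Y\<^esub> At (uB M) y = At (uB M') y"
proof -
  have "ph1 \<phi> \<bullet> uA M = uA M'" "ph2 \<phi> \<bullet> uB M = uB M'" using laws by blast+
  from arg_cong[OF this(1), of "\<lambda>\<alpha>. At \<alpha> x"] arg_cong[OF this(2), of "\<lambda>\<alpha>. At \<alpha> y"]
  show "At (ph1 \<phi>) x \<cdot>\<^bsub>X\<^esub> At (uA M) x = At (uA M') x" "At (ph2 \<phi>) y \<cdot>\<^bsub>Y\<^esub> At (uB M) y = At (uB M') y"
    using assms by (simp_all add: M.sources)
qed

lemma restr_emobj: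
  assumes "is_emobj M' e"
  shows "is_emobj M (restr e)"
proof -
  obtain x r y s v w where E: "e = ((x, r), (y, s), v, w)" by (cases e) auto
  note o = assms[unfolded E M'.emobj_iff]
  have x: "x \<in> Obj X" and y: "y \<in> Obj Y" and r: "r \<in> Hom X (Fo (FA M') x) x" and s: "s \<in> Hom Y (Fo (FB M') y) y"
    and v: "v \<in> Hom X (Fo (FT M') y) x" and w: "w \<in> Hom Y (Fo (FH M') x) y"
    using o by blast+
  note [simp] = M.base_simps phi_simps x y M'.all_simps M.sources
  have u: "(r \<cdot>\<^bsub>X\<^esub> At (ph1 \<phi>) x) \<cdot>\<^bsub>X\<^esub> At (uA M) x = Ide X x" "(s \<cdot>\<^bsub>Y\<^esub> At (ph2 \<phi>) y) \<cdot>\<^bsub>Y\<^esub> At (uB M) y = Ide Y y"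
    using o r s phi_unit[OF x y] by (simp_all add: cat_assoc[OF M.cX] cat_assoc[OF M.cY] Hom_iff M.all_simps)
  note n = M.nts and n' = M'.nts
  show ?thesis
    unfolding E prod.case M.emobj_iff
  proof (intro conjI u x y)
    show "(r \<cdot>\<^bsub>X\<^esub> At (ph1 \<phi>) x) \<cdot>\<^bsub>X\<^esub> Fa (FA M) (r \<cdot>\<^bsub>X\<^esub> At (ph1 \<phi>) x) = (r \<cdot>\<^bsub>X\<^esub> At (ph1 \<phi>) x) \<cdot>\<^bsub>X\<^esub> At (mA M) x"
      using restrict_action[OF M.FA M.FA n(1) n'(1) p(1,1,1) _ x r r r] o laws by blast
    show "(s \<cdot>\<^bsub>Y\<^esub> At (ph2 \<phi>) y) \<cdot>\<^bsub>Y\<^esub> Fa (FB M) (s \<cdot>\<^bsub>Y\<^esub> At (ph2 \<phi>) y) = (s \<cdot>\<^bsub>Y\<^esub> At (ph2 \<phi>) y) \<cdot>\<^bsub>Y\<^esub> At (mB M) y"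
      using restrict_action[OF M.FB M.FB n(3) n'(3) p(2,2,2) _ y s s s] o laws by blast
    show "(r \<cdot>\<^bsub>X\<^esub> At (ph1 \<phi>) x) \<cdot>\<^bsub>X\<^esub> Fa (FA M) (v \<cdot>\<^bsub>X\<^esub> At (ph3 \<phi>) y) = (v \<cdot>\<^bsub>X\<^esub> At (ph3 \<phi>) y) \<cdot>\<^bsub>X\<^esub> At (lT M) y"
      using restrict_action[OF M.FA M.FT n(5) n'(5) p(1,3,3) _ y v r v] o laws by blast
    show "(v \<cdot>\<^bsub>X\<^esub> At (ph3 \<phi>) y) \<cdot>\<^bsub>X\<^esub> Fa (FT M) (s \<cdot>\<^bsub>Y\<^esub> At (ph2 \<phi>) y) = (v \<cdot>\<^bsub>X\<^esub> At (ph3 \<phi>) y) \<cdot>\<^bsub>X\<^esub> At (rT M) y"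
      using restrict_action[OF M.FT M.FB n(6) n'(6) p(3,2,3) _ y s v v] o laws by blast
    show "(s \<cdot>\<^bsub>Y\<^esub> At (ph2 \<phi>) y) \<cdot>\<^bsub>Y\<^esub> Fa (FB M) (w \<cdot>\<^bsub>Y\<^esub> At (ph4 \<phi>) x) = (w \<cdot>\<^bsub>Y\<^esub> At (ph4 \<phi>) x) \<cdot>\<^bsub>Y\<^esub> At (lH M) x"
      using restrict_action[OF M.FB M.FH n(7) n'(7) p(2,4,4) _ x w s w] o laws by blast
    show "(w \<cdot>\<^bsub>Y\<^esub> At (ph4 \<phi>) x) \<cdot>\<^bsub>Y\<^esub> Fa (FH M) (r \<cdot>\<^bsub>X\<^esub> At (ph1 \<phi>) x) = (w \<cdot>\<^bsub>Y\<^esub> At (ph4 \<phi>) x) \<cdot>\<^bsub>Y\<^esub> At (rH M) x"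
      using restrict_action[OF M.FH M.FA n(8) n'(8) p(4,1,4) _ x r w w] o laws by blast
    show "(v \<cdot>\<^bsub>X\<^esub> At (ph3 \<phi>) y) \<cdot>\<^bsub>X\<^esub> Fa (FT M) (w \<cdot>\<^bsub>Y\<^esub> At (ph4 \<phi>) x) = (r \<cdot>\<^bsub>X\<^esub> At (ph1 \<phi>) x) \<cdot>\<^bsub>X\<^esub> At (ev M) x"
      using restrict_action[OF M.FT M.FH n(9) n'(9) p(3,4,1) _ x w v r] o laws by blast
    show "(w \<cdot>\<^bsub>Y\<^esub> At (ph4 \<phi>) x) \<cdot>\<^bsub>Y\<^esub> Fa (FH M) (v \<cdot>\<^bsub>X\<^esub> At (ph3 \<phi>) y) = (s \<cdot>\<^bsub>Y\<^esub> At (ph2 \<phi>) y) \<cdot>\<^bsub>Y\<^esub> At (evh M) y"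
      using restrict_action[OF M.FH M.FT n(10) n'(10) p(4,3,2) _ y v w s] o laws by blast
  qed (use r s v w in \<open>simp_all add: Hom_iff\<close>)
qed

lemma restr_emmor:
  assumes "is_emobj M' e" "is_emobj M' e'" "is_emmor M' e e' h"
  shows "is_emmor M (restr e) (restr e') h"
proof -
  obtain x r y s v w x' r' y' s' v' w' f g where E: "e = ((x, r), (y, s), v, w)" "e' = ((x', r'), (y', s'), v', w')" "h = (f, g)"
    by (cases e, cases e', cases h) auto
  note o = assms[unfolded E M'.emobj_iff M'.emmor_iff]
  have r: "r \<in> Hom X (Fo (FA M') x) x" "r' \<in> Hom X (Fo (FA M') x') x'" 
    and s: "s \<in> Hom Y (Fo (FB M') y) y" "s' \<in> Hom Y (Fo (FB M') y') y'"
    and v: "v \<in> Hom X (Fo (FT M') y) x" "v' \<in> Hom X (Fo (FT M') y') x'"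
    and w: "w \<in> Hom Y (Fo (FH M') x) y" "w' \<in> Hom Y (Fo (FH M') x') y'"
    and f: "f \<in> Hom X x x'" and g: "g \<in> Hom Y y y'"
    using o by blast+
  show ?thesis
    unfolding E prod.case M.emmor_iff
    using restrict_square[OF M.FA p(1) f f r] restrict_square[OF M.FB p(2) g g s]
      restrict_square[OF M.FT p(3) g f v] restrict_square[OF M.FH p(4) f g w] o by blast
qed

lemma EM_func_eq: "EM_func M \<phi> M' = mk_func (EM M') (EM M) restr (\<lambda>(e, h, e'). (restr e, h, restr e'))"
  by (simp add: EM_func_def Let_def)

lemma EM_func_simps:
  "is_emobj M' ((x, r), (y, s), v, w) \<Longrightarrow> Fo (EM_func M \<phi> M') ((x, r), (y, s), v, w) = 
     ((x, r \<cdot>\<^bsub>X\<^esub> At (ph1 \<phi>) x), (y, s \<cdot>\<^bsub>Y\<^esub> At (ph2 \<phi>) y), v \<cdot>\<^bsub>X\<^esub> At (ph3 \<phi>) y, w \<cdot>\<^bsub>Y\<^esub> At (ph4 \<phi>) x)"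
  "(e, h, e') \<in> Arr (EM M') \<Longrightarrow> Fa (EM_func M \<phi> M') (e, h, e') = (Fo (EM_func M \<phi> M') e, h, Fo (EM_func M \<phi> M') e')"
  unfolding EM_func_eq by (simp_all add: M'.EM_simps)

lemma EM_func_functor: "is_functor (EM_func M \<phi> M') (EM M') (EM M)"
  unfolding EM_func_eq
proof (rule mk_func_functor[OF M'.EM_category M.EM_category])
  fix a assume a: "a \<in> Arr (EM M')"
  then show "(case a of (e, h, e') \<Rightarrow> (restr e, h, restr e')) \<in> Arr (EM M) \<and>
      Dom (EM M) (case a of (e, h, e') \<Rightarrow> (restr e, h, restr e')) = restr (Dom (EM M') a) \<and>
      Cod (EM M) (case a of (e, h, e') \<Rightarrow> (restr e, h, restr e')) = restr (Cod (EM M') a)"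
    using restr_emobj restr_emmor by (elim M'.EM_arrE) (simp only: prod.case M.EM_simps M'.EM_simps simp_thms)
next
  fix e assume "e \<in> Obj (EM M')"
  then have "is_emobj M' e" "is_emobj M (restr e)" using restr_emobj by (simp_all only: M'.EM_simps)
  then show "(case Ide (EM M') e of (e, h, e') \<Rightarrow> (restr e, h, restr e')) = Ide (EM M) (restr e)"
    by (cases e) (auto simp: M.EM_simps M'.EM_simps)
next
  fix a b assume ab: "a \<in> Arr (EM M')" "b \<in> Arr (EM M')" and c: "Dom (EM M') b = Cod (EM M') a"
  obtain e f g e' where A: "a = (e, (f, g), e')" "is_emobj M' e" "is_emobj M' e'" "is_emmor M' e e' (f, g)"
    by (rule M'.EM_arrE[OF ab(1)]) blast
  obtain e1 f' g' e'' where B: "b = (e1, (f', g'), e'')" "is_emobj M' e1" "is_emobj M' e''" "is_emmor M' e1 e'' (f', g')"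
    by (rule M'.EM_arrE[OF ab(2)]) blast
  have e1: "e1 = e'" using c A B by (simp add: M'.EM_simps)
  have "(restr e, (f, g), restr e') \<in> Arr (EM M)" "(restr e', (f', g'), restr e'') \<in> Arr (EM M)"
    using A B restr_emobj restr_emmor by (simp_all only: e1 M.EM_simps simp_thms)
  then show "(case b \<cdot>\<^bsub>EM M'\<^esub> a of (e, h, e') \<Rightarrow> (restr e, h, restr e')) =
      (case b of (e, h, e') \<Rightarrow> (restr e, h, restr e')) \<cdot>\<^bsub>EM M\<^esub> (case a of (e, h, e') \<Rightarrow> (restr e, h, restr e'))"
    using ab unfolding A(1) B(1) e1 prod.case by (simp only: M.EM_simps(6) M'.EM_simps(6) prod.case)
qed (simp only: M.EM_simps M'.EM_simps restr_emobj)

lemma U_EM_func: "UA M \<odot> EM_func M \<phi> M' = UA M'" "UB M \<odot> EM_func M \<phi> M' = UB M'"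
proof -
  note F = EM_func_functor
  note [simp] = functor_simps[OF F]
  have o: "Fo (UA M) (Fo (EM_func M \<phi> M') e) = Fo (UA M') e" "Fo (UB M) (Fo (EM_func M \<phi> M') e) = Fo (UB M') e"
    if "e \<in> Obj (EM M')" for e
    using that functor_simps(3)[OF F that]
    by (cases e; auto simp: EM_func_simps M.U_simps M'.U_simps M.EM_simps M'.EM_simps)+
  have a: "Fa (UA M) (Fa (EM_func M \<phi> M') a) = Fa (UA M') a" "Fa (UB M) (Fa (EM_func M \<phi> M') a) = Fa (UB M') a"
    if "a \<in> Arr (EM M')" for a
    using that functor_simps(4)[OF F that]
    by (cases a; auto simp: EM_func_simps M.U_simps M'.U_simps)+
  show "UA M \<odot> EM_func M \<phi> M' = UA M'"
    by (rule func_eqI[OF fcomp_functor[OF F M.UA_functor] M'.UA_functor]) (simp_all add: o a)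
  show "UB M \<odot> EM_func M \<phi> M' = UB M'"
    by (rule func_eqI[OF fcomp_functor[OF F M.UB_functor] M'.UB_functor]) (simp_all add: o a)
qed

end

section \<open>Double adjunctions over an Eilenberg-Moore category\<close>

text \<open>The two adjunctions of \<open>D\<close> are lifts along \<open>F\<close> of those of the Eilenberg-Moore category.  This
  describes the double adjunctions \<open>\<Gamma> M\<close>, where \<open>F\<close> is an isomorphism, as well as an arbitrary \<open>D\<close>,
  where \<open>F\<close> is the comparison functor, and the ones that are obtained below by removing arrows.\<close>

definition lies_over ::
  "('xo, 'xa, 'yo, 'ya) morita \<Rightarrow>
   ('zo, 'za, ('xo, 'xa, 'yo, 'ya) emobj, ('xo, 'xa, 'yo, 'ya) emarr) func \<Rightarrow>
   ('xo, 'xa, 'yo, 'ya, 'zo, 'za) dadj \<Rightarrow> bool" where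
  "lies_over M F D \<longleftrightarrow> is_functor F (ZC D) (EM M) \<and>
     RA D = UA M \<odot> F \<and> F \<odot> LA D = GA M \<and> etaA D = uA M \<and> F \<rhd> epsA D = epsA (EM_dadj M) \<lhd> F \<and>
     RB D = UB M \<odot> F \<and> F \<odot> LB D = GB M \<and> etaB D = uB M \<and> F \<rhd> epsB D = epsB (EM_dadj M) \<lhd> F"

locale over_EM = morita_context X Y M + double_adjunction X Y D
  for X :: "('xo, 'xa) cat" and Y :: "('yo, 'ya) cat" and M and D :: "('xo, 'xa, 'yo, 'ya, 'zo, 'za) dadj" +
  fixes F
  assumes over: "lies_over M F D"
begin

lemma F: "is_functor F (ZC D) (EM M)"
  and R: "RA D = UA M \<odot> F" "RB D = UB M \<odot> F"
  and L: "F \<odot> LA D = GA M" "F \<odot> LB D = GB M"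
  and eta: "etaA D = uA M" "etaB D = uB M"
  using over by (simp_all add: lies_over_def)

lemma R_simps:
  "z \<in> Obj (ZC D) \<Longrightarrow> Fo (RA D) z = Fo (UA M) (Fo F z)" "f \<in> Arr (ZC D) \<Longrightarrow> Fa (RA D) f = Fa (UA M) (Fa F f)"
  "z \<in> Obj (ZC D) \<Longrightarrow> Fo (RB D) z = Fo (UB M) (Fo F z)" "f \<in> Arr (ZC D) \<Longrightarrow> Fa (RB D) f = Fa (UB M) (Fa F f)"
  by (simp_all add: R functor_simps[OF F])

lemma L_simps:
  "x \<in> Obj X \<Longrightarrow> Fo F (Fo (LA D) x) = GA_obj M x" "f \<in> Arr X \<Longrightarrow> Fa F (Fa (LA D) f) = Fa (GA M) f"
  "y \<in> Obj Y \<Longrightarrow> Fo F (Fo (LB D) y) = GB_obj M y" "g \<in> Arr Y \<Longrightarrow> Fa F (Fa (LB D) g) = Fa (GB M) g"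
  using fcomp_simps(3)[of x "LA D" F] fcomp_simps(3)[of y "LB D" F] fcomp_simps(4)[of f "LA D" F] fcomp_simps(4)[of g "LB D" F]
  by (simp_all add: L G_simps functor_simps(1)[OF A.L] functor_simps(1)[OF B.L])

lemma eps_over:
  assumes "z \<in> Obj (ZC D)"
  shows "Fa F (At (epsA D) z) = At (epsA (EM_dadj M)) (Fo F z)" "Fa F (At (epsB D) z) = At (epsB (EM_dadj M)) (Fo F z)"
proof -
  have "At (F \<rhd> epsA D) z = At (epsA (EM_dadj M) \<lhd> F) z" "At (F \<rhd> epsB D) z = At (epsB (EM_dadj M) \<lhd> F) z"
    using over by (simp_all add: lies_over_def)
  then show "Fa F (At (epsA D) z) = At (epsA (EM_dadj M)) (Fo F z)" "Fa F (At (epsB D) z) = At (epsB (EM_dadj M)) (Fo F z)"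
    using assms by (simp_all add: functor_simps[OF F] A.adj_simps B.adj_simps)
qed

lemma F_emobj: "z \<in> Obj (ZC D) \<Longrightarrow> is_emobj M (Fo F z)"
  using functor_simps(3)[OF F] by (simp add: EM_simps)

lemma R_eps:
  assumes "Fo F z = ((x, r), (y, s), v, w)" "z \<in> Obj (ZC D)"
  shows "Fa (RA D) (At (epsA D) z) = r" "Fa (RB D) (At (epsB D) z) = s"
    "Fa (RA D) (At (epsB D) z) = v" "Fa (RB D) (At (epsA D) z) = w"
  using assms F_emobj[OF assms(2)] EM_counit_simps[OF assms(1)]
  by (simp_all add: R_simps A.adj_simps B.adj_simps eps_over)

lemma RL: "RA D \<odot> LA D = FA M" "RB D \<odot> LA D = FH M" "RA D \<odot> LB D = FT M" "RB D \<odot> LB D = FB M"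
  using fcomp_assoc[OF A.L F UA_functor] fcomp_assoc[OF A.L F UB_functor]
    fcomp_assoc[OF B.L F UA_functor] fcomp_assoc[OF B.L F UB_functor]
  by (simp_all add: R L U_G)

text \<open>All structure maps of the Morita context of \<open>D\<close> are images of counits at free objects under the
  right adjoints; \<open>F\<close> takes them to the structure maps of the free modules over \<open>M\<close>.\<close>

lemma Ups_over: "Ups_obj D = M"
proof -
  note A = A.L A.R A.eps and B = B.L B.R B.eps
  have x: "Fo F (Fo (LA D) x) = ((Fo (FA M) x, At (mA M) x), (Fo (FH M) x, At (lH M) x), At (ev M) x, At (rH M) x)"
    if "x \<in> Obj X" for x using L_simps(1)[OF that] by (simp add: GA_obj_def)
  have y: "Fo F (Fo (LB D) y) = ((Fo (FT M) y, At (lT M) y), (Fo (FB M) y, At (mB M) y), At (rT M) y, At (evh M) y)"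
    if "y \<in> Obj Y" for y using L_simps(3)[OF that] by (simp add: GB_obj_def)
  note [simp] = A.adj_simps B.adj_simps R_eps[OF x] R_eps[OF y]
  have "RA D \<rhd> epsA D \<lhd> LA D = mA M"
    by (rule nt_eqI[OF counit_nt[OF A(2,1,1,2,3)]]) (simp_all add: RL nts)
  moreover have "RB D \<rhd> epsB D \<lhd> LB D = mB M"
    by (rule nt_eqI[OF counit_nt[OF B(2,1,1,2,3)]]) (simp_all add: RL nts)
  moreover have "RA D \<rhd> epsA D \<lhd> LB D = lT M"
    by (rule nt_eqI[OF counit_nt[OF A(2) B(1) A(1,2,3)]]) (simp_all add: RL nts)
  moreover have "RA D \<rhd> epsB D \<lhd> LB D = rT M"
    by (rule nt_eqI[OF counit_nt[OF A(2) B(1) B(1,2,3)]]) (simp_all add: RL nts)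
  moreover have "RB D \<rhd> epsB D \<lhd> LA D = lH M"
    by (rule nt_eqI[OF counit_nt[OF B(2) A(1) B(1,2,3)]]) (simp_all add: RL nts)
  moreover have "RB D \<rhd> epsA D \<lhd> LA D = rH M"
    by (rule nt_eqI[OF counit_nt[OF B(2) A(1) A(1,2,3)]]) (simp_all add: RL nts)
  moreover have "RA D \<rhd> epsB D \<lhd> LA D = ev M"
    by (rule nt_eqI[OF counit_nt[OF A(2) A(1) B(1,2,3)]]) (simp_all add: RL nts)
  moreover have "RB D \<rhd> epsA D \<lhd> LB D = evh M"
    by (rule nt_eqI[OF counit_nt[OF B(2) B(1) A(1,2,3)]]) (simp_all add: RL nts)
  ultimately show ?thesis by (simp add: Ups_obj_def RL eta)
qed

lemma comparison_over: "comparison D = F"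
proof -
  let ?k = "\<lambda>z. ((Fo (RA D) z, Fa (RA D) (At (epsA D) z)), (Fo (RB D) z, Fa (RB D) (At (epsB D) z)),
                  Fa (RA D) (At (epsB D) z), Fa (RB D) (At (epsA D) z))"
  note cZ = cat_simps[OF A.cD]
  have k: "?k z = Fo F z" if z: "z \<in> Obj (ZC D)" for z
  proof -
    obtain x r y s v w where e: "Fo F z = ((x, r), (y, s), v, w)" by (cases "Fo F z") auto
    show ?thesis using F_emobj[OF z] by (simp add: R_eps[OF e z] R_simps(1,3)[OF z] e U_simps)
  qed
  have a: "(?k (Dom (ZC D) f), (Fa (RA D) f, Fa (RB D) f), ?k (Cod (ZC D) f)) = Fa F f" if f: "f \<in> Arr (ZC D)" for f
  proof -
    obtain e h h' e' where E: "Fa F f = (e, (h, h'), e')" "(e, (h, h'), e') \<in> Arr (EM M)"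
      using functor_simps(4)[OF F f] by (metis EM_arrE)
    have "e = Fo F (Dom (ZC D) f)" "e' = Fo F (Cod (ZC D) f)"
      using E EM_simps(3,4) functor_simps(5,6)[OF F f] by metis+
    then show ?thesis
      unfolding k[OF cZ(1)[OF f]] k[OF cZ(2)[OF f]] R_simps(2,4)[OF f] using E by (simp add: U_simps)
  qed
  have "Fo F \<in> extensional (Obj (ZC D))" "Fa F \<in> extensional (Arr (ZC D))" "Src F = ZC D" "Tgt F = EM M"
    using F by (simp_all add: is_functor_def)
  then have "mk_func (ZC D) (EM M) ?k (\<lambda>f. (?k (Dom (ZC D) f), (Fa (RA D) f, Fa (RB D) f), ?k (Cod (ZC D) f))) = F"
    unfolding mk_func_def using k a by (intro func.equality) (auto simp: extensional_def restrict_def fun_eq_iff)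
  then show ?thesis by (simp add: comparison_def Ups_over Let_def)
qed

end

lemma (in adjunction) counit_square:
  assumes "is_functor S D W" "f \<in> Arr D" "Cod D f = y" "Dom D f = x"
  shows "Fa S (At \<epsilon> y) \<cdot>\<^bsub>W\<^esub> Fa S (Fa L (Fa R f)) = Fa S f \<cdot>\<^bsub>W\<^esub> Fa S (At \<epsilon> x)"
proof -
  note [simp] = functor_simps[OF assms(1)] adj_simps
  show ?thesis using arg_cong[OF eps_nat[OF assms(2,3)], of "Fa S"] assms by auto
qed

text \<open>Hence every double adjunction is lifted from an Eilenberg-Moore category, and by \<open>comparison_over\<close>
  in one way only.\<close>

lemma (in double_adjunction) comparison_lies_over: "lies_over (Ups_obj D) (comparison D) D"
proof -
  define M where "M = Ups_obj D"
  define K where "K = comparison D"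
  interpret M: morita_context X Y M unfolding M_def by (rule morita_context.intro[OF Ups_morita])
  define k where "k z = ((Fo (RA D) z, Fa (RA D) (At (epsA D) z)), (Fo (RB D) z, Fa (RB D) (At (epsB D) z)),
                  Fa (RA D) (At (epsB D) z), Fa (RB D) (At (epsA D) z))" for z
  note [simp] = A.adj_simps B.adj_simps
  have U [simp]: "FA M = RA D \<odot> LA D" "mA M = RA D \<rhd> epsA D \<lhd> LA D" "uA M = etaA D"
    "FB M = RB D \<odot> LB D" "mB M = RB D \<rhd> epsB D \<lhd> LB D" "uB M = etaB D"
    "FT M = RA D \<odot> LB D" "lT M = RA D \<rhd> epsA D \<lhd> LB D" "rT M = RA D \<rhd> epsB D \<lhd> LB D"
    "FH M = RB D \<odot> LA D" "lH M = RB D \<rhd> epsB D \<lhd> LA D" "rH M = RB D \<rhd> epsA D \<lhd> LA D"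
    "ev M = RA D \<rhd> epsB D \<lhd> LA D" "evh M = RB D \<rhd> epsA D \<lhd> LB D"
    by (simp_all add: M_def Ups_obj_def)
  have K_eq: "K = mk_func (ZC D) (EM M) k (\<lambda>f. (k (Dom (ZC D) f), (Fa (RA D) f, Fa (RB D) f), k (Cod (ZC D) f)))"
    by (simp add: K_def M_def comparison_def k_def[abs_def] Let_def)
  have k: "is_emobj M (k z)" if z: "z \<in> Obj (ZC D)" for z
    unfolding k_def M.emobj_iff
    using z A.counit_square[OF A.R, of "At (epsA D) z"] A.counit_square[OF A.R, of "At (epsB D) z"]
      A.counit_square[OF B.R, of "At (epsA D) z"] A.counit_square[OF B.R, of "At (epsB D) z"]
      B.counit_square[OF A.R, of "At (epsA D) z"] B.counit_square[OF A.R, of "At (epsB D) z"]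
      B.counit_square[OF B.R, of "At (epsA D) z"] B.counit_square[OF B.R, of "At (epsB D) z"]
    by (simp add: Hom_iff A.triangle_R B.triangle_R)
  have m: "is_emmor M (k (Dom (ZC D) f)) (k (Cod (ZC D) f)) (Fa (RA D) f, Fa (RB D) f)" if f: "f \<in> Arr (ZC D)" for f
    unfolding k_def M.emmor_iff
    using f A.counit_square[OF A.R f refl refl] A.counit_square[OF B.R f refl refl]
      B.counit_square[OF A.R f refl refl] B.counit_square[OF B.R f refl refl]
    by (simp add: Hom_iff)
  have Ide_k: "Ide (EM M) (k z) = (k z, (Ide X (Fo (RA D) z), Ide Y (Fo (RB D) z)), k z)" if "z \<in> Obj (ZC D)" for z
    using M.EM_simps(5)[OF k[OF that, unfolded k_def]] by (simp add: k_def)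
  have a: "f \<in> Arr (ZC D) \<Longrightarrow> (k (Dom (ZC D) f), (Fa (RA D) f, Fa (RB D) f), k (Cod (ZC D) f)) \<in> Arr (EM M)" for f
    by (simp add: M.EM_simps k m)
  have c: "(k (Cod (ZC D) f), (Fa (RA D) g, Fa (RB D) g), k (Cod (ZC D) g)) \<cdot>\<^bsub>EM M\<^esub>
      (k (Dom (ZC D) f), (Fa (RA D) f, Fa (RB D) f), k (Cod (ZC D) f)) =
      (k (Dom (ZC D) f), (Fa (RA D) g \<cdot>\<^bsub>X\<^esub> Fa (RA D) f, Fa (RB D) g \<cdot>\<^bsub>Y\<^esub> Fa (RB D) f), k (Cod (ZC D) g))"
    if "f \<in> Arr (ZC D)" "g \<in> Arr (ZC D)" "Dom (ZC D) g = Cod (ZC D) f" for f g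
    by (rule M.EM_simps(6)[OF a[OF that(1)] a[OF that(2), unfolded that(3)]])
  have K: "is_functor K (ZC D) (EM M)"
    unfolding K_eq
    by (rule mk_func_functor[OF A.cD M.EM_category]) (auto simp: M.EM_simps(1-5) k m Ide_k c)
  have K_simps: "z \<in> Obj (ZC D) \<Longrightarrow> Fo K z = k z"
    "f \<in> Arr (ZC D) \<Longrightarrow> Fa K f = (k (Dom (ZC D) f), (Fa (RA D) f, Fa (RB D) f), k (Cod (ZC D) f))" for z f
    by (simp_all add: K_eq)
  have uk: "z \<in> Obj (ZC D) \<Longrightarrow> Fo (UA M) (k z) = Fo (RA D) z" "z \<in> Obj (ZC D) \<Longrightarrow> Fo (UB M) (k z) = Fo (RB D) z" for z
    using k[of z] by (simp_all add: k_def M.U_simps)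
  have kL: "x \<in> Obj X \<Longrightarrow> k (Fo (LA D) x) = GA_obj M x" "y \<in> Obj Y \<Longrightarrow> k (Fo (LB D) y) = GB_obj M y" for x y
    by (simp_all add: k_def GA_obj_def GB_obj_def)
  note [simp] = functor_simps(1,2)[OF K] functor_simps(1,2)[OF M.UA_functor] functor_simps(1,2)[OF M.UB_functor]
    functor_simps(1,2)[OF M.GA_functor] functor_simps(1,2)[OF M.GB_functor]
  have R: "UA M \<odot> K = RA D" "UB M \<odot> K = RB D"
    by (rule func_eqI[OF fcomp_functor[OF K M.UA_functor] A.R] func_eqI[OF fcomp_functor[OF K M.UB_functor] B.R];
        simp add: K_simps uk M.U_simps(3,4)[OF a])+
  have L: "K \<odot> LA D = GA M" "K \<odot> LB D = GB M"
    by (rule func_eqI[OF fcomp_functor[OF A.L K] M.GA_functor] func_eqI[OF fcomp_functor[OF B.L K] M.GB_functor];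
        simp add: K_simps M.G_simps kL)+
  have "K \<rhd> epsA D = epsA (EM_dadj M) \<lhd> K"
  proof (rule nt_eqI)
    show "is_nt (K \<rhd> epsA D) (K \<odot> (LA D \<odot> RA D)) (K \<odot> idf (ZC D))"
      by (rule whisker_left_nt[OF A.eps A.LR K])
    show "is_nt (epsA (EM_dadj M) \<lhd> K) (K \<odot> (LA D \<odot> RA D)) (K \<odot> idf (ZC D))"
      by (rule nt_cong[OF whisker_right_nt[OF M.epsA_nt fcomp_functor[OF M.UA_functor M.GA_functor] K]])
        (simp_all add: fcomp_assoc[OF K M.UA_functor M.GA_functor] R fcomp_idf[OF K] L fcomp_assoc[OF A.R A.L K, symmetric])
    fix z assume "z \<in> Obj (Src (K \<odot> (LA D \<odot> RA D)))"
    then have z: "z \<in> Obj (ZC D)" by simp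
    show "At (K \<rhd> epsA D) z = At (epsA (EM_dadj M) \<lhd> K) z"
      using z M.EM_eps(1)[OF k[OF z, unfolded k_def]] by (simp add: K_simps kL) (simp add: k_def)
  qed
  moreover have "K \<rhd> epsB D = epsB (EM_dadj M) \<lhd> K"
  proof (rule nt_eqI)
    show "is_nt (K \<rhd> epsB D) (K \<odot> (LB D \<odot> RB D)) (K \<odot> idf (ZC D))"
      by (rule whisker_left_nt[OF B.eps B.LR K])
    show "is_nt (epsB (EM_dadj M) \<lhd> K) (K \<odot> (LB D \<odot> RB D)) (K \<odot> idf (ZC D))"
      by (rule nt_cong[OF whisker_right_nt[OF M.epsB_nt fcomp_functor[OF M.UB_functor M.GB_functor] K]])
        (simp_all add: fcomp_assoc[OF K M.UB_functor M.GB_functor] R fcomp_idf[OF K] L fcomp_assoc[OF B.R B.L K, symmetric])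
    fix z assume "z \<in> Obj (Src (K \<odot> (LB D \<odot> RB D)))"
    then have z: "z \<in> Obj (ZC D)" by simp
    show "At (K \<rhd> epsB D) z = At (epsB (EM_dadj M) \<lhd> K) z"
      using z M.EM_eps(2)[OF k[OF z, unfolded k_def]] by (simp add: K_simps kL) (simp add: k_def)
  qed
  ultimately show ?thesis
    unfolding M_def[symmetric] K_def[symmetric] lies_over_def using K by (simp add: R L)
qed

text \<open>
  A functor between double adjunctions that is compatible with \<open>EM_func M \<phi> M'\<close> is a morphism of
  double adjunctions that induces \<open>\<phi>\<close>: the components of the two mates are obtained from those of
  the counits at \<open>G'\<^sub>AX\<close> and \<open>G'\<^sub>BY\<close>, that is from the multiplications of \<open>M'\<close> restricted along \<open>\<phi>\<close>,
  and a multiplication composed with the unit disappears.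
\<close>

lemma Ups_mor_over:
  assumes D: "over_EM X Y M D F" and D': "over_EM X Y M' D' F'" and \<phi>: "is_morita_mor M M' \<phi>"
    and H: "is_functor H (ZC D') (ZC D)" and HF: "F \<odot> H = EM_func M \<phi> M' \<odot> F'"
  shows "is_dadj_mor D D' H" "Ups_mor D H D' = \<phi>"
proof -
  interpret D: over_EM X Y M D F by (rule D)
  interpret D': over_EM X Y M' D' F' by (rule D')
  interpret P: morita_morphism X Y M M' \<phi>
    by (intro morita_morphism.intro D.morita_context_axioms D'.morita_context_axioms morita_morphism_axioms.intro \<phi>)
  note E = P.EM_func_functor
  show m: "is_dadj_mor D D' H"
    using fcomp_assoc[OF H D.F D.UA_functor] fcomp_assoc[OF H D.F D.UB_functor]
      fcomp_assoc[OF D'.F E D.UA_functor, symmetric] fcomp_assoc[OF D'.F E D.UB_functor, symmetric] H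
    by (simp add: is_dadj_mor_def D.R D'.R HF P.U_EM_func)
  interpret A: adjunction_morphism X "ZC D" "LA D" "RA D" "etaA D" "epsA D" "ZC D'" "LA D'" "RA D'" "etaA D'" "epsA D'" H
    by (rule is_dadj_mor_morphisms[OF D.dadj D'.dadj m])
  interpret B: adjunction_morphism Y "ZC D" "LB D" "RB D" "etaB D" "epsB D" "ZC D'" "LB D'" "RB D'" "etaB D'" "epsB D'" H
    by (rule is_dadj_mor_morphisms[OF D.dadj D'.dadj m])
  have HF_obj: "Fo F (Fo H z) = Fo (EM_func M \<phi> M') (Fo F' z)" if "z \<in> Obj (ZC D')" for z
    using that fcomp_simps(3)[of z H F] fcomp_simps(3)[of z F' "EM_func M \<phi> M'"]
    by (simp add: HF functor_simps(1)[OF H] functor_simps(1)[OF D'.F])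
  have eA: "Fo F (Fo H (Fo (LA D') x)) = ((Fo (FA M') x, At (mA M') x \<cdot>\<^bsub>X\<^esub> At (ph1 \<phi>) (Fo (FA M') x)),
      (Fo (FH M') x, At (lH M') x \<cdot>\<^bsub>Y\<^esub> At (ph2 \<phi>) (Fo (FH M') x)),
      At (ev M') x \<cdot>\<^bsub>X\<^esub> At (ph3 \<phi>) (Fo (FH M') x), At (rH M') x \<cdot>\<^bsub>Y\<^esub> At (ph4 \<phi>) (Fo (FA M') x))" if "x \<in> Obj X" for x
    using that D'.GA_emobj[OF that] P.EM_func_simps(1)[OF D'.GA_emobj[OF that, unfolded GA_obj_def]]
    by (simp add: HF_obj D'.L_simps D'.A.adj_simps) (simp add: GA_obj_def)
  have eB: "Fo F (Fo H (Fo (LB D') y)) = ((Fo (FT M') y, At (lT M') y \<cdot>\<^bsub>X\<^esub> At (ph1 \<phi>) (Fo (FT M') y)),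
      (Fo (FB M') y, At (mB M') y \<cdot>\<^bsub>Y\<^esub> At (ph2 \<phi>) (Fo (FB M') y)),
      At (rT M') y \<cdot>\<^bsub>X\<^esub> At (ph3 \<phi>) (Fo (FB M') y), At (evh M') y \<cdot>\<^bsub>Y\<^esub> At (ph4 \<phi>) (Fo (FT M') y))" if "y \<in> Obj Y" for y
    using that D'.GB_emobj[OF that] P.EM_func_simps(1)[OF D'.GB_emobj[OF that, unfolded GB_obj_def]]
    by (simp add: HF_obj D'.L_simps D'.B.adj_simps) (simp add: GB_obj_def)
  have RL_obj: "x \<in> Obj X \<Longrightarrow> Fo (RA D') (Fo (LA D') x) = Fo (FA M') x" "x \<in> Obj X \<Longrightarrow> Fo (RB D') (Fo (LA D') x) = Fo (FH M') x"
    "y \<in> Obj Y \<Longrightarrow> Fo (RA D') (Fo (LB D') y) = Fo (FT M') y" "y \<in> Obj Y \<Longrightarrow> Fo (RB D') (Fo (LB D') y) = Fo (FB M') y" for x y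
    unfolding D'.RL[symmetric] by (simp_all add: functor_simps(1)[OF D'.A.L] functor_simps(1)[OF D'.B.L])
  note S = D.A.adj_simps D.B.adj_simps D'.A.adj_simps D'.B.adj_simps functor_simps[OF H] A.RF_simps B.RF_simps RL_obj
  note T = D.all_simps D'.all_simps P.phi_simps
  have RL: "f \<in> Arr X \<Longrightarrow> Fa (RA D) (Fa (LA D) f) = Fa (FA M) f" "f \<in> Arr X \<Longrightarrow> Fa (RB D) (Fa (LA D) f) = Fa (FH M) f"
    "g \<in> Arr Y \<Longrightarrow> Fa (RA D) (Fa (LB D) g) = Fa (FT M) g" "g \<in> Arr Y \<Longrightarrow> Fa (RB D) (Fa (LB D) g) = Fa (FB M) g" for f g
    unfolding D.RL[symmetric] by (simp_all add: S)
  have eta: "At (etaA D') x = At (uA M') x" "At (etaB D') y = At (uB M') y" for x y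
    by (simp_all add: D'.eta)
  have 1: "RA D \<rhd> A.mate = ph1 \<phi>"
  proof (rule nt_eqI[OF A.whisker_mate_nt[OF D.A.R A.RF]])
    fix x assume "x \<in> Obj (Src (RA D \<odot> LA D))"
    then have x: "x \<in> Obj X" by (simp add: S)
    have n: "At (ph1 \<phi>) (Fo (FA M') x) \<cdot>\<^bsub>X\<^esub> Fa (FA M) (At (uA M') x) = Fa (FA M') (At (uA M') x) \<cdot>\<^bsub>X\<^esub> At (ph1 \<phi>) x"
      using x by (intro nt_natural[OF P.p(1) D.FA]) (simp_all add: T)
    show "At (RA D \<rhd> A.mate) x = At (ph1 \<phi>) x"
      using x comp_tail[OF D.cX D'.X_equations(3)[OF x], of "At (ph1 \<phi>) x"]
      by (simp add: S A.mate_simps A.mate_at D.R_eps[OF eA] RL eta T cat_assoc[OF D.cX] n)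
  qed (simp add: D.RL D'.RL P.p)
  have 4: "RB D \<rhd> A.mate = ph4 \<phi>"
  proof (rule nt_eqI[OF A.whisker_mate_nt[OF D.B.R B.RF]])
    fix x assume "x \<in> Obj (Src (RB D \<odot> LA D))"
    then have x: "x \<in> Obj X" by (simp add: S)
    have n: "At (ph4 \<phi>) (Fo (FA M') x) \<cdot>\<^bsub>Y\<^esub> Fa (FH M) (At (uA M') x) = Fa (FH M') (At (uA M') x) \<cdot>\<^bsub>Y\<^esub> At (ph4 \<phi>) x"
      using x by (intro nt_natural[OF P.p(4) D.FH]) (simp_all add: T)
    show "At (RB D \<rhd> A.mate) x = At (ph4 \<phi>) x"
      using x comp_tail[OF D.cY D'.X_equations(8)[OF x], of "At (ph4 \<phi>) x"]
      by (simp add: S A.mate_simps A.mate_at D.R_eps[OF eA] RL eta T cat_assoc[OF D.cY] n)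
  qed (simp add: D.RL D'.RL P.p)
  have 3: "RA D \<rhd> B.mate = ph3 \<phi>"
  proof (rule nt_eqI[OF B.whisker_mate_nt[OF D.A.R A.RF]])
    fix y assume "y \<in> Obj (Src (RA D \<odot> LB D))"
    then have y: "y \<in> Obj Y" by (simp add: S)
    have n: "At (ph3 \<phi>) (Fo (FB M') y) \<cdot>\<^bsub>X\<^esub> Fa (FT M) (At (uB M') y) = Fa (FT M') (At (uB M') y) \<cdot>\<^bsub>X\<^esub> At (ph3 \<phi>) y"
      using y by (intro nt_natural[OF P.p(3) D.FT]) (simp_all add: T)
    show "At (RA D \<rhd> B.mate) y = At (ph3 \<phi>) y"
      using y comp_tail[OF D.cX D'.Y_equations(8)[OF y], of "At (ph3 \<phi>) y"]
      by (simp add: S B.mate_simps B.mate_at D.R_eps[OF eB] RL eta T cat_assoc[OF D.cX] n)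
  qed (simp add: D.RL D'.RL P.p)
  have 2: "RB D \<rhd> B.mate = ph2 \<phi>"
  proof (rule nt_eqI[OF B.whisker_mate_nt[OF D.B.R B.RF]])
    fix y assume "y \<in> Obj (Src (RB D \<odot> LB D))"
    then have y: "y \<in> Obj Y" by (simp add: S)
    have n: "At (ph2 \<phi>) (Fo (FB M') y) \<cdot>\<^bsub>Y\<^esub> Fa (FB M) (At (uB M') y) = Fa (FB M') (At (uB M') y) \<cdot>\<^bsub>Y\<^esub> At (ph2 \<phi>) y"
      using y by (intro nt_natural[OF P.p(2) D.FB]) (simp_all add: T)
    show "At (RB D \<rhd> B.mate) y = At (ph2 \<phi>) y"
      using y comp_tail[OF D.cY D'.Y_equations(3)[OF y], of "At (ph2 \<phi>) y"]
      by (simp add: S B.mate_simps B.mate_at D.R_eps[OF eB] RL eta T cat_assoc[OF D.cY] n)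
  qed (simp add: D.RL D'.RL P.p)
  show "Ups_mor D H D' = \<phi>"
    using 1 2 3 4 unfolding A.mate_def B.mate_def by (simp add: Ups_mor_def mate_a_def mate_b_def)
qed

text \<open>On objects, this is the compatibility \<open>mate_counit\<close> of the mates with the counits under the right
  adjoints.\<close>

lemma comparison_natural:
  assumes D: "is_dadj X Y D" and D': "is_dadj X Y D'" and H: "is_dadj_mor D D' H"
  shows "comparison D \<odot> H = EM_func (Ups_obj D) (Ups_mor D H D') (Ups_obj D') \<odot> comparison D'"
proof -
  interpret D: double_adjunction X Y D by (rule double_adjunction.intro[OF D])
  interpret D': double_adjunction X Y D' by (rule double_adjunction.intro[OF D'])
  interpret A: adjunction_morphism X "ZC D" "LA D" "RA D" "etaA D" "epsA D" "ZC D'" "LA D'" "RA D'" "etaA D'" "epsA D'" H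
    by (rule is_dadj_mor_morphisms[OF assms])
  interpret B: adjunction_morphism Y "ZC D" "LB D" "RB D" "etaB D" "epsB D" "ZC D'" "LB D'" "RB D'" "etaB D'" "epsB D'" H
    by (rule is_dadj_mor_morphisms[OF assms])
  interpret P: morita_morphism X Y "Ups_obj D" "Ups_obj D'" "Ups_mor D H D'"
    by (intro morita_morphism.intro morita_context.intro morita_morphism_axioms.intro D.Ups_morita D'.Ups_morita
        Ups_mor_morita[OF assms])
  have K: "is_functor (comparison D) (ZC D) (EM (Ups_obj D))" and K': "is_functor (comparison D') (ZC D') (EM (Ups_obj D'))"
    using D.comparison_lies_over D'.comparison_lies_over by (simp_all add: lies_over_def)
  note [simp] = A.all_simps B.all_simps A.mate_simps B.mate_simps
  have ph: "ph1 (Ups_mor D H D') = RA D \<rhd> A.mate" "ph2 (Ups_mor D H D') = RB D \<rhd> B.mate"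
    "ph3 (Ups_mor D H D') = RA D \<rhd> B.mate" "ph4 (Ups_mor D H D') = RB D \<rhd> A.mate"
    by (simp_all add: Ups_mor_def mate_a_def mate_b_def A.mate_def B.mate_def)
  have o: "Fo (comparison D) (Fo H z) = Fo (EM_func (Ups_obj D) (Ups_mor D H D') (Ups_obj D')) (Fo (comparison D') z)"
    if z: "z \<in> Obj (ZC D')" for z
  proof -
    have "is_emobj (Ups_obj D') (Fo (comparison D') z)"
      using functor_simps(3)[OF K' z] by (simp add: P.M'.EM_simps)
    then show ?thesis
      using z arg_cong[OF A.mate_counit[OF z], of "Fa (RA D)"] arg_cong[OF A.mate_counit[OF z], of "Fa (RB D)"]
        arg_cong[OF B.mate_counit[OF z], of "Fa (RA D)"] arg_cong[OF B.mate_counit[OF z], of "Fa (RB D)"]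
      by (simp add: comparison_def Let_def P.EM_func_simps ph)
  qed
  have "comparison D \<odot> H = EM_func (Ups_obj D) (Ups_mor D H D') (Ups_obj D') \<odot> comparison D'"
  proof (rule func_eqI[OF fcomp_functor[OF A.F K] fcomp_functor[OF K' P.EM_func_functor]])
    fix z assume "z \<in> Obj (ZC D')"
    then show "Fo (comparison D \<odot> H) z = Fo (EM_func (Ups_obj D) (Ups_mor D H D') (Ups_obj D') \<odot> comparison D') z"
      by (simp add: o functor_simps(1)[OF K'])
  next
    fix f assume f: "f \<in> Arr (ZC D')"
    note c = cat_simps(1,2)[OF D'.A.cD f]
    have Kf: "Fa (comparison D') f = (Fo (comparison D') (Dom (ZC D') f), (Fa (RA D') f, Fa (RB D') f), Fo (comparison D') (Cod (ZC D') f))"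
      using f c by (simp add: comparison_def Let_def)
    have KHf: "Fa (comparison D) (Fa H f) = (Fo (comparison D) (Fo H (Dom (ZC D') f)), (Fa (RA D') f, Fa (RB D') f), Fo (comparison D) (Fo H (Cod (ZC D') f)))"
      using f c by (simp add: comparison_def Let_def)
    show "Fa (comparison D \<odot> H) f = Fa (EM_func (Ups_obj D) (Ups_mor D H D') (Ups_obj D') \<odot> comparison D') f"
      using f functor_simps(4)[OF K' f] unfolding Kf
      by (simp add: functor_simps(1)[OF K'] KHf Kf P.EM_func_simps(2) o[OF c(1)] o[OF c(2)])
  qed
  then show ?thesis .
qed

section \<open>Lifting adjunctions along faithful functors\<close>

lemma faithfulD:
  assumes "faithful F" "is_functor F Z E" "f \<in> Arr Z" "g \<in> Arr Z" "Dom Z f = Dom Z g" "Cod Z f = Cod Z g" "Fa F f = Fa F g"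
  shows "f = g"
proof -
  note [simp] = functor_simps(1)[OF assms(2)] cat_simps[OF functor_cat(1)[OF assms(2)]]
  have "inj_on (Fa F) (Hom Z (Dom Z f) (Cod Z f))"
    using assms(1,3) unfolding faithful_def by simp
  then show ?thesis using assms(3-7) by (auto simp: Hom_iff dest: inj_onD)
qed

lemma fullD:
  assumes "full F" "is_functor F Z E" "x \<in> Obj Z" "y \<in> Obj Z" "h \<in> Hom E (Fo F x) (Fo F y)"
  obtains f where "f \<in> Hom Z x y" "Fa F f = h"
  using assms functor_simps(1,2)[OF assms(2)] unfolding full_def by metis

text \<open>As \<open>F\<close> is faithful and maps \<open>\<epsilon>'\<close> to \<open>\<epsilon>\<close>, the triangle identities can be tested below.\<close>

lemma adjunction_over:
  assumes adj: "is_adjunction C E G U \<eta> \<epsilon>" and F: "is_functor F Z E" "faithful F"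
    and L': "is_functor L C Z" "F \<odot> L = G"
    and e: "is_nt \<epsilon>' (L \<odot> (U \<odot> F)) (idf Z)" "\<And>z. z \<in> Obj Z \<Longrightarrow> Fa F (At \<epsilon>' z) = At \<epsilon> (Fo F z)"
  shows "is_adjunction C Z L (U \<odot> F) \<eta> \<epsilon>'"
proof -
  interpret adjunction C E G U \<eta> \<epsilon> by (rule adjunction.intro[OF adj])
  note UF = fcomp_functor[OF F(1) R]
  note [simp] = adj_simps functor_simps[OF F(1)] functor_simps[OF L'(1)] nt_simps(3-5)[OF e(1) fcomp_functor[OF UF L'(1)]]
    cat_simps[OF functor_cat(1)[OF F(1)]]
  have FL: "x \<in> Obj C \<Longrightarrow> Fo F (Fo L x) = Fo G x" "f \<in> Arr C \<Longrightarrow> Fa F (Fa L f) = Fa G f" for x f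
    using fcomp_simps(3)[of x L F] fcomp_simps(4)[of f L F] by (simp_all add: L'(2))
  have UFL: "(U \<odot> F) \<odot> L = U \<odot> G" using fcomp_assoc[OF L'(1) F(1) R] by (simp add: L'(2))
  show ?thesis
  proof (rule is_adjunctionI[OF L'(1) UF _ e(1)])
    show "is_nt \<eta> (idf C) ((U \<odot> F) \<odot> L)" using eta by (simp add: UFL)
    show "Fa (U \<odot> F) (At \<epsilon>' z) \<cdot>\<^bsub>C\<^esub> At \<eta> (Fo (U \<odot> F) z) = Ide C (Fo (U \<odot> F) z)" if "z \<in> Obj Z" for z
      using that by (simp add: e(2) triangle_R)
    show "At \<epsilon>' (Fo L x) \<cdot>\<^bsub>Z\<^esub> Fa L (At \<eta> x) = Ide Z (Fo L x)" if "x \<in> Obj C" for x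
      using that by (intro faithfulD[OF F(2,1)]) (simp_all add: e(2) FL triangle_L)
  qed
qed

text \<open>
  A left adjoint \<open>G\<close> of \<open>U\<close> lifts along a faithful functor \<open>F\<close> as soon as it does so on objects and
  the arrows out of \<open>Gx\<close> lift: faithfulness makes the lifts of the counit and of the arrows \<open>Gf\<close>
  unique, and therefore natural and functorial.
\<close>

lemma lift_adjunction:
  assumes adj: "is_adjunction C E G U \<eta> \<epsilon>" and F: "is_functor F Z E" "faithful F"
    and l: "\<And>x. x \<in> Obj C \<Longrightarrow> l x \<in> Obj Z \<and> Fo F (l x) = Fo G x"
    and lift: "\<And>x z h. x \<in> Obj C \<Longrightarrow> z \<in> Obj Z \<Longrightarrow> h \<in> Hom E (Fo G x) (Fo F z) \<Longrightarrow> \<exists>f\<in>Hom Z (l x) z. Fa F f = h"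
  obtains L \<epsilon>' where "is_adjunction C Z L (U \<odot> F) \<eta> \<epsilon>'" "F \<odot> L = G" "F \<rhd> \<epsilon>' = \<epsilon> \<lhd> F"
proof -
  interpret adjunction C E G U \<eta> \<epsilon> by (rule adjunction.intro[OF adj])
  note cZ = functor_cat(1)[OF F(1)] and UF = fcomp_functor[OF F(1) R]
  note [simp] = adj_simps functor_simps[OF F(1)] cat_simps[OF cZ]
  define lf where "lf x z h = (SOME f. f \<in> Hom Z (l x) z \<and> Fa F f = h)" for x z h
  have lf: "lf x z h \<in> Arr Z" "Dom Z (lf x z h) = l x" "Cod Z (lf x z h) = z" "Fa F (lf x z h) = h"
    if "x \<in> Obj C" "z \<in> Obj Z" "h \<in> Arr E" "Dom E h = Fo G x" "Cod E h = Fo F z" for x z h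
  proof -
    have "h \<in> Hom E (Fo G x) (Fo F z)" using that(3-5) by (simp add: Hom_iff)
    then have "\<exists>f. f \<in> Hom Z (l x) z \<and> Fa F f = h" using lift[OF that(1,2)] by blast
    then have "lf x z h \<in> Hom Z (l x) z \<and> Fa F (lf x z h) = h" unfolding lf_def by (rule someI_ex)
    then show "lf x z h \<in> Arr Z" "Dom Z (lf x z h) = l x" "Cod Z (lf x z h) = z" "Fa F (lf x z h) = h"
      by (auto simp: Hom_iff)
  qed
  note [simp] = lf l
  define L where "L = mk_func C Z l (\<lambda>f. lf (Dom C f) (l (Cod C f)) (Fa G f))"
  have L: "is_functor L C Z"
    unfolding L_def by (rule mk_func_functor[OF cC cZ]) (auto intro!: faithfulD[OF F(2,1)])
  have L_simps [simp]: "x \<in> Obj C \<Longrightarrow> Fo L x = l x" "f \<in> Arr C \<Longrightarrow> Fa L f = lf (Dom C f) (l (Cod C f)) (Fa G f)" for x f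
    by (simp_all add: L_def)
  have FL: "F \<odot> L = G"
    by (rule func_eqI[OF fcomp_functor[OF L F(1)] adjunction.L[OF adjunction_axioms]]) (simp_all add: functor_simps(1)[OF L])
  define \<epsilon>' where "\<epsilon>' = mk_nt (L \<odot> (U \<odot> F)) (idf Z) (\<lambda>z. lf (Fo U (Fo F z)) z (At \<epsilon> (Fo F z)))"
  have e: "is_nt \<epsilon>' (L \<odot> (U \<odot> F)) (idf Z)"
    unfolding \<epsilon>'_def
    by (rule mk_nt_nt[OF fcomp_functor[OF UF L] idf_functor[OF cZ]]) (auto intro!: faithfulD[OF F(2,1)] simp: eps_nat)
  have e_at: "Fa F (At \<epsilon>' z) = At \<epsilon> (Fo F z)" if "z \<in> Obj Z" for z
    using that by (simp add: \<epsilon>'_def functor_simps(1)[OF L])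
  have "F \<rhd> \<epsilon>' = \<epsilon> \<lhd> F"
  proof (rule nt_eqI)
    show "is_nt (F \<rhd> \<epsilon>') (F \<odot> (L \<odot> (U \<odot> F))) (F \<odot> idf Z)"
      by (rule whisker_left_nt[OF e fcomp_functor[OF UF L] F(1)])
    show "is_nt (\<epsilon> \<lhd> F) (F \<odot> (L \<odot> (U \<odot> F))) (F \<odot> idf Z)"
      by (rule nt_cong[OF whisker_right_nt[OF eps LR F(1)]])
        (simp_all add: fcomp_assoc[OF F(1) R adjunction.L[OF adjunction_axioms]] fcomp_assoc[OF UF L F(1), symmetric] FL fcomp_idf[OF F(1)])
    show "At (F \<rhd> \<epsilon>') z = At (\<epsilon> \<lhd> F) z" if "z \<in> Obj (Src (F \<odot> (L \<odot> (U \<odot> F))))" for z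
      using that nt_simps(1)[OF e fcomp_functor[OF UF L]] by (simp add: e_at functor_simps(1)[OF L])
  qed
  with adjunction_over[OF adj F L FL e e_at] FL show ?thesis by (rule that)
qed

definition no_exit :: "'o \<Rightarrow> ('o, 'a) cat \<Rightarrow> ('o, 'a) cat" where
  "no_exit z Z = mk_cat (Obj Z) {f \<in> Arr Z. Dom Z f = z \<longrightarrow> Cod Z f = z} (Dom Z) (Cod Z) (Ide Z) (Comp Z)"

lemma no_exit_category: "category Z \<Longrightarrow> category (no_exit z Z)"
  unfolding no_exit_def
  by (rule mk_cat_category) (auto simp: cat_simps cat_assoc)

text \<open>
  If all free modules lift to objects different from \<open>z0\<close>, then deleting the arrows from \<open>z0\<close> to
  other objects leaves the two adjunctions intact, because it does not affect the arrows out of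
  free modules.  It also leaves the Morita context unchanged, but no arrow over \<open>k\<close> remains, so that
  the comparison functor is not full.
\<close>

lemma (in morita_context) exists_not_moritable:
  fixes Z :: "('zo, 'za) cat"
  assumes F: "is_functor F Z (EM M)" "full F" "faithful F"
    and z: "z0 \<in> Obj Z" "z1 \<in> Obj Z" "z1 \<noteq> z0" "k \<in> Hom (EM M) (Fo F z0) (Fo F z1)"
    and la: "\<And>x. x \<in> Obj X \<Longrightarrow> la x \<in> Obj Z \<and> la x \<noteq> z0 \<and> Fo F (la x) = GA_obj M x"
    and lb: "\<And>y. y \<in> Obj Y \<Longrightarrow> lb y \<in> Obj Z \<and> lb y \<noteq> z0 \<and> Fo F (lb y) = GB_obj M y"
  obtains D :: "('xo, 'xa, 'yo, 'ya, 'zo, 'za) dadj" where "is_dadj X Y D" "Ups_obj D = M" "\<not> moritable D"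
proof -
  note cZ = functor_cat(1)[OF F(1)]
  note cN = no_exit_category[OF cZ, of z0]
  have N: "Obj (no_exit z0 Z) = Obj Z" "f \<in> Arr (no_exit z0 Z) \<longleftrightarrow> f \<in> Arr Z \<and> (Dom Z f = z0 \<longrightarrow> Cod Z f = z0)"
    "f \<in> Arr (no_exit z0 Z) \<Longrightarrow> Dom (no_exit z0 Z) f = Dom Z f" "f \<in> Arr (no_exit z0 Z) \<Longrightarrow> Cod (no_exit z0 Z) f = Cod Z f"
    "x \<in> Obj Z \<Longrightarrow> Ide (no_exit z0 Z) x = Ide Z x"
    "f \<in> Arr (no_exit z0 Z) \<Longrightarrow> g \<in> Arr (no_exit z0 Z) \<Longrightarrow> Dom Z g = Cod Z f \<Longrightarrow> g \<cdot>\<^bsub>no_exit z0 Z\<^esub> f = g \<cdot>\<^bsub>Z\<^esub> f" for f g x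
    by (auto simp: no_exit_def)
  have NH: "f \<in> Hom (no_exit z0 Z) x y \<longleftrightarrow> f \<in> Hom Z x y \<and> (x = z0 \<longrightarrow> y = z0)" for f x y
    by (auto simp: Hom_iff no_exit_def)
  define F' where "F' = mk_func (no_exit z0 Z) (EM M) (Fo F) (Fa F)"
  have F': "is_functor F' (no_exit z0 Z) (EM M)"
    unfolding F'_def by (rule mk_func_functor[OF cN EM_category]) (auto simp: N functor_simps[OF F(1)])
  have F'_simps: "z \<in> Obj Z \<Longrightarrow> Fo F' z = Fo F z" "f \<in> Arr (no_exit z0 Z) \<Longrightarrow> Fa F' f = Fa F f" for z f
    by (simp_all add: F'_def N(1))
  have fF': "faithful F'"
    unfolding faithful_def functor_simps(1)[OF F'] N(1)
  proof (intro ballI inj_onI)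
    fix x y f g assume a: "f \<in> Hom (no_exit z0 Z) x y" "g \<in> Hom (no_exit z0 Z) x y" "Fa F' f = Fa F' g"
    then have "f \<in> Arr (no_exit z0 Z)" "g \<in> Arr (no_exit z0 Z)" by (simp_all only: Hom_iff)
    then have "Fa F f = Fa F g" using a(3) by (simp only: F'_simps)
    moreover have "f \<in> Hom Z x y" "g \<in> Hom Z x y" using a by (simp_all add: NH)
    ultimately show "f = g" by (intro faithfulD[OF F(3,1)]) (simp_all add: Hom_iff)
  qed
  have adjA: "is_adjunction X (EM M) (GA M) (UA M) (uA M) (epsA (EM_dadj M))"
    and adjB: "is_adjunction Y (EM M) (GB M) (UB M) (uB M) (epsB (EM_dadj M))"
    using EM_dadj by (simp_all add: is_dadj_def EM_dadj_sel)
  have lift: "\<exists>f\<in>Hom (no_exit z0 Z) w z. Fa F' f = h"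
    if "w \<in> Obj Z" "w \<noteq> z0" "z \<in> Obj Z" "h \<in> Hom (EM M) (Fo F w) (Fo F' z)" for w z h
  proof -
    have "h \<in> Hom (EM M) (Fo F w) (Fo F z)" using that by (simp add: F'_simps)
    from fullD[OF F(2,1) that(1,3) this] obtain f where "f \<in> Hom Z w z" "Fa F f = h" .
    then show ?thesis using that(2) NH[of f w z] N(2)[of f] F'_simps(2)[of f]
      by (intro bexI[of _ f]) (auto simp: Hom_iff[of f Z])
  qed
  obtain L1 e1 where 1: "is_adjunction X (no_exit z0 Z) L1 (UA M \<odot> F') (uA M) e1" "F' \<odot> L1 = GA M"
      "F' \<rhd> e1 = epsA (EM_dadj M) \<lhd> F'"
  proof (rule lift_adjunction[OF adjA F' fF', of la])
    show "la x \<in> Obj (no_exit z0 Z) \<and> Fo F' (la x) = Fo (GA M) x" if "x \<in> Obj X" for x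
      using la[OF that] that by (simp add: N F'_simps G_simps)
    show "\<exists>f\<in>Hom (no_exit z0 Z) (la x) z. Fa F' f = h"
      if "x \<in> Obj X" "z \<in> Obj (no_exit z0 Z)" "h \<in> Hom (EM M) (Fo (GA M) x) (Fo F' z)" for x z h
      using lift[of "la x" z h] la[OF that(1)] that by (simp add: N(1) G_simps)
  qed
  obtain L2 e2 where 2: "is_adjunction Y (no_exit z0 Z) L2 (UB M \<odot> F') (uB M) e2" "F' \<odot> L2 = GB M"
      "F' \<rhd> e2 = epsB (EM_dadj M) \<lhd> F'"
  proof (rule lift_adjunction[OF adjB F' fF', of lb])
    show "lb y \<in> Obj (no_exit z0 Z) \<and> Fo F' (lb y) = Fo (GB M) y" if "y \<in> Obj Y" for y
      using lb[OF that] that by (simp add: N F'_simps G_simps)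
    show "\<exists>f\<in>Hom (no_exit z0 Z) (lb y) z. Fa F' f = h"
      if "y \<in> Obj Y" "z \<in> Obj (no_exit z0 Z)" "h \<in> Hom (EM M) (Fo (GB M) y) (Fo F' z)" for y z h
      using lift[of "lb y" z h] lb[OF that(1)] that by (simp add: N(1) G_simps)
  qed
  define D where "D = \<lparr>ZC = no_exit z0 Z, LA = L1, RA = UA M \<odot> F', etaA = uA M, epsA = e1,
    LB = L2, RB = UB M \<odot> F', etaB = uB M, epsB = e2\<rparr>"
  have D: "is_dadj X Y D" using 1(1) 2(1) by (simp add: is_dadj_def D_def)
  have "lies_over M F' D" using F' 1 2 by (simp add: lies_over_def D_def)
  then interpret D: over_EM X Y M D F'
    by (intro over_EM.intro morita_context_axioms double_adjunction.intro D over_EM_axioms.intro)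
  have "\<not> moritable D"
  proof
    assume "moritable D"
    then have "full F'"
      by (auto simp: moritable_def is_equivalence_def D.comparison_over dest: inverse_equivalences_full)
    moreover have "k \<in> Hom (EM M) (Fo F' z0) (Fo F' z1)" using z by (simp add: F'_simps)
    ultimately obtain f where "f \<in> Hom (no_exit z0 Z) z0 z1"
      using fullD[OF _ F', of z0 z1 k] z(1,2) by (auto simp: N(1))
    then show False using z(3) by (auto simp: NH)
  qed
  then show ?thesis using that D D.Ups_over by blast
qed

section \<open>Transport along injections\<close>

locale image_category =
  fixes io :: "'o \<Rightarrow> 'p" and ia :: "'a \<Rightarrow> 'b" and C :: "('o, 'a) cat"
  assumes io: "inj io" and ia: "inj ia" and C: "category C"
begin

lemma inv_simps [simp]: "inv io (io x) = x" "inv ia (ia f) = f"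
  by (simp_all add: io ia)

lemma img_simps:
  "Obj (image_cat io ia C) = io ` Obj C" "Arr (image_cat io ia C) = ia ` Arr C"
  "f \<in> Arr C \<Longrightarrow> Dom (image_cat io ia C) (ia f) = io (Dom C f)"
  "f \<in> Arr C \<Longrightarrow> Cod (image_cat io ia C) (ia f) = io (Cod C f)"
  "x \<in> Obj C \<Longrightarrow> Ide (image_cat io ia C) (io x) = ia (Ide C x)"
  "f \<in> Arr C \<Longrightarrow> g \<in> Arr C \<Longrightarrow> Dom C g = Cod C f \<Longrightarrow> ia g \<cdot>\<^bsub>image_cat io ia C\<^esub> ia f = ia (g \<cdot>\<^bsub>C\<^esub> f)"
  by (simp_all add: image_cat_def)

lemma io_eq: "io x = io y \<longleftrightarrow> x = y"
  using io by (simp add: inj_eq)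

lemma image_category: "category (image_cat io ia C)"
  unfolding image_cat_def
  by (rule mk_cat_category) (auto simp: cat_simps[OF C] cat_assoc[OF C] io_eq)

lemma to_image_functor: "is_functor (to_image io ia C) C (image_cat io ia C)"
  unfolding to_image_def
  by (rule mk_func_functor[OF C image_category]) (simp_all add: img_simps)

lemma from_image_functor: "is_functor (from_image io ia C) (image_cat io ia C) C"
  unfolding from_image_def
  by (rule mk_func_functor[OF image_category C]) (auto simp: img_simps io_eq cat_simps[OF C])

lemma to_image_simps: "x \<in> Obj C \<Longrightarrow> Fo (to_image io ia C) x = io x" "f \<in> Arr C \<Longrightarrow> Fa (to_image io ia C) f = ia f"
  by (simp_all add: to_image_def)

lemma from_image_simps: "x \<in> Obj C \<Longrightarrow> Fo (from_image io ia C) (io x) = x" "f \<in> Arr C \<Longrightarrow> Fa (from_image io ia C) (ia f) = f"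
  by (simp_all add: from_image_def img_simps(1,2))

lemma from_to: "from_image io ia C \<odot> to_image io ia C = idf C"
  by (rule func_eqI[OF fcomp_functor[OF to_image_functor from_image_functor] idf_functor[OF C]])
    (simp_all add: functor_simps(1)[OF to_image_functor] to_image_simps from_image_simps)

lemma to_from: "to_image io ia C \<odot> from_image io ia C = idf (image_cat io ia C)"
  by (rule func_eqI[OF fcomp_functor[OF from_image_functor to_image_functor] idf_functor[OF image_category]])
    (auto simp: functor_simps(1)[OF from_image_functor] to_image_simps from_image_simps img_simps(1,2))

lemma from_image_equivalence: "inverse_equivalences (from_image io ia C) (to_image io ia C)"
  using from_image_functor to_image_functor functor_simps(1,2)[OF from_image_functor]
    naturally_isomorphic_refl[OF idf_functor[OF C]] naturally_isomorphic_refl[OF idf_functor[OF image_category]]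
  by (simp add: inverse_equivalences_def from_to to_from)

end

context image_category
begin

lemma transport_adjunction:
  assumes adj: "is_adjunction B C G U \<eta> \<epsilon>"
  shows "is_adjunction B (image_cat io ia C) (to_image io ia C \<odot> G) (U \<odot> from_image io ia C) \<eta>
      (to_image io ia C \<rhd> \<epsilon> \<lhd> from_image io ia C)" (is "is_adjunction B ?Z (?I \<odot> G) (U \<odot> ?J) \<eta> ?\<epsilon>")
    and "from_image io ia C \<odot> (to_image io ia C \<odot> G) = G"
    and "from_image io ia C \<rhd> (to_image io ia C \<rhd> \<epsilon> \<lhd> from_image io ia C) = \<epsilon> \<lhd> from_image io ia C"
proof -
  interpret adjunction B C G U \<eta> \<epsilon> by (rule adjunction.intro[OF adj])
  note I = to_image_functor and J = from_image_functor
  note G = adjunction.L[OF adjunction_axioms] and U = R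
  note [simp] = adj_simps functor_simps(1-4)[OF I] functor_simps(1-4)[OF J]
  show JIG: "?J \<odot> (?I \<odot> G) = G"
    using fcomp_assoc[OF G I J] by (simp add: from_to fcomp_idf[OF G])
  have IJ: "?I \<odot> (idf C \<odot> ?J) = idf ?Z" by (simp add: fcomp_idf[OF J] to_from)
  note e1 = whisker_right_nt[OF eps LR J]
  note e2 = whisker_left_nt[OF e1 fcomp_functor[OF J LR] I, unfolded IJ]
  have s: "?I \<odot> ((G \<odot> U) \<odot> ?J) = (?I \<odot> G) \<odot> (U \<odot> ?J)"
    using fcomp_assoc[OF J U G] fcomp_assoc[OF fcomp_functor[OF J U] G I] by simp
  note e = e2[unfolded s]
  note UJ = fcomp_functor[OF J U] and IG = fcomp_functor[OF G I]
  have at: "Fa ?J (At ?\<epsilon> z) = At \<epsilon> (Fo ?J z)" if "z \<in> Obj ?Z" for z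
    using that functor_simps(3)[OF J that]
    by (simp add: to_image_simps from_image_simps)
  show "is_adjunction B ?Z (?I \<odot> G) (U \<odot> ?J) \<eta> ?\<epsilon>"
    by (rule adjunction_over[OF adj J inverse_equivalences_faithful[OF from_image_equivalence] IG JIG e at])
  show "?J \<rhd> ?\<epsilon> = \<epsilon> \<lhd> ?J"
  proof (rule nt_eqI[OF whisker_left_nt[OF e fcomp_functor[OF UJ IG] J]])
    show "is_nt (\<epsilon> \<lhd> ?J) (?J \<odot> (?I \<odot> G) \<odot> (U \<odot> ?J)) (?J \<odot> idf ?Z)"
      by (rule nt_cong[OF e1])
        (simp_all add: fcomp_assoc[OF J U G] fcomp_assoc[OF UJ IG J, symmetric] JIG fcomp_idf[OF J])
  qed (simp add: to_image_simps from_image_simps)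
qed

end

lemma (in morita_morphism) emobj_cases:
  assumes "is_emobj M' e"
  obtains x r y s v w where "e = ((x, r), (y, s), v, w)" "x \<in> Obj X" "y \<in> Obj Y" "r \<in> Hom X (Fo (FA M') x) x"
    "s \<in> Hom Y (Fo (FB M') y) y" "v \<in> Hom X (Fo (FT M') y) x" "w \<in> Hom Y (Fo (FH M') x) y"
  using assms by (cases e) (auto simp: M'.emobj_iff)

lemma EM_func_eqI:
  assumes "is_functor F (EM M') C" "is_functor G (EM M') C" and M': "is_morita X Y M'"
    and "\<And>e. is_emobj M' e \<Longrightarrow> Fo F e = Fo G e"
    and "\<And>e f g e'. (e, (f, g), e') \<in> Arr (EM M') \<Longrightarrow> Fa F (e, (f, g), e') = Fa G (e, (f, g), e')"
  shows "F = G"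
proof -
  interpret M': morita_context X Y M' by (rule morita_context.intro[OF M'])
  show ?thesis
  proof (rule func_eqI[OF assms(1,2)])
    show "Fa F a = Fa G a" if "a \<in> Arr (EM M')" for a
      using that assms(5) by (cases a) auto
  qed (simp add: M'.EM_simps assms(4))
qed

lemma EM_func_id:
  assumes M: "is_morita X Y M"
  shows "EM_func M (morita_id M) M = idf (EM M)"
proof -
  interpret morita_morphism X Y M M "morita_id M"
    by (intro morita_morphism.intro morita_context.intro morita_morphism_axioms.intro M morita_mor_id[OF M])
  have o: "Fo (EM_func M (morita_id M) M) e = e" if e: "is_emobj M e" for e
  proof -
    obtain x r y s v w where E: "e = ((x, r), (y, s), v, w)" "x \<in> Obj X" "y \<in> Obj Y" "r \<in> Hom X (Fo (FA M) x) x"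
      "s \<in> Hom Y (Fo (FB M) y) y" "v \<in> Hom X (Fo (FT M) y) x" "w \<in> Hom Y (Fo (FH M) x) y"
      by (rule emobj_cases[OF e])
    then show ?thesis using e by (simp add: EM_func_simps morita_id_sel M.base_simps Hom_iff)
  qed
  show ?thesis
    by (rule EM_func_eqI[OF EM_func_functor idf_functor[OF M.EM_category] M])
      (simp_all add: M.EM_simps EM_func_simps o)
qed

lemma EM_func_comp:
  assumes M: "is_morita X Y M" and M': "is_morita X Y M'" and M'': "is_morita X Y M''"
    and \<phi>: "is_morita_mor M M' \<phi>" and \<psi>: "is_morita_mor M' M'' \<psi>"
  shows "EM_func M (morita_comp \<psi> \<phi>) M'' = EM_func M \<phi> M' \<odot> EM_func M' \<psi> M''"
proof -
  interpret P: morita_morphism X Y M M' \<phi>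
    by (intro morita_morphism.intro morita_context.intro morita_morphism_axioms.intro M M' \<phi>)
  interpret Q: morita_morphism X Y M' M'' \<psi>
    by (intro morita_morphism.intro morita_context.intro morita_morphism_axioms.intro M' M'' \<psi>)
  interpret PQ: morita_morphism X Y M M'' "morita_comp \<psi> \<phi>"
    by (intro morita_morphism.intro morita_context.intro morita_morphism_axioms.intro M M''
        morita_mor_comp[OF M M' M'' \<phi> \<psi>])
  note F = fcomp_functor[OF Q.EM_func_functor P.EM_func_functor]
  note [simp] = functor_simps(1)[OF Q.EM_func_functor]
  have src: "NSrc (ph1 \<phi>) = FA M" "NSrc (ph2 \<phi>) = FB M" "NSrc (ph3 \<phi>) = FT M" "NSrc (ph4 \<phi>) = FH M"
    using P.p by (simp_all add: is_nt_def)
  have o: "Fo (EM_func M (morita_comp \<psi> \<phi>) M'') e = Fo (EM_func M \<phi> M') (Fo (EM_func M' \<psi> M'') e)"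
    if e: "is_emobj M'' e" for e
  proof -
    obtain x r y s v w where E: "e = ((x, r), (y, s), v, w)" "x \<in> Obj X" "y \<in> Obj Y" "r \<in> Hom X (Fo (FA M'') x) x"
      "s \<in> Hom Y (Fo (FB M'') y) y" "v \<in> Hom X (Fo (FT M'') y) x" "w \<in> Hom Y (Fo (FH M'') x) y"
      by (rule Q.emobj_cases[OF e])
    have "is_emobj M' (Fo (EM_func M' \<psi> M'') e)"
      using e functor_simps(3)[OF Q.EM_func_functor, of e] by (simp add: P.M'.EM_simps Q.M'.EM_simps)
    then show ?thesis
      using e E(2-)
      by (simp add: E(1) P.EM_func_simps Q.EM_func_simps PQ.EM_func_simps morita_comp_sel src P.M.src_simps
          cat_assoc[OF P.M.cX] cat_assoc[OF P.M.cY] P.phi_simps Q.phi_simps Hom_iff)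
  qed
  show ?thesis
  proof (rule EM_func_eqI[OF PQ.EM_func_functor F M''])
    show "Fa (EM_func M (morita_comp \<psi> \<phi>) M'') (e, (f, g), e') = Fa (EM_func M \<phi> M' \<odot> EM_func M' \<psi> M'') (e, (f, g), e')"
      if "(e, (f, g), e') \<in> Arr (EM M'')" for e f g e'
      using that functor_simps(4)[OF Q.EM_func_functor that]
      by (simp add: P.EM_func_simps Q.EM_func_simps PQ.EM_func_simps o Q.M'.EM_simps(2))
  qed (simp add: o Q.M'.EM_simps)
qed

section \<open>The adjunction between Morita contexts and double adjunctions\<close>

locale universe =
  fixes X :: "('xo, 'xa) cat" and Y :: "('yo, 'ya) cat"
    and io :: "('xo, 'xa, 'yo, 'ya) emobj \<Rightarrow> 'zo" and ia :: "('xo, 'xa, 'yo, 'ya) emarr \<Rightarrow> 'za"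
  assumes io: "inj io" and ia: "inj ia"
begin

abbreviation I where "I M \<equiv> to_image io ia (EM M)"
abbreviation J where "J M \<equiv> from_image io ia (EM M)"
abbreviation \<Gamma> where "\<Gamma> M \<equiv> Gam_obj io ia M"

lemma image: "is_morita X Y M \<Longrightarrow> image_category io ia (EM M)"
  using io ia morita_context.EM_category[OF morita_context.intro] by (intro image_category.intro)

lemma Gam_over:
  assumes M: "is_morita X Y M"
  shows "over_EM X Y M (\<Gamma> M) (J M)"
proof -
  interpret morita_context X Y M by (rule morita_context.intro[OF M])
  interpret image_category io ia "EM M" by (rule image[OF M])
  have adjA: "is_adjunction X (EM M) (GA M) (UA M) (uA M) (epsA (EM_dadj M))"
    and adjB: "is_adjunction Y (EM M) (GB M) (UB M) (uB M) (epsB (EM_dadj M))"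
    using EM_dadj by (simp_all add: is_dadj_def EM_dadj_sel)
  have s: "ZC (\<Gamma> M) = image_cat io ia (EM M)"
    "LA (\<Gamma> M) = I M \<odot> GA M" "RA (\<Gamma> M) = UA M \<odot> J M" "etaA (\<Gamma> M) = uA M" "epsA (\<Gamma> M) = I M \<rhd> epsA (EM_dadj M) \<lhd> J M"
    "LB (\<Gamma> M) = I M \<odot> GB M" "RB (\<Gamma> M) = UB M \<odot> J M" "etaB (\<Gamma> M) = uB M" "epsB (\<Gamma> M) = I M \<rhd> epsB (EM_dadj M) \<lhd> J M"
    by (simp_all add: Gam_obj_def image_dadj_def Let_def EM_dadj_sel)
  note A = transport_adjunction[OF adjA] and B = transport_adjunction[OF adjB]
  show ?thesis
    by (intro over_EM.intro morita_context_axioms double_adjunction.intro over_EM_axioms.intro)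
      (simp_all add: is_dadj_def lies_over_def s A B from_image_functor)
qed

lemma Gam_dadj: "is_morita X Y M \<Longrightarrow> is_dadj X Y (\<Gamma> M)"
  and Ups_Gam: "is_morita X Y M \<Longrightarrow> Ups_obj (\<Gamma> M) = M"
  and comparison_Gam: "is_morita X Y M \<Longrightarrow> comparison (\<Gamma> M) = J M"
  using over_EM.axioms(2)[OF Gam_over, of M] over_EM.Ups_over[OF Gam_over, of M] over_EM.comparison_over[OF Gam_over, of M]
  by (simp_all add: double_adjunction_def)

lemma comparison_over_EM:
  assumes D: "is_dadj X Y D"
  shows "over_EM X Y (Ups_obj D) D (comparison D)"
proof -
  interpret double_adjunction X Y D by (rule double_adjunction.intro[OF D])
  show ?thesis
    by (intro over_EM.intro morita_context.intro over_EM_axioms.intro Ups_morita double_adjunction_axioms comparison_lies_over)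
qed

lemma ZC_Gam: "ZC (\<Gamma> M) = image_cat io ia (EM M)"
  by (simp add: Gam_obj_def image_dadj_def Let_def EM_dadj_def)

lemma I_functor: "is_morita X Y M \<Longrightarrow> is_functor (I M) (EM M) (ZC (\<Gamma> M))"
  and J_functor: "is_morita X Y M \<Longrightarrow> is_functor (J M) (ZC (\<Gamma> M)) (EM M)"
  and J_I: "is_morita X Y M \<Longrightarrow> J M \<odot> I M = idf (EM M)"
  and I_J: "is_morita X Y M \<Longrightarrow> I M \<odot> J M = idf (ZC (\<Gamma> M))"
  unfolding ZC_Gam
  using image_category.to_image_functor[OF image] image_category.from_image_functor[OF image]
    image_category.from_to[OF image] image_category.to_from[OF image] by auto

lemma EM_func_functor: "is_morita X Y M \<Longrightarrow> is_morita X Y M' \<Longrightarrow> is_morita_mor M M' \<phi> \<Longrightarrow>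
    is_functor (EM_func M \<phi> M') (EM M') (EM M)"
  by (intro morita_morphism.EM_func_functor morita_morphism.intro morita_context.intro morita_morphism_axioms.intro)

lemma J_I_comp: "is_morita X Y M \<Longrightarrow> is_functor F C (EM M) \<Longrightarrow> J M \<odot> (I M \<odot> F) = F"
  using fcomp_assoc[of F C "EM M" "I M" "ZC (\<Gamma> M)" "J M" "EM M"] I_functor J_functor
  by (simp add: J_I fcomp_idf)

lemma Gam_mor:
  assumes M: "is_morita X Y M" and M': "is_morita X Y M'" and \<phi>: "is_morita_mor M M' \<phi>"
  shows "is_dadj_mor (\<Gamma> M) (\<Gamma> M') (Gam_mor io ia M \<phi> M')" "Ups_mor (\<Gamma> M) (Gam_mor io ia M \<phi> M') (\<Gamma> M') = \<phi>"
proof -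
  note EJ = fcomp_functor[OF J_functor[OF M'] EM_func_functor[OF M M' \<phi>]]
  note h = Ups_mor_over[OF Gam_over[OF M] Gam_over[OF M'] \<phi> fcomp_functor[OF EJ I_functor[OF M]]
      J_I_comp[OF M EJ]]
  show "is_dadj_mor (\<Gamma> M) (\<Gamma> M') (Gam_mor io ia M \<phi> M')" "Ups_mor (\<Gamma> M) (Gam_mor io ia M \<phi> M') (\<Gamma> M') = \<phi>"
    using h by (simp_all add: Gam_mor_def)
qed

lemma Gam_mor_id: "is_morita X Y M \<Longrightarrow> Gam_mor io ia M (morita_id M) M = idf (ZC (\<Gamma> M))"
  using fcomp_idf(2)[OF J_functor] by (simp add: Gam_mor_def EM_func_id I_J)

lemma Gam_mor_comp:
  assumes M: "is_morita X Y M" and M': "is_morita X Y M'" and M'': "is_morita X Y M''"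
    and \<phi>: "is_morita_mor M M' \<phi>" and \<psi>: "is_morita_mor M' M'' \<psi>"
  shows "Gam_mor io ia M (morita_comp \<psi> \<phi>) M'' = Gam_mor io ia M \<phi> M' \<odot> Gam_mor io ia M' \<psi> M''"
proof -
  note E = EM_func_functor[OF M M' \<phi>] and E' = EM_func_functor[OF M' M'' \<psi>]
  note E'J = fcomp_functor[OF J_functor[OF M''] E']
  note IEJ = fcomp_functor[OF E'J I_functor[OF M']]
  show ?thesis
    unfolding Gam_mor_def EM_func_comp[OF assms]
    using fcomp_assoc[OF IEJ fcomp_functor[OF J_functor[OF M'] E] I_functor[OF M]]
      fcomp_assoc[OF IEJ J_functor[OF M'] E] fcomp_assoc[OF J_functor[OF M''] E' E]
    by (simp add: J_I_comp[OF M' E'J])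
qed

text \<open>The comparison functor with its target transported along \<open>io\<close> and \<open>ia\<close>, as a morphism from
  \<open>\<Gamma> (Ups_obj D)\<close> to \<open>D\<close>.\<close>

definition counit where "counit D = I (Ups_obj D) \<odot> comparison D"

lemma Ups_morita: "is_dadj X Y D \<Longrightarrow> is_morita X Y (Ups_obj D)"
  by (rule double_adjunction.Ups_morita[OF double_adjunction.intro])

lemma comparison_functor: "is_dadj X Y D \<Longrightarrow> is_functor (comparison D) (ZC D) (EM (Ups_obj D))"
  using over_EM.F[OF comparison_over_EM] .

lemma counit_mor:
  assumes D: "is_dadj X Y D"
  shows "is_dadj_mor (\<Gamma> (Ups_obj D)) D (counit D)" "Ups_mor (\<Gamma> (Ups_obj D)) (counit D) D = morita_id (Ups_obj D)"
proof -
  note M = Ups_morita[OF D] and K = comparison_functor[OF D]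
  have "J (Ups_obj D) \<odot> counit D = EM_func (Ups_obj D) (morita_id (Ups_obj D)) (Ups_obj D) \<odot> comparison D"
    by (simp add: counit_def EM_func_id[OF M] J_I_comp[OF M K] fcomp_idf[OF K])
  note h = Ups_mor_over[OF Gam_over[OF M] comparison_over_EM[OF D] morita_mor_id[OF M] _ this]
  show "is_dadj_mor (\<Gamma> (Ups_obj D)) D (counit D)" "Ups_mor (\<Gamma> (Ups_obj D)) (counit D) D = morita_id (Ups_obj D)"
    by (rule h; simp add: counit_def fcomp_functor[OF K I_functor[OF M]])+
qed

lemma counit_Gam: "is_morita X Y M \<Longrightarrow> counit (\<Gamma> M) = idf (ZC (\<Gamma> M))"
  by (simp add: counit_def Ups_Gam comparison_Gam I_J)

lemma counit_natural:
  assumes D: "is_dadj X Y D" and D': "is_dadj X Y D'" and H: "is_dadj_mor D D' H"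
  shows "Gam_mor io ia (Ups_obj D) (Ups_mor D H D') (Ups_obj D') \<odot> counit D' = counit D \<odot> H"
proof -
  note M = Ups_morita[OF D] and M' = Ups_morita[OF D'] and K = comparison_functor[OF D] and K' = comparison_functor[OF D']
  note E = EM_func_functor[OF M M' Ups_mor_morita[OF assms]]
  note IK = fcomp_functor[OF K' I_functor[OF M']]
  have Hf: "is_functor H (ZC D') (ZC D)" using H by (simp add: is_dadj_mor_def)
  show ?thesis
    unfolding Gam_mor_def counit_def
    using fcomp_assoc[OF IK fcomp_functor[OF J_functor[OF M'] E] I_functor[OF M]]
      fcomp_assoc[OF IK J_functor[OF M'] E] fcomp_assoc[OF Hf K I_functor[OF M]]
    by (simp add: J_I_comp[OF M' K'] comparison_natural[OF assms])
qed

text \<open>Invertibility of the counit in the category of double adjunctions.  The inverse is a strict inverse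
  of the functor \<open>counit D\<close>, whereas moritability only provides one up to isomorphism.\<close>

definition invertible where
  "invertible D \<longleftrightarrow> (\<exists>\<delta>. is_dadj_mor D (\<Gamma> (Ups_obj D)) \<delta> \<and>
     counit D \<odot> \<delta> = idf (ZC (\<Gamma> (Ups_obj D))) \<and> \<delta> \<odot> counit D = idf (ZC D))"

lemma invertible_imp_moritable:
  assumes D: "is_dadj X Y D" and i: "invertible D"
  shows "moritable D"
proof -
  note M = Ups_morita[OF D] and K = comparison_functor[OF D]
  note I = I_functor[OF M] and J = J_functor[OF M]
  obtain \<delta> where d: "is_functor \<delta> (ZC (\<Gamma> (Ups_obj D))) (ZC D)"
    and e: "counit D \<odot> \<delta> = idf (ZC (\<Gamma> (Ups_obj D)))" "\<delta> \<odot> counit D = idf (ZC D)"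
    using i by (auto simp: invertible_def is_dadj_mor_def)
  let ?G = "\<delta> \<odot> I (Ups_obj D)"
  note G = fcomp_functor[OF I d]
  have "?G \<odot> comparison D = idf (ZC D)"
    using fcomp_assoc[OF K I d] e(2) by (simp add: counit_def)
  moreover have "comparison D \<odot> ?G = idf (EM (Ups_obj D))"
  proof -
    have "comparison D \<odot> \<delta> = J (Ups_obj D)"
      using J_I_comp[OF M fcomp_functor[OF d K]] fcomp_assoc[OF d K I] e(1) by (simp add: counit_def fcomp_idf[OF J])
    then show ?thesis using fcomp_assoc[OF I d K] by (simp add: J_I[OF M])
  qed
  ultimately have "inverse_equivalences (comparison D) ?G"
    using K G functor_simps(1,2)[OF K] naturally_isomorphic_refl[OF idf_functor[OF functor_cat(1)[OF K]]]
      naturally_isomorphic_refl[OF idf_functor[OF functor_cat(2)[OF K]]]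
    by (simp add: inverse_equivalences_def)
  then show ?thesis by (auto simp: moritable_def is_equivalence_def)
qed

lemma invertibleI:
  assumes D: "is_dadj X Y D" and K: "full (comparison D)" "faithful (comparison D)"
    "bij_betw (Fo (comparison D)) (Obj (ZC D)) (Obj (EM (Ups_obj D)))"
  shows "invertible D"
proof -
  note M = Ups_morita[OF D] and Kf = comparison_functor[OF D]
  note I = I_functor[OF M] and J = J_functor[OF M]
  interpret D: over_EM X Y "Ups_obj D" D "comparison D" by (rule comparison_over_EM[OF D])
  interpret G: over_EM X Y "Ups_obj D" "\<Gamma> (Ups_obj D)" "J (Ups_obj D)" by (rule Gam_over[OF M])
  obtain G where G: "is_functor G (EM (Ups_obj D)) (ZC D)" "G \<odot> comparison D = idf (ZC D)"
    "comparison D \<odot> G = idf (EM (Ups_obj D))"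
    by (rule bijective_functor_inverse[OF Kf K])
  note GJ = fcomp_functor[OF J G(1)]
  have KGJ: "comparison D \<odot> (G \<odot> J (Ups_obj D)) = J (Ups_obj D)"
    using fcomp_assoc[OF J G(1) Kf] by (simp add: G fcomp_idf[OF J])
  have "is_dadj_mor D (\<Gamma> (Ups_obj D)) (G \<odot> J (Ups_obj D))"
    using GJ fcomp_assoc[OF GJ Kf D.UA_functor] fcomp_assoc[OF GJ Kf D.UB_functor]
    by (simp add: is_dadj_mor_def D.R G.R KGJ)
  moreover have "counit D \<odot> (G \<odot> J (Ups_obj D)) = idf (ZC (\<Gamma> (Ups_obj D)))"
    unfolding counit_def using fcomp_assoc[OF GJ Kf I] by (simp add: KGJ I_J[OF M])
  moreover have "(G \<odot> J (Ups_obj D)) \<odot> counit D = idf (ZC D)"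
    unfolding counit_def using fcomp_assoc[OF fcomp_functor[OF Kf I] J G(1)] by (simp add: J_I_comp[OF M Kf] G)
  ultimately show ?thesis by (auto simp: invertible_def)
qed

text \<open>Equivalence and isomorphism of categories differ for a single comparison functor \<open>K\<close>, but not for
  all of them together.  If \<open>K\<close> is an equivalence that is not injective on objects, choose
  \<open>z \<noteq> z'\<close> with the same image: the free modules have preimages different from \<open>z'\<close>, where \<open>z\<close> takes
  the place of \<open>z'\<close>.  If it is not surjective, choose a module \<open>e\<close> that it misses: free modules lie in
  the image of \<open>K\<close> and are therefore different from \<open>e\<close>, while \<open>e\<close> is isomorphic to some \<open>Kz\<close>.  In both
  cases, removing arrows produces a pre-torsor that is not moritable.\<close>

lemma invertible_if_all_moritable:
  assumes D: "is_dadj X Y D" and \<tau>: "is_pretorsor_structure D \<tau>"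
    and all: "\<And>D' :: ('xo, 'xa, 'yo, 'ya, 'zo, 'za) dadj. is_dadj X Y D' \<Longrightarrow> is_pretorsor_structure D' \<tau> \<Longrightarrow> moritable D'"
  shows "invertible D"
proof -
  define K where "K = comparison D"
  define M where "M = Ups_obj D"
  have M: "is_morita X Y M" unfolding M_def by (rule Ups_morita[OF D])
  have K: "is_functor K (ZC D) (EM M)" unfolding K_def M_def by (rule comparison_functor[OF D])
  interpret D: over_EM X Y M D K unfolding M_def K_def by (rule comparison_over_EM[OF D])
  interpret E: image_category io ia "EM M" by (rule image[OF M])
  obtain G where eq: "inverse_equivalences K G"
    using all[OF D \<tau>] by (auto simp: moritable_def is_equivalence_def K_def)
  have ff: "full K" "faithful K" using inverse_equivalences_full[OF eq] inverse_equivalences_faithful[OF eq] .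
  have no: False if "is_dadj X Y D'" "Ups_obj D' = M" "\<not> moritable D'" for D' :: "('xo, 'xa, 'yo, 'ya, 'zo, 'za) dadj"
  proof -
    have "is_shepherd M \<tau>" using D.pretorsor_iff_shepherd \<tau> by (simp add: M_def)
    then show False
      using all[OF that(1)] that double_adjunction.pretorsor_iff_shepherd[OF double_adjunction.intro[OF that(1)]] by simp
  qed
  have "inj_on (Fo K) (Obj (ZC D))"
  proof (rule inj_onI, rule ccontr)
    fix z z' assume z: "z \<in> Obj (ZC D)" "z' \<in> Obj (ZC D)" "Fo K z = Fo K z'" "z \<noteq> z'"
    let ?a = "\<lambda>x. if Fo (LA D) x = z' then z else Fo (LA D) x"
    let ?b = "\<lambda>y. if Fo (LB D) y = z' then z else Fo (LB D) y"
    show False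
    proof (rule D.exists_not_moritable[OF K ff z(2,1,4), of "Ide (EM M) (Fo K z)" ?a ?b])
      show "Ide (EM M) (Fo K z) \<in> Hom (EM M) (Fo K z') (Fo K z)"
        using z functor_simps(3)[OF K z(1)] by (simp add: Hom_iff cat_simps[OF D.EM_category])
      show "?a x \<in> Obj (ZC D) \<and> ?a x \<noteq> z' \<and> Fo K (?a x) = GA_obj M x" if "x \<in> Obj X" for x
        using that z D.L_simps(1)[OF that] functor_simps(3)[OF D.A.L that] by auto
      show "?b y \<in> Obj (ZC D) \<and> ?b y \<noteq> z' \<and> Fo K (?b y) = GB_obj M y" if "y \<in> Obj Y" for y
        using that z D.L_simps(3)[OF that] functor_simps(3)[OF D.B.L that] by auto
    qed (rule no)
  qed
  moreover have "Fo K ` Obj (ZC D) = Obj (EM M)"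
  proof (intro equalityI subsetI)
    fix e assume e: "e \<in> Obj (EM M)"
    show "e \<in> Fo K ` Obj (ZC D)"
    proof (rule ccontr)
      assume n: "e \<notin> Fo K ` Obj (ZC D)"
      obtain z f g where z: "z \<in> Obj (ZC D)" and f: "inverse_arrows (EM M) f g" "Dom (EM M) f = e" "Cod (EM M) f = Fo K z"
        by (rule inverse_equivalences_surjective[OF eq K e])
      have Kz: "Fo K z \<in> Obj (EM M)" using functor_simps(3)[OF K z] .
      show False
      proof (rule D.exists_not_moritable[OF E.from_image_functor inverse_equivalences_full[OF E.from_image_equivalence]
            inverse_equivalences_faithful[OF E.from_image_equivalence],
            of "io e" "io (Fo K z)" f "\<lambda>x. io (GA_obj M x)" "\<lambda>y. io (GB_obj M y)"])
        show "io e \<in> Obj (image_cat io ia (EM M))" "io (Fo K z) \<in> Obj (image_cat io ia (EM M))" "io (Fo K z) \<noteq> io e"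
          using e Kz n z by (auto simp: E.img_simps(1) E.io_eq)
        show "f \<in> Hom (EM M) (Fo (J M) (io e)) (Fo (J M) (io (Fo K z)))"
          using f e Kz by (simp add: E.from_image_simps inverse_arrows_def Hom_iff)
        show "io (GA_obj M x) \<in> Obj (image_cat io ia (EM M)) \<and> io (GA_obj M x) \<noteq> io e \<and> Fo (J M) (io (GA_obj M x)) = GA_obj M x"
          if x: "x \<in> Obj X" for x
        proof -
          have "GA_obj M x \<in> Obj (EM M)" using D.GA_emobj[OF x] by (simp add: D.EM_simps)
          moreover have "GA_obj M x \<noteq> e"
            using n D.L_simps(1)[OF x] functor_simps(3)[OF D.A.L x] by (metis imageI)
          ultimately show ?thesis by (simp add: E.img_simps(1) E.io_eq E.from_image_simps)
        qed
        show "io (GB_obj M y) \<in> Obj (image_cat io ia (EM M)) \<and> io (GB_obj M y) \<noteq> io e \<and> Fo (J M) (io (GB_obj M y)) = GB_obj M y"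
          if y: "y \<in> Obj Y" for y
        proof -
          have "GB_obj M y \<in> Obj (EM M)" using D.GB_emobj[OF y] by (simp add: D.EM_simps)
          moreover have "GB_obj M y \<noteq> e"
            using n D.L_simps(3)[OF y] functor_simps(3)[OF D.B.L y] by (metis imageI)
          ultimately show ?thesis by (simp add: E.img_simps(1) E.io_eq E.from_image_simps)
        qed
      qed (rule no)
    qed
  qed (use functor_simps(3)[OF K] in auto)
  ultimately show ?thesis
    using invertibleI[OF D] ff by (simp add: K_def M_def bij_betw_def)
qed

end

context universe
begin

lemma Gam_shepherd: "is_morita X Y M \<Longrightarrow> is_pretorsor_structure (\<Gamma> M) \<gamma> \<longleftrightarrow> is_shepherd M \<gamma>"
  using double_adjunction.pretorsor_iff_shepherd[OF double_adjunction.intro[OF Gam_dadj]] by (simp add: Ups_Gam)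

lemma Ups_shepherd: "is_dadj X Y D \<Longrightarrow> is_shepherd (Ups_obj D) \<tau> \<longleftrightarrow> is_pretorsor_structure D \<tau>"
  using double_adjunction.pretorsor_iff_shepherd[OF double_adjunction.intro] by blast

lemma Gam_bar_functor: "is_functor (Gam_bar io ia X Y) (Herd X Y) (PreTor X Y)"
  unfolding Gam_bar_def Herd_eq
  by (rule hom_cat_functor[OF Herd_category[unfolded Herd_eq] PreTor_category];
      auto simp: PreTor_eq Hom_iff Gam_dadj Gam_mor Gam_mor_id Gam_mor_comp Gam_shepherd)

lemma PreTor_simps:
  "(D, \<tau>) \<in> Obj (PreTor X Y) \<longleftrightarrow> is_dadj X Y D \<and> is_pretorsor_structure D \<tau>"
  "((D, \<tau>), F, (D', \<tau>')) \<in> Arr (PreTor X Y) \<longleftrightarrow> is_dadj X Y D \<and> is_pretorsor_structure D \<tau> \<and>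
     is_dadj X Y D' \<and> is_pretorsor_structure D' \<tau>' \<and> is_dadj_mor D D' F \<and> preserves_shepherd (Ups_mor D F D') \<tau> \<tau>'"
  "((D, \<tau>), F, (D', \<tau>')) \<in> Arr (PreTor X Y) \<Longrightarrow> Dom (PreTor X Y) ((D, \<tau>), F, (D', \<tau>')) = (D, \<tau>)"
  "((D, \<tau>), F, (D', \<tau>')) \<in> Arr (PreTor X Y) \<Longrightarrow> Cod (PreTor X Y) ((D, \<tau>), F, (D', \<tau>')) = (D', \<tau>')"
  "is_dadj X Y D \<Longrightarrow> is_pretorsor_structure D \<tau> \<Longrightarrow> Ide (PreTor X Y) (D, \<tau>) = ((D, \<tau>), idf (ZC D), (D, \<tau>))"
  "((D, \<tau>), F, (D', \<tau>')) \<in> Arr (PreTor X Y) \<Longrightarrow> ((D', \<tau>'), F', (D'', \<tau>'')) \<in> Arr (PreTor X Y) \<Longrightarrow>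
     ((D', \<tau>'), F', (D'', \<tau>'')) \<cdot>\<^bsub>PreTor X Y\<^esub> ((D, \<tau>), F, (D', \<tau>')) = ((D, \<tau>), F \<odot> F', (D'', \<tau>''))"
  by (auto simp: PreTor_eq)

lemma functor_values:
  "(D, \<tau>) \<in> Obj (PreTor X Y) \<Longrightarrow> Fo (Ups_bar X Y) (D, \<tau>) = (Ups_obj D, \<tau>)"
  "(M, \<tau>) \<in> Obj (Herd X Y) \<Longrightarrow> Fo (Gam_bar io ia X Y) (M, \<tau>) = (\<Gamma> M, \<tau>)"
  "((D, \<tau>), F, (D', \<tau>')) \<in> Arr (PreTor X Y) \<Longrightarrow>
     Fa (Ups_bar X Y) ((D, \<tau>), F, (D', \<tau>')) = ((Ups_obj D, \<tau>), Ups_mor D F D', (Ups_obj D', \<tau>'))"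
  "((M, \<tau>), \<phi>, (M', \<tau>')) \<in> Arr (Herd X Y) \<Longrightarrow>
     Fa (Gam_bar io ia X Y) ((M, \<tau>), \<phi>, (M', \<tau>')) = ((\<Gamma> M, \<tau>), Gam_mor io ia M \<phi> M', (\<Gamma> M', \<tau>'))"
  by (simp_all add: Ups_bar_def Gam_bar_def)

lemma counit_arr_bar:
  assumes "is_dadj X Y D" "is_pretorsor_structure D \<tau>"
  shows "((\<Gamma> (Ups_obj D), \<tau>), counit D, (D, \<tau>)) \<in> Arr (PreTor X Y)"
  using assms preserves_shepherd_id[OF Ups_morita[OF assms(1)]]
  by (simp add: PreTor_simps Gam_dadj Ups_morita counit_mor Gam_shepherd Ups_shepherd)

lemma Herd_arr: "((M, \<tau>), \<phi>, (M', \<tau>')) \<in> Arr (Herd X Y) \<longleftrightarrow> is_morita X Y M \<and> is_shepherd M \<tau> \<and>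
    is_morita X Y M' \<and> is_shepherd M' \<tau>' \<and> is_morita_mor M M' \<phi> \<and> preserves_shepherd \<phi> \<tau> \<tau>'"
  by (auto simp: Herd_eq)

lemma Herd_obj: "(M, \<tau>) \<in> Obj (Herd X Y) \<longleftrightarrow> is_morita X Y M \<and> is_shepherd M \<tau>"
  by (simp add: Herd_eq)

abbreviation Gam_bar_eps where "Gam_bar_eps \<equiv> mk_nt (Gam_bar io ia X Y \<odot> Ups_bar X Y) (idf (PreTor X Y))
    (\<lambda>(D, \<tau>). ((\<Gamma> (Ups_obj D), \<tau>), counit D, (D, \<tau>)))"

sublocale bar: identity_unit_adjunction "Herd X Y" "PreTor X Y" "Gam_bar io ia X Y" "Ups_bar X Y" Gam_bar_eps
proof
  note [simp] = functor_simps(1,2)[OF Gam_bar_functor] functor_simps(1,2)[OF Ups_bar_functor]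
  show "is_functor (Gam_bar io ia X Y) (Herd X Y) (PreTor X Y)" by (rule Gam_bar_functor)
  show "is_functor (Ups_bar X Y) (PreTor X Y) (Herd X Y)" by (rule Ups_bar_functor)
  show "Ups_bar X Y \<odot> Gam_bar io ia X Y = idf (Herd X Y)"
  proof (rule func_eqI[OF fcomp_functor[OF Gam_bar_functor Ups_bar_functor] idf_functor[OF Herd_category]])
    show "Fo (Ups_bar X Y \<odot> Gam_bar io ia X Y) m = Fo (idf (Herd X Y)) m" if "m \<in> Obj (Herd X Y)" for m
      using that by (cases m) (simp add: functor_values Herd_obj PreTor_simps Gam_dadj Ups_Gam Gam_shepherd)
    show "Fa (Ups_bar X Y \<odot> Gam_bar io ia X Y) a = Fa (idf (Herd X Y)) a" if a: "a \<in> Arr (Herd X Y)" for a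
    proof -
      obtain M \<tau> \<phi> M' \<tau>' where A: "a = ((M, \<tau>), \<phi>, (M', \<tau>'))" by (cases a) auto
      show ?thesis
        using a unfolding A by (simp add: functor_values Herd_arr PreTor_simps Gam_dadj Ups_Gam Gam_mor Gam_shepherd)
    qed
  qed
  show "is_nt Gam_bar_eps (Gam_bar io ia X Y \<odot> Ups_bar X Y) (idf (PreTor X Y))"
  proof (rule mk_nt_nt[OF fcomp_functor[OF Ups_bar_functor Gam_bar_functor] idf_functor[OF PreTor_category]])
    fix d :: "('xo, 'xa, 'yo, 'ya, 'zo, 'za) pretor" assume d: "d \<in> Obj (PreTor X Y)"
    obtain D \<tau> where "d = (D, \<tau>)" by (cases d) auto
    then show "(case d of (D, \<tau>) \<Rightarrow> ((\<Gamma> (Ups_obj D), \<tau>), counit D, (D, \<tau>))) \<in> Arr (PreTor X Y) \<and>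
        Dom (PreTor X Y) (case d of (D, \<tau>) \<Rightarrow> ((\<Gamma> (Ups_obj D), \<tau>), counit D, (D, \<tau>))) = Fo (Gam_bar io ia X Y \<odot> Ups_bar X Y) d \<and>
        Cod (PreTor X Y) (case d of (D, \<tau>) \<Rightarrow> ((\<Gamma> (Ups_obj D), \<tau>), counit D, (D, \<tau>))) = Fo (idf (PreTor X Y)) d"
      using d counit_arr_bar[of D \<tau>]
      by (simp add: PreTor_simps(1,3,4) functor_values Ups_morita Herd_obj Ups_shepherd)
  next
    fix a :: "('xo, 'xa, 'yo, 'ya, 'zo, 'za) pretor_arr" assume a: "a \<in> Arr (PreTor X Y)"
    obtain D \<tau> H D' \<tau>' where A: "a = ((D, \<tau>), H, (D', \<tau>'))" by (cases a) auto
    have h: "is_dadj X Y D" "is_pretorsor_structure D \<tau>" "is_dadj X Y D'" "is_pretorsor_structure D' \<tau>'"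
      "is_dadj_mor D D' H" "preserves_shepherd (Ups_mor D H D') \<tau> \<tau>'" using a by (simp_all add: A PreTor_simps)
    have g: "((\<Gamma> (Ups_obj D), \<tau>), Gam_mor io ia (Ups_obj D) (Ups_mor D H D') (Ups_obj D'), (\<Gamma> (Ups_obj D'), \<tau>')) \<in> Arr (PreTor X Y)"
      using h by (simp add: PreTor_simps Gam_dadj Ups_morita Gam_mor Ups_mor_morita Gam_shepherd Ups_shepherd)
    have u: "((Ups_obj D, \<tau>), Ups_mor D H D', (Ups_obj D', \<tau>')) \<in> Arr (Herd X Y)"
      using h by (simp add: Herd_arr Ups_morita Ups_mor_morita Ups_shepherd)
    show "(case Cod (PreTor X Y) a of (D, \<tau>) \<Rightarrow> ((\<Gamma> (Ups_obj D), \<tau>), counit D, (D, \<tau>))) \<cdot>\<^bsub>PreTor X Y\<^esub>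
          Fa (Gam_bar io ia X Y \<odot> Ups_bar X Y) a
        = Fa (idf (PreTor X Y)) a \<cdot>\<^bsub>PreTor X Y\<^esub>
          (case Dom (PreTor X Y) a of (D, \<tau>) \<Rightarrow> ((\<Gamma> (Ups_obj D), \<tau>), counit D, (D, \<tau>)))"
      using h a unfolding A
      by (simp add: PreTor_simps(3,4) functor_values u
          PreTor_simps(6)[OF g counit_arr_bar[OF h(3,4)]] PreTor_simps(6)[OF counit_arr_bar[OF h(1,2)]] counit_natural)
  qed
  show "Fa (Ups_bar X Y) (At Gam_bar_eps d) = Ide (Herd X Y) (Fo (Ups_bar X Y) d)" if d: "d \<in> Obj (PreTor X Y)" for d
  proof -
    obtain D \<tau> where D: "d = (D, \<tau>)" by (cases d) auto
    show ?thesis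
      using d counit_arr_bar[of D \<tau>] unfolding D
      by (simp add: PreTor_simps(1) functor_values counit_mor Ups_Gam Ups_morita)
        (simp add: Herd_eq Ups_morita Ups_shepherd)
  qed
  show "At Gam_bar_eps (Fo (Gam_bar io ia X Y) m) = Ide (PreTor X Y) (Fo (Gam_bar io ia X Y) m)" if m: "m \<in> Obj (Herd X Y)" for m
    using m by (cases m) (simp add: Herd_obj functor_values PreTor_simps Gam_dadj Ups_Gam counit_Gam Gam_shepherd)
qed

section \<open>Invertibility of the counit\<close>

lemma invertible_iff_PreTor:
  assumes D: "is_dadj X Y D" "is_pretorsor_structure D \<tau>"
  shows "(\<exists>h. inverse_arrows (PreTor X Y) ((\<Gamma> (Ups_obj D), \<tau>), counit D, (D, \<tau>)) h) \<longleftrightarrow> invertible D"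
proof
  note c = counit_arr_bar[OF D]
  assume "\<exists>h. inverse_arrows (PreTor X Y) ((\<Gamma> (Ups_obj D), \<tau>), counit D, (D, \<tau>)) h"
  then obtain D1 \<tau>1 \<delta> D2 \<tau>2 where "inverse_arrows (PreTor X Y) ((\<Gamma> (Ups_obj D), \<tau>), counit D, (D, \<tau>)) ((D1, \<tau>1), \<delta>, (D2, \<tau>2))" by auto
  moreover from this have "D1 = D" "D2 = \<Gamma> (Ups_obj D)" "\<tau>1 = \<tau>" "\<tau>2 = \<tau>" "((D, \<tau>), \<delta>, (\<Gamma> (Ups_obj D), \<tau>)) \<in> Arr (PreTor X Y)"
    using PreTor_simps(3,4)[OF c] by (auto simp: inverse_arrows_def PreTor_simps(3,4))
  ultimately show "invertible D"
    using D PreTor_simps(3,4)[OF c] PreTor_simps(6)[OF c] PreTor_simps(6)[OF _ c]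
    by (auto simp: inverse_arrows_def invertible_def PreTor_simps(2,5) Gam_dadj Ups_morita)
next
  note c = counit_arr_bar[OF D]
  assume "invertible D"
  then obtain \<delta> where d: "is_dadj_mor D (\<Gamma> (Ups_obj D)) \<delta>"
    "counit D \<odot> \<delta> = idf (ZC (\<Gamma> (Ups_obj D)))" "\<delta> \<odot> counit D = idf (ZC D)" by (auto simp: invertible_def)
  note M = Ups_morita[OF D(1)] and G = Gam_dadj[OF Ups_morita[OF D(1)]]
  \<comment> \<open>the inverse induces the inverse of the identity, and so preserves every shepherd\<close>
  have "Ups_mor D \<delta> (\<Gamma> (Ups_obj D)) = morita_id (Ups_obj D)"
    using Ups_mor_comp[OF D(1) G D(1) d(1) counit_mor(1)[OF D(1)]] Ups_mor_id[OF D(1)]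
      morita_comp_id(2)[OF Ups_mor_morita[OF D(1) G d(1)]]
    by (simp add: d counit_mor[OF D(1)] Ups_Gam[OF M])
  then have a: "((D, \<tau>), \<delta>, (\<Gamma> (Ups_obj D), \<tau>)) \<in> Arr (PreTor X Y)"
    using D d preserves_shepherd_id[OF M] by (simp add: PreTor_simps Gam_dadj Ups_morita Gam_shepherd Ups_shepherd)
  show "\<exists>h. inverse_arrows (PreTor X Y) ((\<Gamma> (Ups_obj D), \<tau>), counit D, (D, \<tau>)) h"
    using a c d D PreTor_simps(6)[OF a c] PreTor_simps(6)[OF c a]
    by (intro exI[of _ "((D, \<tau>), \<delta>, (\<Gamma> (Ups_obj D), \<tau>))"])
      (simp add: inverse_arrows_def PreTor_simps(3-5) Gam_dadj Ups_morita Gam_shepherd Ups_shepherd)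
qed

text \<open>If \<open>\<Gamma>\<close> and \<open>\<Upsilon>\<close> are inverse equivalences, then \<open>\<Upsilon>\<close> is fully faithful, so that the inverse of the
  counit is the morphism over the identity.\<close>

lemma invertible_if_equivalences:
  assumes e: "inverse_equivalences (Gam io ia X Y) (Ups X Y)" and D: "is_dadj X Y (D :: ('xo, 'xa, 'yo, 'ya, 'zo, 'za) dadj)"
  shows "invertible D"
proof -
  note s = inverse_equivalences_sym[OF e]
  note full = inverse_equivalences_full[OF s] and faithful = inverse_equivalences_faithful[OF s]
  note M = Ups_morita[OF D] and c = counit_mor[OF D]
  note G = Gam_dadj[OF M] and UG = Ups_Gam[OF M]
  have arr: "(D1, F, D2) \<in> Arr (Adj X Y) \<longleftrightarrow> is_dadj X Y D1 \<and> is_dadj X Y D2 \<and> is_dadj_mor D1 D2 F"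
    for D1 F D2 by (simp add: Adj_def)
  have adj_obj: "D1 \<in> Obj (Adj X Y) \<longleftrightarrow> is_dadj X Y D1" for D1 by (simp add: Adj_def)
  \<comment> \<open>parallel morphisms are equal if they induce the same Morita morphism\<close>
  have eqI: "F = F'" if "is_dadj X Y D1" "is_dadj X Y D2" "is_dadj_mor D1 D2 F" "is_dadj_mor D1 D2 F'"
    "Ups_mor D1 F D2 = Ups_mor D1 F' D2" for D1 D2 :: "('xo, 'xa, 'yo, 'ya, 'zo, 'za) dadj" and F F'
  proof -
    have "(D1, F, D2) = (D1, F', D2)"
    proof (rule faithfulD[OF faithful Ups_functor])
      show f: "(D1, F, D2) \<in> Arr (Adj X Y)" "(D1, F', D2) \<in> Arr (Adj X Y)" using that by (simp_all add: arr)
      show "Dom (Adj X Y) (D1, F, D2) = Dom (Adj X Y) (D1, F', D2)" "Cod (Adj X Y) (D1, F, D2) = Cod (Adj X Y) (D1, F', D2)"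
        using that by (simp_all add: Adj_def)
      show "Fa (Ups X Y) (D1, F, D2) = Fa (Ups X Y) (D1, F', D2)" using f that(5) by (simp add: Ups_def)
    qed
    then show ?thesis by simp
  qed
  let ?h = "(Ups_obj D, morita_id (Ups_obj D), Ups_obj D)"
  have h: "?h \<in> Hom (Mor X Y) (Fo (Ups X Y) D) (Fo (Ups X Y) (\<Gamma> (Ups_obj D)))"
    using D G M UG morita_mor_id[OF M] by (simp add: Hom_iff Mor_def Ups_def Adj_def)
  obtain a where a: "a \<in> Hom (Adj X Y) D (\<Gamma> (Ups_obj D))" "Fa (Ups X Y) a = ?h"
    by (rule fullD[OF full Ups_functor _ _ h]) (simp_all only: adj_obj D G)
  obtain D1 \<delta> D2 where A: "a = (D1, \<delta>, D2)" by (cases a)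
  have aA: "(D1, \<delta>, D2) \<in> Arr (Adj X Y)" using a(1) by (simp add: A Hom_iff)
  then have "D1 = D" "D2 = \<Gamma> (Ups_obj D)" using a(1) by (simp_all add: A Hom_iff arr Adj_def)
  with aA a(2) have \<delta>: "is_dadj_mor D (\<Gamma> (Ups_obj D)) \<delta>" "Ups_mor D \<delta> (\<Gamma> (Ups_obj D)) = morita_id (Ups_obj D)"
    by (simp_all add: A arr Ups_def)
  have id: "morita_comp (morita_id (Ups_obj D)) (morita_id (Ups_obj D)) = morita_id (Ups_obj D)"
    by (rule morita_comp_id(1)[OF morita_mor_id[OF M]])
  have "counit D \<odot> \<delta> = idf (ZC (\<Gamma> (Ups_obj D)))"
    by (rule eqI[OF G G dadj_mor_comp[OF G c(1) \<delta>(1)] dadj_mor_id[OF G]])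
      (simp add: Ups_mor_comp[OF G D G c(1) \<delta>(1)] Ups_mor_id[OF G] UG \<delta> c id)
  moreover have "\<delta> \<odot> counit D = idf (ZC D)"
    by (rule eqI[OF D D dadj_mor_comp[OF D \<delta>(1) c(1)] dadj_mor_id[OF D]])
      (simp add: Ups_mor_comp[OF D G D \<delta>(1) c(1)] Ups_mor_id[OF D] \<delta> c id)
  ultimately show ?thesis using \<delta> by (auto simp: invertible_def)
qed

lemma bar_equivalences_iff:
  "inverse_equivalences (Gam_bar io ia X Y) (Ups_bar X Y) \<longleftrightarrow>
     (\<forall>(D :: ('xo, 'xa, 'yo, 'ya, 'zo, 'za) dadj) \<tau>. is_dadj X Y D \<and> is_pretorsor_structure D \<tau> \<longrightarrow> invertible D)"
  using invertible_iff_PreTor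
  by (simp add: bar.inverse_equivalences_iff PreTor_simps(1) Ball_def functor_simps(1)[OF Ups_bar_functor] cong: imp_cong)

end

theorem corollary5p5p1:
  fixes X :: "('xo, 'xa) cat"
    and Y :: "('yo, 'ya) cat"
    and io :: "('xo, 'xa, 'yo, 'ya) emobj \<Rightarrow> 'zo"
    and ia :: "('xo, 'xa, 'yo, 'ya) emarr \<Rightarrow> 'za"
  assumes "category X" and "category Y"
    and "inj io" and "inj ia"
  shows "adjoint_pair (Gam_bar io ia X Y) (Ups_bar X Y)
       \<and> full (Gam_bar io ia X Y) \<and> faithful (Gam_bar io ia X Y)
       \<and> (inverse_equivalences (Gam_bar io ia X Y) (Ups_bar X Y) \<longleftrightarrow>
            (\<forall>(D :: ('xo, 'xa, 'yo, 'ya, 'zo, 'za) dadj) \<tau>.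
               (D, \<tau>) \<in> Obj (PreTor X Y) \<longrightarrow> moritable D))
       \<and> (inverse_equivalences (Gam io ia X Y) (Ups X Y) \<longrightarrow>
            inverse_equivalences (Gam_bar io ia X Y) (Ups_bar X Y))"
proof -
  interpret universe X Y io ia by (rule universe.intro[OF assms(3,4)])
  have "inverse_equivalences (Gam_bar io ia X Y) (Ups_bar X Y) \<longleftrightarrow>
      (\<forall>(D :: ('xo, 'xa, 'yo, 'ya, 'zo, 'za) dadj) \<tau>. (D, \<tau>) \<in> Obj (PreTor X Y) \<longrightarrow> moritable D)"
    unfolding bar_equivalences_iff PreTor_simps(1)
    using invertible_imp_moritable invertible_if_all_moritable by blast
  then show ?thesis
    using bar.adjoint bar.full bar.faithful invertible_if_equivalences bar_equivalences_iff by blast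
qed

end
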